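(* Let $\Omega \subset \mathbb{R}^N$ be a bounded Lipschitz domain. Then $L_\Delta$ satisfies the maximum principle in $\Omega$ if one of the following conditions is satisfied: (i) $h_\Omega + \rho_N \ge 0$ on $\Omega$, where $$h_\Omega(x)= c_N \Bigl( \int_{B_1(x)\setminus \Omega} \frac{1}{|x-y|^N}\,dy - \int_{\Omega \setminus B_1(x)} \frac{1}{|x-y|^N}\,dy\Bigr),\qquad x\in\Omega;$$ (ii) $|\Omega| \le 2^N \exp \bigl(\frac{N}{2} \bigl(\psi(\frac{N}{2})-\gamma\bigr)\bigr)\,|B_1(0)|$.
   Context: $N\ge1$; $|\cdot|$ applied to sets is Lebesgue measure; $B_1(x)$ is the open unit ball centered at $x$. $c_N= \pi^{-N/2}\Gamma(N/2)$, $\rho_N=2 \log 2 + \psi(\frac{N}{2}) -\gamma$, where $\psi=\Gamma'/\Gamma$ is the Digamma function and $\gamma=-\Gamma'(1)$ the Euler–Mascheroni constant. Set $$\mathcal{E}_L(u,w)=\frac{c_N}{2}\iint_{|x-y|\le1}\frac{(u(x)-u(y))(w(x)-w(y))}{|x-y|^N}\,dx\,dy-c_N\iint_{|x-y|\ge1}\frac{u(x)w(y)}{|x-y|^N}\,dx\,dy+\rho_N\int_{\mathbb{R}^N}uw\,dx ,$$ with integrals over $x,y\in\mathbb{R}^N$ (the form of the logarithmic Laplacian $L_\Delta$). $L^1_0(\mathbb{R}^N)$ is the space of locally integrable $u:\mathbb{R}^N\to\mathbb{R}$ with $\int_{\mathbb{R}^N}\frac{|u(x)|}{(1+|x|)^N}\,dx<\infty$.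 $\mathcal{V}(\Omega)$ is the space of $u\in L^1_0(\mathbb{R}^N)$ with $\iint_{x,y\in\Omega,\,|x-y|\le1}\frac{(u(x)-u(y))^2}{|x-y|^N}\,dx\,dy+\int_\Omega u^2\,dx<\infty$; $\mathcal{E}_L(u,\phi)$ is well defined for $u\in\mathcal{V}(\Omega)$, $\phi\in C_c^\infty(\Omega)$. For $u\in\mathcal{V}(\Omega)$, $L_\Delta u\ge0$ in $\Omega$ (in weak sense) means $\mathcal{E}_L(u,\phi)\ge0$ for all nonnegative $\phi\in C_c^\infty(\Omega)$. $L_\Delta$ satisfies the maximum principle in $\Omega$ if for every $u\in\mathcal{V}(\Omega)$ with $L_\Delta u\ge0$ in $\Omega$ and $u\ge0$ in $\mathbb{R}^N\setminus\Omega$ we have $u\ge0$ a.e. in $\mathbb{R}^N$. *)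

theory Defs
  imports "HOL-Analysis.Analysis"
begin

definition c_const :: "nat \<Rightarrow> real" where
  "c_const N = pi powr (- (real N / 2)) * Gamma (real N / 2)"

text \<open>The library constant \<open>Digamma\<close> is introduced by a series; it is the logarithmic derivative
  of \<open>Gamma\<close>, see \<open>has_field_derivative_Gamma\<close>.\<close>

definition rho_const :: "nat \<Rightarrow> real" where
  "rho_const N = 2 * ln 2 + Digamma (real N / 2) - euler_mascheroni"

text \<open>
  The integrals are taken with respect to the completed Lebesgue measure, on the Euclidean space
  \<open>'a\<close> and on \<open>'a \<times> 'a\<close>. Since Bochner integrals of non-integrable functions are 0 by convention,
  the form is meaningful only where its three integrals converge absolutely, which is the case
  for \<open>u\<close> in the energy space \<open>V_space \<Omega>\<close> and \<open>w\<close> a test function on \<open>\<Omega>\<close> as defined below.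
\<close>

definition E_L :: "('a::euclidean_space \<Rightarrow> real) \<Rightarrow> ('a \<Rightarrow> real) \<Rightarrow> real" where
  "E_L u w =
     c_const DIM('a) / 2 *
       (LINT p:{(x, y). norm (x - y) \<le> 1}|(lebesgue :: ('a \<times> 'a) measure).
          (case p of (x, y) \<Rightarrow> (u x - u y) * (w x - w y) / norm (x - y) ^ DIM('a)))
   - c_const DIM('a) *
       (LINT p:{(x, y). norm (x - y) \<ge> 1}|(lebesgue :: ('a \<times> 'a) measure).
          (case p of (x, y) \<Rightarrow> u x * w y / norm (x - y) ^ DIM('a)))
   + rho_const DIM('a) * (LINT x|lebesgue. u x * w x)"

definition locally_integrable :: "('a::euclidean_space \<Rightarrow> real) \<Rightarrow> bool" where
  "locally_integrable u \<longleftrightarrow> (\<forall>K. compact K \<longrightarrow> set_integrable lebesgue K u)"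

definition L1_0 :: "('a::euclidean_space \<Rightarrow> real) set" where
  "L1_0 = {u. locally_integrable u \<and>
              integrable lebesgue (\<lambda>x. \<bar>u x\<bar> / (1 + norm x) ^ DIM('a))}"

text \<open>For measurable \<open>u\<close>, integrability of the nonnegative integrands below is finiteness of the
  corresponding integrals.\<close>

definition V_space :: "'a::euclidean_space set \<Rightarrow> ('a \<Rightarrow> real) set" where
  "V_space \<Omega> = {u \<in> L1_0.
     set_integrable (lebesgue :: ('a \<times> 'a) measure)
       {(x, y). x \<in> \<Omega> \<and> y \<in> \<Omega> \<and> norm (x - y) \<le> 1}
       (\<lambda>(x, y). (u x - u y)\<^sup>2 / norm (x - y) ^ DIM('a)) \<and>
     set_integrable lebesgue \<Omega> (\<lambda>x. (u x)\<^sup>2)}"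

text \<open>\<open>C_k k f\<close>: \<open>f\<close> is \<open>k\<close> times continuously differentiable; in finite dimension it is
  enough to require that \<open>f\<close> is differentiable with all directional derivatives of class \<open>k - 1\<close>.\<close>

primrec C_k :: "nat \<Rightarrow> ('a::euclidean_space \<Rightarrow> real) \<Rightarrow> bool" where
  "C_k 0 f \<longleftrightarrow> continuous_on UNIV f"
| "C_k (Suc k) f \<longleftrightarrow> f differentiable_on UNIV \<and> (\<forall>v. C_k k (\<lambda>x. frechet_derivative f (at x) v))"

text \<open>Smooth functions with compact support in \<open>\<Omega>\<close>, extended by 0 to the whole space.\<close>

definition test_functions :: "'a::euclidean_space set \<Rightarrow> ('a \<Rightarrow> real) set" where
  "test_functions \<Omega> = {\<phi>. (\<forall>k. C_k k \<phi>) \<and>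
     compact (closure {x. \<phi> x \<noteq> 0}) \<and> closure {x. \<phi> x \<noteq> 0} \<subseteq> \<Omega>}"

definition L_Delta_nonneg :: "'a::euclidean_space set \<Rightarrow> ('a \<Rightarrow> real) \<Rightarrow> bool" where
  "L_Delta_nonneg \<Omega> u \<longleftrightarrow>
     (\<forall>\<phi> \<in> test_functions \<Omega>. (\<forall>x. \<phi> x \<ge> 0) \<longrightarrow> E_L u \<phi> \<ge> 0)"

text \<open>Elements of \<open>V_space \<Omega>\<close> stand for their classes modulo null sets, so the sign condition
  outside \<open>\<Omega>\<close> is required almost everywhere.\<close>

definition maximum_principle :: "'a::euclidean_space set \<Rightarrow> bool" where
  "maximum_principle \<Omega> \<longleftrightarrow>
     (\<forall>u \<in> V_space \<Omega>. L_Delta_nonneg \<Omega> u \<and> (AE x in lebesgue. x \<notin> \<Omega> \<longrightarrow> u x \<ge> 0) \<longrightarrow>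
        (AE x in lebesgue. u x \<ge> 0))"

text \<open>Near each boundary point, \<open>\<Omega>\<close> is the part above the graph of a Lipschitz function
  over the hyperplane orthogonal to some unit vector \<open>e\<close>; the point of that hyperplane below \<open>x\<close>
  is \<open>x - (x \<bullet> e) *\<^sub>R e\<close>.\<close>

definition bounded_lipschitz_domain :: "'a::euclidean_space set \<Rightarrow> bool" where
  "bounded_lipschitz_domain \<Omega> \<longleftrightarrow>
     bounded \<Omega> \<and> open \<Omega> \<and> connected \<Omega> \<and> \<Omega> \<noteq> {} \<and>
     (\<forall>p \<in> frontier \<Omega>. \<exists>U e L g.
        open U \<and> p \<in> U \<and> norm e = 1 \<and>
        L-lipschitz_on {z. z \<bullet> e = 0} (g :: 'a \<Rightarrow> real) \<and>
        \<Omega> \<inter> U = {x \<in> U. x \<bullet> e > g (x - (x \<bullet> e) *\<^sub>R e)})"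

definition h_fun :: "'a::euclidean_space set \<Rightarrow> 'a \<Rightarrow> real" where
  "h_fun \<Omega> x = c_const DIM('a) *
     ((LINT y:ball x 1 - \<Omega>|lebesgue. 1 / norm (x - y) ^ DIM('a))
    - (LINT y:\<Omega> - ball x 1|lebesgue. 1 / norm (x - y) ^ DIM('a)))"

end

(* Condition (ii) implies condition (i) pointwise: with |Omega| = |B_r|, exchanging mass between Omega
   and the ball B_r(x) gives h(x) >= - 2 ln r, and (ii) says 2 ln r <= rho_N.

   Under (i), let u be a supersolution and phi >= 0 a test function. Dropping the nonnegative
   contribution of u outside Omega turns E_L(u, phi) >= 0 into
     0 <= c_N/2 B(u, phi) + int_Omega (h + rho_N) u phi,
   where B is the bilinear form with kernel |x-y|^(-N) on Omega x Omega. By mollification this extends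
   to bounded phi >= 0 of finite energy with compact support in Omega. Take phi = eta_n w with
   w = min(u^-, 1) and Lipschitz cutoffs eta_n -> 1; since boundary strips of width 1/n of a Lipschitz
   domain have volume O(1/n), the cutoffs have bounded energy, and weak L^2 convergence gives
     0 <= int_Omega (h + rho_N) u^- w <= c_N/2 B(u, w) <= - c_N/2 B(w, w).
   So w is constant on Omega, and the constant is 0 because h + rho_N > 0 near a point of the closure
   of maximal norm. Truncating u^- at 1 is what makes bounded energy of the cutoffs sufficient, so that
   no boundary Hardy inequality is needed. *)

theory Submission
  imports Defs
begin

text \<open>The sign of the zero-order term is used twice. Close to the boundary
  \<open>h_fun\<close> is unbounded, and \<open>(h + rho) * (u * f)\<close> has no evident
  integrable majorant along the cutoffs, so no limit of its integral is taken. Being nonpositive, it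
  can be discarded before the limit; afterwards it is recovered, because its L1 norm is at most
  c_N/2 times the form, which by then is known to tend to 0. Weak convergence suffices since u stays
  fixed in the bilinear form, so w never has to be approximated in energy norm. The function h
  measures the discrepancy of two truncations: \<open>E_L\<close> cuts the kernel at |x-y| = 1,
  whereas B cuts it at the boundary of \<Omega>, and the kernel of h is the difference of the two
  indicators times |x-y|^(-N). The 2 in 2 ln r is c_N times the area of the unit sphere.
  Mollification is not compatible with the energy on \<Omega> x \<Omega>, which is not translation
  invariant. Uniform energy bounds for mollified functions are therefore obtained through a
  whole-space energy whose kernel is cut at distance 1.\<close>

lemma integrable_abs_le:
  fixes f g :: "'a \<Rightarrow> real"
  assumes "integrable M g" "f \<in> borel_measurable M" "\<And>x. \<bar>f x\<bar> \<le> g x"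
  shows "integrable M f"
  by (rule Bochner_Integration.integrable_bound[OF assms(1,2)])
     (use order_trans[OF assms(3) abs_ge_self] in auto)

lemma integrable_indicator_bounded:
  fixes A :: "'a::euclidean_space set"
  assumes "A \<in> sets borel" "bounded A"
  shows "integrable lborel (indicator A :: 'a \<Rightarrow> real)"
  using assms emeasure_bounded_finite[OF assms(2)] by (intro integrable_real_indicator) auto

section \<open>Smooth functions and convolution\<close>

lemma C_k_imp_continuous: "C_k k f \<Longrightarrow> continuous_on UNIV f"
  by (cases k) (auto intro: differentiable_imp_continuous_on)

lemma C_k_SucI:
  assumes "\<And>x. (f has_derivative D x) (at x)" "\<And>v. C_k k (\<lambda>x. D x v)"
  shows "C_k (Suc k) f"
proof -
  have "frechet_derivative f (at x) = D x" for x
    using frechet_derivative_at[OF assms(1)] by simp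
  moreover have "f differentiable_on UNIV"
    using assms(1) by (auto simp: differentiable_on_def differentiable_def)
  ultimately show ?thesis using assms(2) by simp
qed

lemma C_k_SucD:
  assumes "C_k (Suc k) f"
  shows "(f has_derivative frechet_derivative f (at x)) (at x)"
  using assms by (auto simp: differentiable_on_def frechet_derivative_works)

lemma C_k_Suc_imp: "C_k (Suc k) f \<Longrightarrow> C_k k f"
proof (induction k arbitrary: f)
  case 0
  then show ?case by (auto intro: differentiable_imp_continuous_on)
next
  case (Suc k)
  then show ?case by (metis C_k.simps(2))
qed

lemma C_k_const: "C_k k (\<lambda>x. c)"
proof (induction k arbitrary: c)
  case (Suc k)
  show ?case by (rule C_k_SucI[where D="\<lambda>x v. 0"]) (auto intro: Suc)
qed auto

lemma C_k_add: "C_k k f \<Longrightarrow> C_k k g \<Longrightarrow> C_k k (\<lambda>x. f x + g x)"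
proof (induction k arbitrary: f g)
  case 0
  then show ?case by (auto intro: continuous_intros)
next
  case (Suc k)
  show ?case
    by (rule C_k_SucI[OF has_derivative_add[OF Suc.prems[THEN C_k_SucD]]])
       (use Suc in auto)
qed

lemma C_k_mult: "C_k k f \<Longrightarrow> C_k k g \<Longrightarrow> C_k k (\<lambda>x. f x * g x)"
proof (induction k arbitrary: f g)
  case 0
  then show ?case by (auto intro: continuous_intros)
next
  case (Suc k)
  have "C_k k f" "C_k k g" using Suc.prems C_k_Suc_imp by blast+
  then show ?case
    by (intro C_k_SucI[OF has_derivative_mult[OF Suc.prems[THEN C_k_SucD]]] C_k_add Suc.IH)
       (use Suc.prems in auto)
qed

lemma C_k_inner: "C_k k (\<lambda>x. x \<bullet> v)"
proof (cases k)
  case 0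
  then show ?thesis by (auto intro: continuous_intros)
next
  case (Suc k)
  have "C_k (Suc k) (\<lambda>x. x \<bullet> v)"
    by (rule C_k_SucI[where D="\<lambda>x w. w \<bullet> v"])
       (auto intro!: C_k_const derivative_eq_intros)
  then show ?thesis using Suc by simp
qed

text \<open>The classical flat function exp(-1/t), together with the factors t^(-m) that its
  derivatives produce. The family is closed under differentiation up to linear combinations, so
  smoothness follows by induction on the order with \<open>m\<close> left arbitrary.\<close>

definition flat_exp :: "nat \<Rightarrow> real \<Rightarrow> real" where
  "flat_exp m t = (if t > 0 then exp (- (1 / t)) / t ^ m else 0)"

lemma flat_exp_has_derivative:
  "(flat_exp m has_real_derivative flat_exp (m + 2) t - real m * flat_exp (m + 1) t) (at t)"
proof -
  consider "t > 0" | "t < 0" | "t = 0" by linarith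
  then show ?thesis
  proof cases
    case 1
    have "((\<lambda>t. - (1 / t)) has_real_derivative 1 / t\<^sup>2) (at t)"
      using 1 by (auto intro!: derivative_eq_intros simp: power2_eq_square)
    from DERIV_divide[OF DERIV_fun_exp[OF this] DERIV_pow[of m t UNIV]]
    have "((\<lambda>t. exp (- (1 / t)) / t ^ m) has_real_derivative
        (exp (- (1 / t)) * (1 / t\<^sup>2) * t ^ m - exp (- (1 / t)) * (real m * t ^ (m - 1))) / (t ^ m * t ^ m)) (at t)"
      using 1 by simp
    also have "real m * t ^ (m - 1) = real m * t ^ m / t"
      using 1 by (cases m) auto
    also have "(exp (- (1 / t)) * (1 / t\<^sup>2) * t ^ m - exp (- (1 / t)) * (real m * t ^ m / t)) / (t ^ m * t ^ m)
      = flat_exp (m + 2) t - real m * flat_exp (m + 1) t"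
      using 1 unfolding flat_exp_def by (simp add: divide_simps power2_eq_square) (simp add: algebra_simps)
    finally have "((\<lambda>t. exp (- (1 / t)) / t ^ m) has_real_derivative
        flat_exp (m + 2) t - real m * flat_exp (m + 1) t) (at t)" .
    moreover have "eventually (\<lambda>s. s \<in> {0<..}) (nhds t)"
      using 1 by (intro eventually_nhds_in_open) auto
    then have ev: "eventually (\<lambda>s. flat_exp m s = exp (- (1 / s)) / s ^ m) (nhds t)"
      by eventually_elim (auto simp: flat_exp_def)
    ultimately show ?thesis by (simp add: DERIV_cong_ev[OF refl ev refl])
  next
    case 2
    have "eventually (\<lambda>s. s \<in> {..<0}) (nhds t)"
      using 2 by (intro eventually_nhds_in_open) auto
    then have ev: "eventually (\<lambda>s. flat_exp m s = 0) (nhds t)"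
      by eventually_elim (auto simp: flat_exp_def)
    have "(flat_exp m has_real_derivative 0) (at t)" by (simp add: DERIV_cong_ev[OF refl ev refl])
    then show ?thesis using 2 by (simp add: flat_exp_def)
  next
    case 3
    \<comment> \<open>With s = 1/h, the right difference quotient at 0 is s^(m+1) / exp s, which
      tends to 0 as s tends to infinity; the left one is identically 0.\<close>
    have "((\<lambda>x. x ^ Suc m / exp x) \<longlongrightarrow> 0) (at_top :: real filter)"
      by (rule tendsto_power_div_exp_0)
    then have "((\<lambda>h. inverse h ^ Suc m / exp (inverse h)) \<longlongrightarrow> 0) (at_right (0::real))"
      by (rule filterlim_compose) (rule filterlim_inverse_at_top_right)
    moreover have "eventually (\<lambda>h. h > (0::real)) (at_right 0)"
      by (simp add: eventually_at_right_less)
    then have "eventually (\<lambda>h. inverse h ^ Suc m / exp (inverse h) = (flat_exp m h - flat_exp m 0) / h) (at_right 0)"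
      by eventually_elim (auto simp: flat_exp_def exp_minus divide_simps)
    ultimately have R: "((\<lambda>h. (flat_exp m h - flat_exp m 0) / h) \<longlongrightarrow> 0) (at_right 0)"
      by (rule Lim_transform_eventually)
    have "eventually (\<lambda>h. h < (0::real)) (at_left 0)"
      by (rule eventually_at_leftI[of "-1"]) auto
    then have "eventually (\<lambda>h. 0 = (flat_exp m h - flat_exp m 0) / h) (at_left 0)"
      by eventually_elim (auto simp: flat_exp_def)
    then have L: "((\<lambda>h. (flat_exp m h - flat_exp m 0) / h) \<longlongrightarrow> 0) (at_left 0)"
      by (rule Lim_transform_eventually[OF tendsto_const])
    have "(flat_exp m has_real_derivative 0) (at 0)"
      unfolding DERIV_def using L R by (simp add: filterlim_at_split)
    then show ?thesis using 3 by (simp add: flat_exp_def)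
  qed
qed

lemma C_k_flat_exp: "C_k k (\<lambda>x::'a::euclidean_space. flat_exp m (a - x \<bullet> x))"
proof (induction k arbitrary: m)
  case 0
  have "continuous_on UNIV (flat_exp m)"
    by (rule DERIV_continuous_on) (rule has_field_derivative_at_within[OF flat_exp_has_derivative])
  then have "continuous_on UNIV (\<lambda>x::'a. flat_exp m (a - x \<bullet> x))"
    by (rule continuous_on_compose2) (auto intro!: continuous_intros)
  then show ?case by simp
next
  case (Suc k)
  let ?g = "\<lambda>x::'a. flat_exp (m + 2) (a - x \<bullet> x) + (- real m) * flat_exp (m + 1) (a - x \<bullet> x)"
  show ?case
  proof (rule C_k_SucI[where D="\<lambda>x v. ?g x * ((- 2) * (x \<bullet> v))"])
    fix x :: 'a
    have "((\<lambda>x. a - x \<bullet> x) has_derivative (\<lambda>v. (- 2) * (x \<bullet> v))) (at x)"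
      by (auto intro!: derivative_eq_intros simp: inner_commute)
    from DERIV_compose_FDERIV[OF flat_exp_has_derivative this]
    show "((\<lambda>x. flat_exp m (a - x \<bullet> x)) has_derivative (\<lambda>v. ?g x * ((- 2) * (x \<bullet> v)))) (at x)"
      by (simp add: algebra_simps)
  qed (intro C_k_mult C_k_add Suc C_k_const C_k_inner)
qed

section \<open>Uniform bounds for smooth functions of bounded support, and convolution\<close>

lemma C_k_compact_bounded:
  fixes g :: "'a::euclidean_space \<Rightarrow> real"
  assumes "C_k k g" "bounded {x. g x \<noteq> 0}"
  obtains B where "\<And>x. \<bar>g x\<bar> \<le> B"
proof -
  obtain r where r: "{x. g x \<noteq> 0} \<subseteq> cball 0 r"
    using bounded_subset_ballD[OF assms(2), of 0] ball_subset_cball by blast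
  have "compact (g ` cball 0 r)"
    by (intro compact_continuous_image continuous_on_subset[OF C_k_imp_continuous[OF assms(1)]]) auto
  then obtain B where B: "\<forall>y \<in> g ` cball 0 r. \<bar>y\<bar> \<le> B"
    using compact_imp_bounded bounded_real by metis
  have "\<bar>g x\<bar> \<le> max B 0" for x
    using B r by (cases "g x = 0") (auto simp: le_max_iff_disj)
  then show ?thesis using that by blast
qed

lemma has_derivative_bounded_support:
  fixes g :: "'a::euclidean_space \<Rightarrow> real"
  assumes "\<And>x. (g has_derivative D x) (at x)"
  shows "{x. D x v \<noteq> 0} \<subseteq> closure {x. g x \<noteq> 0}"
proof
  fix x assume "x \<in> {x. D x v \<noteq> 0}"
  show "x \<in> closure {x. g x \<noteq> 0}"
  proof (rule ccontr)
    assume "x \<notin> closure {x. g x \<noteq> 0}"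
    then have "((\<lambda>x. 0) has_derivative D x) (at x)"
      by (intro has_derivative_transform_within_open[OF assms, of "- closure {x. g x \<noteq> 0}"])
         (use closure_subset[of "{x. g x \<noteq> 0}"] in auto)
    then have "D x = (\<lambda>x. 0)"
      using has_derivative_const has_derivative_unique by blast
    with \<open>x \<in> _\<close> show False by auto
  qed
qed

text \<open>Each partial derivative is continuous with bounded support, hence bounded; the sum of
  these bounds over the basis controls the derivative in every direction, and the mean value
  inequality turns it into a Lipschitz constant.\<close>

lemma C_1_lipschitz:
  fixes g :: "'a::euclidean_space \<Rightarrow> real"
  assumes g: "C_k (Suc k) g" "bounded {x. g x \<noteq> 0}"
  obtains L where "L \<ge> 0" "\<And>x v. \<bar>frechet_derivative g (at x) v\<bar> \<le> L * norm v"
    "\<And>x y. \<bar>g x - g y\<bar> \<le> L * norm (x - y)"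
proof -
  let ?D = "\<lambda>x. frechet_derivative g (at x)"
  note D = C_k_SucD[OF g(1)]
  have "\<exists>B. \<forall>x. \<bar>?D x i\<bar> \<le> B" for i
  proof -
    have "bounded {x. ?D x i \<noteq> 0}"
      using has_derivative_bounded_support[OF D, of i] g(2) bounded_closure bounded_subset by blast
    moreover have "C_k k (\<lambda>x. ?D x i)" using g(1) by simp
    ultimately show ?thesis by (metis C_k_compact_bounded)
  qed
  then obtain B where B: "\<And>i x. \<bar>?D x i\<bar> \<le> B i" by metis
  define L where "L = (\<Sum>i\<in>Basis. B i)"
  have B0: "B i \<ge> 0" for i using B[of undefined i] by linarith
  have *: "\<bar>?D x v\<bar> \<le> L * norm v" for x v
  proof -
    have lin: "linear (?D x)" using D has_derivative_linear by blast
    have "?D x v = ?D x (\<Sum>i\<in>Basis. (v \<bullet> i) *\<^sub>R i)" by (simp add: euclidean_representation)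
    also have "\<dots> = (\<Sum>i\<in>Basis. (v \<bullet> i) * ?D x i)"
      by (simp add: linear_sum[OF lin] linear_scale[OF lin])
    also have "\<bar>\<dots>\<bar> \<le> (\<Sum>i\<in>Basis. B i * norm v)"
      by (intro order.trans[OF sum_abs] sum_mono)
         (auto simp: abs_mult mult.commute[of "B _"] intro!: mult_mono B Basis_le_norm)
    finally show ?thesis by (simp add: L_def sum_distrib_right)
  qed
  have "norm (g x - g y) \<le> L * norm (x - y)" for x y
    using D * by (intro differentiable_bound[of UNIV g ?D L])
       (auto intro!: onorm_le has_derivative_at_withinI)
  then show ?thesis using * that[of L] by (auto simp: L_def intro!: sum_nonneg B0)
qed

lemmas [intro] = borel_measurable_continuous_onI

text \<open>All derivatives fall on \<open>g\<close>, so integrability of \<open>f\<close> is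
  enough. The induction runs with \<open>g\<close> arbitrary because a directional derivative of the
  convolution is again a convolution, of \<open>f\<close> with the derivative of
  \<open>g\<close>.\<close>

lemma C_k_convolution:
  fixes f g :: "'a::euclidean_space \<Rightarrow> real"
  assumes f: "integrable lborel f" and g: "C_k k g" "bounded {x. g x \<noteq> 0}"
  shows "C_k k (\<lambda>x. \<integral>y. f y * g (x - y) \<partial>lborel)"
  using g
proof (induction k arbitrary: g)
  case 0
  obtain B where B: "\<And>x. \<bar>g x\<bar> \<le> B" using C_k_compact_bounded[OF 0] by blast
  have cg: "continuous_on UNIV g" using 0 by simp
  have [measurable]: "g \<in> borel_measurable borel" using cg by blast
  have [measurable]: "f \<in> borel_measurable borel" using f by auto
  have "isCont (\<lambda>x. \<integral>y. f y * g (x - y) \<partial>lborel) x" for x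
    unfolding continuous_at_sequentially comp_def
  proof (intro allI impI)
    fix X assume X: "X \<longlonglongrightarrow> x"
    show "(\<lambda>n. \<integral>y. f y * g (X n - y) \<partial>lborel) \<longlonglongrightarrow> (LBINT y. f y * g (x - y))"
    proof (rule integral_dominated_convergence[where w="\<lambda>y. \<bar>f y\<bar> * B"])
      show "integrable lborel (\<lambda>y. \<bar>f y\<bar> * B)" using f by auto
      show "AE y in lborel. (\<lambda>n. f y * g (X n - y)) \<longlonglongrightarrow> f y * g (x - y)"
        by (intro AE_I2 tendsto_intros continuous_on_tendsto_compose[OF cg] X) auto
      show "AE y in lborel. norm (f y * g (X n - y)) \<le> \<bar>f y\<bar> * B" for n
        by (auto simp: abs_mult intro!: mult_left_mono B)
    qed measurable
  qed
  then show ?case by (simp add: continuous_at_imp_continuous_on)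
next
  case (Suc k)
  let ?D = "\<lambda>x. frechet_derivative g (at x)"
  note D = C_k_SucD[OF Suc.prems(1)]
  obtain L where L: "L \<ge> 0" "\<And>x v. \<bar>?D x v\<bar> \<le> L * norm v"
      "\<And>x y. \<bar>g x - g y\<bar> \<le> L * norm (x - y)"
    using C_1_lipschitz[OF Suc.prems] by blast
  obtain B where B: "\<And>x. \<bar>g x\<bar> \<le> B" using C_k_compact_bounded[OF Suc.prems] by blast
  have [measurable]: "g \<in> borel_measurable borel"
    using C_k_imp_continuous[OF Suc.prems(1)] by blast
  have Dk: "C_k k (\<lambda>x. ?D x v)" for v using Suc.prems by simp
  have [measurable]: "(\<lambda>x. ?D x v) \<in> borel_measurable borel" for v
    using C_k_imp_continuous[OF Dk] by blast
  have [measurable]: "f \<in> borel_measurable borel" using f by auto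
  have lin: "linear (?D x)" for x using D has_derivative_linear by blast
  have int_g: "integrable lborel (\<lambda>y. f y * g (x - y))" for x
    by (rule Bochner_Integration.integrable_bound[OF integrable_mult_right[OF f, of B]])
       (use B order_trans[OF abs_ge_zero B] in \<open>auto simp: abs_mult mult.commute[of B] intro!: mult_left_mono\<close>)
  have int_D: "integrable lborel (\<lambda>y. f y * ?D (x - y) v)" for x v
    by (rule Bochner_Integration.integrable_bound[OF integrable_mult_right[OF f, of "L * norm v"]])
       (use L in \<open>auto simp: abs_mult mult.commute[of "L * norm v"] intro!: mult_left_mono\<close>)
  show ?case
  proof (rule C_k_SucI[where D="\<lambda>x v. \<integral>y. f y * ?D (x - y) v \<partial>lborel"])
    fix v
    have "bounded {x. ?D x v \<noteq> 0}"
      using has_derivative_bounded_support[OF D, of v] Suc.prems(2) bounded_closure bounded_subset by blast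
    then show "C_k k (\<lambda>x. \<integral>y. f y * ?D (x - y) v \<partial>lborel)"
      by (rule Suc.IH[OF Dk])
  next
    fix x :: 'a
    \<comment> \<open>The normalised remainder of the first-order expansion of \<open>g\<close> at
      \<open>x - y\<close>. It tends to 0 for every \<open>y\<close> and is bounded by
      \<open>2 * L\<close>, one \<open>L\<close> for the increment and one for the linear part, so
      dominated convergence applies.\<close>
    let ?R = "\<lambda>z y. (g (z - y) - g (x - y) - ?D (x - y) (z - x)) / norm (z - x)"
    let ?G = "\<lambda>x. LBINT y. f y * g (x - y)" and ?G' = "\<lambda>v. LBINT y. f y * ?D (x - y) v"
    show "(?G has_derivative ?G') (at x)"
      unfolding has_derivative_iff_norm
    proof
      have "linear ?G'"
        by (rule linearI)
           (simp_all add: linear_add[OF lin] linear_scale[OF lin] ring_distribs int_D mult.left_commute)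
      then show "bounded_linear ?G'"
        by (simp add: linear_conv_bounded_linear)
      have "((\<lambda>z. (LBINT y. f y * ?R z y)) \<longlongrightarrow> 0) (at x)"
        unfolding tendsto_at_iff_sequentially comp_def
      proof (intro allI impI)
        fix X assume X0: "\<forall>i. X i \<in> UNIV - {x}" and X: "X \<longlonglongrightarrow> x"
        have "(\<lambda>n. \<integral>y. f y * ?R (X n) y \<partial>lborel) \<longlonglongrightarrow> (\<integral>y. 0 \<partial>(lborel :: 'a measure))"
        proof (rule integral_dominated_convergence[where w="\<lambda>y. \<bar>f y\<bar> * (2 * L)"])
          show "integrable lborel (\<lambda>y. \<bar>f y\<bar> * (2 * L))" using f by auto
          show "AE y in lborel. (\<lambda>n. f y * ?R (X n) y) \<longlonglongrightarrow> 0"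
          proof (rule AE_I2)
            fix y
            have "((\<lambda>z. g (z - y)) has_derivative ?D (x - y)) (at x)"
              using has_derivative_compose[OF has_derivative_diff[OF has_derivative_ident has_derivative_const, of y] D[of "x - y"]]
              by simp
            then have "((\<lambda>z. norm (?R z y)) \<longlongrightarrow> 0) (at x)"
              by (simp add: has_derivative_iff_norm)
            then have "((\<lambda>z. ?R z y) \<longlongrightarrow> 0) (at x)"
              by (rule tendsto_norm_zero_cancel)
            then have "(\<lambda>n. ?R (X n) y) \<longlonglongrightarrow> 0"
              using X X0 unfolding tendsto_at_iff_sequentially comp_def by blast
            then show "(\<lambda>n. f y * ?R (X n) y) \<longlonglongrightarrow> 0"
              by (rule tendsto_mult_right_zero)
          qed
          show "AE y in lborel. norm (f y * ?R (X n) y) \<le> \<bar>f y\<bar> * (2 * L)" for n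
          proof (rule AE_I2)
            fix y
            have "\<bar>g (X n - y) - g (x - y) - ?D (x - y) (X n - x)\<bar> \<le> 2 * L * norm (X n - x)"
              using L(2)[of "x - y" "X n - x"] L(3)[of "X n - y" "x - y"] by (simp add: algebra_simps)
            then have "\<bar>?R (X n) y\<bar> \<le> 2 * L"
              using X0 by (auto simp: divide_simps)
            then show "norm (f y * ?R (X n) y) \<le> \<bar>f y\<bar> * (2 * L)"
              unfolding real_norm_def abs_mult by (intro mult_left_mono) auto
          qed
        qed measurable
        then show "(\<lambda>n. \<integral>y. f y * ?R (X n) y \<partial>lborel) \<longlonglongrightarrow> 0" by simp
      qed
      moreover have "\<And>z. (LBINT y. f y * ?R z y) = (?G z - ?G x - ?G' (z - x)) / norm (z - x)"
        using int_g int_D by (simp add: right_diff_distrib diff_divide_distrib)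
      ultimately have "((\<lambda>z. (?G z - ?G x - ?G' (z - x)) / norm (z - x)) \<longlongrightarrow> 0) (at x)"
        by (simp only:)
      then have "((\<lambda>z. norm ((?G z - ?G x - ?G' (z - x)) / norm (z - x))) \<longlongrightarrow> 0) (at x)"
        by (rule tendsto_norm_zero)
      then show "((\<lambda>z. norm (?G z - ?G x - ?G' (z - x)) / norm (z - x)) \<longlongrightarrow> 0) (at x)"
        by simp
    qed
  qed
qed

section \<open>Weak convergence and translations in Lebesgue spaces\<close>

lemma integrable_mult_L2:
  fixes f g :: "'a \<Rightarrow> real"
  assumes [measurable]: "f \<in> borel_measurable M" "g \<in> borel_measurable M"
    and i: "integrable M (\<lambda>x. (f x)\<^sup>2)" "integrable M (\<lambda>x. (g x)\<^sup>2)"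
  shows "integrable M (\<lambda>x. f x * g x)"
proof (rule integrable_abs_le[OF Bochner_Integration.integrable_add[OF i]])
  show "\<bar>f x * g x\<bar> \<le> (f x)\<^sup>2 + (g x)\<^sup>2" for x
    using sum_squares_bound[of "\<bar>f x\<bar>" "\<bar>g x\<bar>"] abs_ge_zero[of "f x * g x"]
    unfolding abs_mult power2_abs by linarith
qed measurable

text \<open>Fatou's lemma puts the limit into L2. For the pairing, with \<open>h n\<close> the
  distance to the limit, the product \<open>\<bar>F\<bar> * h n\<close> is at most
  min(\<open>\<bar>F\<bar> * h n\<close>, T F^2) + (\<open>h n\<close>)^2 / T. For fixed T the first
  summand is dominated by T F^2 and converges, while the integral of the second is uniformly small
  for large T. This works on measures of infinite mass.\<close>

lemma weak_L2_convergence: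
  fixes F g :: "'a \<Rightarrow> real"
  assumes [measurable]: "F \<in> borel_measurable M" "g \<in> borel_measurable M" "\<And>n. gs n \<in> borel_measurable M"
    and F: "integrable M (\<lambda>x. (F x)\<^sup>2)"
    and gs: "\<And>n. (\<integral>\<^sup>+x. ennreal ((gs n x)\<^sup>2) \<partial>M) \<le> ennreal C"
    and lim: "AE x in M. (\<lambda>n. gs n x) \<longlonglongrightarrow> g x"
  shows "integrable M (\<lambda>x. (g x)\<^sup>2)" "(\<lambda>n. \<integral>x. F x * gs n x \<partial>M) \<longlonglongrightarrow> (\<integral>x. F x * g x \<partial>M)"
proof -
  \<comment> \<open>Since \<open>ennreal\<close> sends negative numbers to 0, the hypothesis allows
    a negative \<open>C\<close>; \<open>C'\<close> is a bound that also holds for the real-valued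
    integrals.\<close>
  define C' where "C' = max C 0"
  have gs': "(\<integral>\<^sup>+x. ennreal ((gs n x)\<^sup>2) \<partial>M) \<le> ennreal C'" for n
    by (rule order_trans[OF gs]) (auto simp: C'_def intro!: ennreal_leI)
  have igs: "integrable M (\<lambda>x. (gs n x)\<^sup>2)" for n
    using gs'[of n] by (intro integrableI_bounded) (auto intro: le_less_trans)
  have "(\<integral>\<^sup>+x. ennreal ((g x)\<^sup>2) \<partial>M) = (\<integral>\<^sup>+x. liminf (\<lambda>n. ennreal ((gs n x)\<^sup>2)) \<partial>M)"
    using lim
  proof (intro nn_integral_cong_AE, eventually_elim)
    case (elim x)
    then have "(\<lambda>n. ennreal ((gs n x)\<^sup>2)) \<longlonglongrightarrow> ennreal ((g x)\<^sup>2)"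
      by (intro tendsto_intros) auto
    from lim_imp_Liminf[OF _ this] show ?case by simp
  qed
  also have "\<dots> \<le> liminf (\<lambda>n. \<integral>\<^sup>+x. ennreal ((gs n x)\<^sup>2) \<partial>M)"
    by (rule nn_integral_liminf) measurable
  also have "\<dots> \<le> ennreal C'"
    by (rule Liminf_le) (use gs' in auto)
  finally have g2: "(\<integral>\<^sup>+x. ennreal ((g x)\<^sup>2) \<partial>M) \<le> ennreal C'" .
  then show ig: "integrable M (\<lambda>x. (g x)\<^sup>2)"
    by (intro integrableI_bounded) (auto intro: le_less_trans)
  define h where "h n x = \<bar>gs n x - g x\<bar>" for n x
  have [measurable]: "h n \<in> borel_measurable M" for n unfolding h_def[abs_def] by measurable
  have h_le: "(h n x)\<^sup>2 \<le> 2 * (gs n x)\<^sup>2 + 2 * (g x)\<^sup>2" for n x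
    using sum_squares_bound[of "gs n x" "- g x"] by (simp add: h_def power2_diff)
  have ih: "integrable M (\<lambda>x. (h n x)\<^sup>2)" for n
    by (rule Bochner_Integration.integrable_bound[where f="\<lambda>x. 2 * (gs n x)\<^sup>2 + 2 * (g x)\<^sup>2"]) (use igs ig h_le in auto)
  have C2: "(\<integral>x. (g x)\<^sup>2 \<partial>M) \<le> C'" "(\<integral>x. (gs n x)\<^sup>2 \<partial>M) \<le> C'" for n
    using g2 gs' ig igs
    by (auto simp: nn_integral_eq_integral C'_def)
  have hC: "(\<integral>x. (h n x)\<^sup>2 \<partial>M) \<le> 4 * C'" for n
  proof -
    have "(\<integral>x. (h n x)\<^sup>2 \<partial>M) \<le> (\<integral>x. 2 * (gs n x)\<^sup>2 + 2 * (g x)\<^sup>2 \<partial>M)"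
      by (intro integral_mono ih h_le) (use igs ig in auto)
    also have "\<dots> = 2 * (\<integral>x. (gs n x)\<^sup>2 \<partial>M) + 2 * (\<integral>x. (g x)\<^sup>2 \<partial>M)"
      using igs ig by simp
    finally show ?thesis using C2(1) C2(2)[of n] by linarith
  qed
  have iF: "integrable M (\<lambda>x. \<bar>F x\<bar> * h n x)" for n
    using F by (intro integrable_mult_L2 ih) auto
  have "(\<lambda>n. \<integral>x. \<bar>F x\<bar> * h n x \<partial>M) \<longlonglongrightarrow> 0"
  proof (rule LIMSEQ_I)
    fix e :: real assume e: "e > 0"
    \<comment> \<open>Chosen so that the tail \<open>4 * C' / T\<close> is at most
      \<open>e / 2\<close>; the summand 1 keeps \<open>T\<close> positive when \<open>C'\<close> is
      0.\<close>
    define T where "T = (8 * C' + 1) / e"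
    have C0: "C' \<ge> 0" by (simp add: C'_def)
    have T: "T > 0" "4 * C' / T \<le> e / 2" using e C0 by (auto simp: T_def field_simps)
    let ?m = "\<lambda>n x. min (\<bar>F x\<bar> * h n x) (T * (F x)\<^sup>2)"
    have pt: "\<bar>F x\<bar> * h n x \<le> ?m n x + (h n x)\<^sup>2 / T" for n x
    proof (cases "\<bar>F x\<bar> * h n x \<le> T * (F x)\<^sup>2")
      case True
      then show ?thesis using T by simp
    next
      case False
      then have "T * \<bar>F x\<bar> * \<bar>F x\<bar> < h n x * \<bar>F x\<bar>" by (simp add: power2_eq_square mult.commute mult.left_commute)
      then have "T * \<bar>F x\<bar> < h n x" by (rule mult_right_less_imp_less) simp
      then have "\<bar>F x\<bar> \<le> h n x / T" using T by (simp add: field_simps)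
      then have "\<bar>F x\<bar> * h n x \<le> h n x / T * h n x" by (rule mult_right_mono) (simp add: h_def)
      then have "\<bar>F x\<bar> * h n x \<le> (h n x)\<^sup>2 / T" by (simp add: power2_eq_square)
      moreover have "?m n x \<ge> 0" using T by (simp add: h_def)
      ultimately show ?thesis by linarith
    qed
    have im: "integrable M (?m n)" for n
      by (rule Bochner_Integration.integrable_bound[OF iF[of n]]) (use T in \<open>auto simp: h_def\<close>)
    have "(\<lambda>n. \<integral>x. ?m n x \<partial>M) \<longlonglongrightarrow> (\<integral>x. 0 \<partial>M)"
    proof (rule integral_dominated_convergence[where w="\<lambda>x. T * (F x)\<^sup>2"])
      show "AE x in M. (\<lambda>n. ?m n x) \<longlonglongrightarrow> 0"
        using lim
      proof eventually_elim
        case (elim x)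
        then have "(\<lambda>n. h n x) \<longlonglongrightarrow> 0"
          unfolding h_def using LIM_zero tendsto_rabs_zero by blast
        then have "(\<lambda>n. \<bar>F x\<bar> * h n x) \<longlonglongrightarrow> 0" by (rule tendsto_mult_right_zero)
        from tendsto_min[OF this tendsto_const[of "T * (F x)\<^sup>2"]] T show ?case by (simp add: min_def)
      qed
    qed (use F T in \<open>auto simp: h_def\<close>)
    then have "eventually (\<lambda>n. (\<integral>x. ?m n x \<partial>M) < e / 2) sequentially"
      using e by (intro order_tendstoD) auto
    then obtain n0 where n0: "\<And>n. n \<ge> n0 \<Longrightarrow> (\<integral>x. ?m n x \<partial>M) < e / 2"
      by (auto simp: eventually_sequentially)
    show "\<exists>no. \<forall>n\<ge>no. norm ((\<integral>x. \<bar>F x\<bar> * h n x \<partial>M) - 0) < e"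
    proof (intro exI allI impI)
      fix n assume n: "n \<ge> n0"
      have "(\<integral>x. \<bar>F x\<bar> * h n x \<partial>M) \<le> (\<integral>x. ?m n x + (h n x)\<^sup>2 / T \<partial>M)"
        using pt by (intro integral_mono iF Bochner_Integration.integrable_add im) (auto intro: ih)
      also have "\<dots> = (\<integral>x. ?m n x \<partial>M) + (\<integral>x. (h n x)\<^sup>2 \<partial>M) / T"
        using im ih by simp
      also have "(\<integral>x. (h n x)\<^sup>2 \<partial>M) / T \<le> 4 * C' / T"
        using T hC by (intro divide_right_mono) auto
      finally have "(\<integral>x. \<bar>F x\<bar> * h n x \<partial>M) < e" using n0[OF n] T by linarith
      moreover have "(\<integral>x. \<bar>F x\<bar> * h n x \<partial>M) \<ge> 0" by (simp add: h_def)
      ultimately show "norm ((\<integral>x. \<bar>F x\<bar> * h n x \<partial>M) - 0) < e" by simp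
    qed
  qed
  moreover have "norm ((\<integral>x. F x * gs n x \<partial>M) - (\<integral>x. F x * g x \<partial>M)) \<le> (\<integral>x. \<bar>F x\<bar> * h n x \<partial>M)" for n
  proof -
    have "(\<integral>x. F x * gs n x \<partial>M) - (\<integral>x. F x * g x \<partial>M) = (\<integral>x. F x * (gs n x - g x) \<partial>M)"
      by (simp add: right_diff_distrib integrable_mult_L2 F igs ig)
    also have "norm \<dots> \<le> (\<integral>x. norm (F x * (gs n x - g x)) \<partial>M)" by (rule integral_norm_bound)
    finally show ?thesis by (simp add: abs_mult h_def)
  qed
  then have "eventually (\<lambda>n. norm ((\<integral>x. F x * gs n x \<partial>M) - (\<integral>x. F x * g x \<partial>M)) \<le> (\<integral>x. \<bar>F x\<bar> * h n x \<partial>M)) sequentially"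
    by (intro always_eventually allI)
  ultimately have "(\<lambda>n. (\<integral>x. F x * gs n x \<partial>M) - (\<integral>x. F x * g x \<partial>M)) \<longlonglongrightarrow> 0"
    by (rule Lim_null_comparison[rotated])
  then show "(\<lambda>n. \<integral>x. F x * gs n x \<partial>M) \<longlonglongrightarrow> (\<integral>x. F x * g x \<partial>M)"
    by (rule LIM_zero_cancel)
qed

section \<open>Invariance of Lebesgue measure and continuity of translations\<close>

lemma distr_lborel_reflect: "distr lborel borel (\<lambda>z. x - z) = (lborel :: 'a::euclidean_space measure)"
proof -
  have "(lborel :: 'a measure) = density (distr lborel borel (\<lambda>z. x + (-1) *\<^sub>R z)) (\<lambda>_. ennreal (\<bar>-1\<bar> ^ DIM('a)))"
    by (rule lborel_affine) simp
  also have "\<dots> = distr lborel borel (\<lambda>z. x - z)" by (simp add: density_1)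
  finally show ?thesis ..
qed

lemma distr_lborel_translate: "distr lborel borel (\<lambda>x. x - z) = (lborel :: 'a::euclidean_space measure)"
proof -
  have "(+) (- z) = (\<lambda>x. x - z)" by auto
  then show ?thesis using lborel_distr_plus[of "- z"] by simp
qed

lemma nn_integral_lborel_translate:
  fixes f :: "'a::euclidean_space \<Rightarrow> ennreal"
  assumes "f \<in> borel_measurable borel"
  shows "(\<integral>\<^sup>+x. f (x - z) \<partial>lborel) = (\<integral>\<^sup>+x. f x \<partial>lborel)"
  using nn_integral_distr[of "\<lambda>x. x - z" lborel borel f] assms by (simp add: distr_lborel_translate)

lemma integral_lborel_translate:
  fixes f :: "'a::euclidean_space \<Rightarrow> real"
  assumes "f \<in> borel_measurable borel"
  shows "(LBINT x. f (x - z)) = (LBINT x. f x)"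
  using integral_distr[of "\<lambda>x. x - z" lborel borel f] assms by (simp add: distr_lborel_translate)

lemma integrable_lborel_translate:
  fixes f :: "'a::euclidean_space \<Rightarrow> real"
  assumes "integrable lborel f"
  shows "integrable lborel (\<lambda>x. f (x - z))"
  using integrable_distr[of "\<lambda>x. x - z" lborel borel f] assms by (simp add: distr_lborel_translate)

lemma nn_integral_lborel_reflect:
  fixes f :: "'a::euclidean_space \<Rightarrow> ennreal"
  assumes "f \<in> borel_measurable borel"
  shows "(\<integral>\<^sup>+y. f (x - y) \<partial>lborel) = (\<integral>\<^sup>+x. f x \<partial>lborel)"
  using nn_integral_distr[of "\<lambda>z. x - z" lborel borel f] assms by (simp add: distr_lborel_reflect)

lemma integral_lborel_reflect:
  fixes f :: "'a::euclidean_space \<Rightarrow> real"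
  assumes "f \<in> borel_measurable borel"
  shows "(LBINT z. f (x - z)) = (LBINT x. f x)"
  using integral_distr[of "\<lambda>z. x - z" lborel borel f] assms by (simp add: distr_lborel_reflect)

text \<open>Openness gives pointwise convergence of the shifted indicators on \<open>U\<close>, but
  not on its frontier, which may have positive measure. Only the part lost inside \<open>U\<close>
  is therefore estimated; as translations preserve volume, the part gained outside has the same
  integral, whence the factor 2.\<close>

lemma translation_continuous_open:
  fixes U :: "'a::euclidean_space set"
  assumes U: "open U" "emeasure lborel U < \<infinity>" and X: "X \<longlonglongrightarrow> 0"
  shows "(\<lambda>n. \<integral>x. \<bar>indicator U (x - X n) - indicator U x :: real\<bar> \<partial>lborel) \<longlonglongrightarrow> 0"
proof -
  have [measurable]: "U \<in> sets borel" using U by auto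
  have i: "integrable lborel (indicator U :: 'a \<Rightarrow> real)" using U by simp
  have i': "integrable lborel (\<lambda>x. indicator U (x - z) :: real)" for z
    using integrable_lborel_translate[OF i] .
  let ?d = "\<lambda>n x. max 0 (indicator U x - indicator U (x - X n) :: real)"
  have "(\<lambda>n. \<integral>x. ?d n x \<partial>lborel) \<longlonglongrightarrow> (\<integral>x. 0 \<partial>(lborel :: 'a measure))"
  proof (rule integral_dominated_convergence[where w="indicator U"])
    show "AE x in lborel. (\<lambda>n. ?d n x) \<longlonglongrightarrow> 0"
    proof (rule AE_I2)
      fix x
      show "(\<lambda>n. ?d n x) \<longlonglongrightarrow> 0"
      proof (cases "x \<in> U")
        case True
        have "(\<lambda>n. x - X n) \<longlonglongrightarrow> x" using tendsto_diff[OF tendsto_const X, of x] by simp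
        from topological_tendstoD[OF this U(1) True]
        have "eventually (\<lambda>n. ?d n x = 0) sequentially"
          by eventually_elim (auto simp: indicator_def)
        then show ?thesis by (rule tendsto_eventually)
      next
        case False
        then have "?d n x = 0" for n by (auto simp: indicator_def)
        then show ?thesis by simp
      qed
    qed
  qed (use i in \<open>auto simp: indicator_def\<close>)
  then have "(\<lambda>n. 2 * (LBINT x. ?d n x)) \<longlonglongrightarrow> 0" by (auto intro: tendsto_mult_right_zero)
  moreover have "(LBINT x. \<bar>indicator U (x - X n) - indicator U x :: real\<bar>) = 2 * (LBINT x. ?d n x)" for n
  proof -
    have id: "integrable lborel (?d n)"
      using i i'[of "X n"] by (intro integrable_max Bochner_Integration.integrable_diff) auto
    have eq: "(\<lambda>x. \<bar>indicator U (x - X n) - indicator U x :: real\<bar>) =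
        (\<lambda>x. 2 * ?d n x - (indicator U x - indicator U (x - X n)))"
      by (auto simp: indicator_def)
    have "(LBINT x. \<bar>indicator U (x - X n) - indicator U x :: real\<bar>)
       = 2 * (LBINT x. ?d n x) - ((LBINT x. indicator U x) - (LBINT x. indicator U (x - X n)))"
      unfolding eq using i i'[of "X n"] id by simp
    then show ?thesis by (simp add: integral_lborel_translate[of "indicator U"])
  qed
  ultimately show ?thesis by simp
qed

text \<open>An e/3 argument: translations are isometries of L1, so continuity of translation is
  inherited by L1 limits. It serves both for the passage from open sets to sets of finite measure
  and for the limit step of the induction over integrable functions.\<close>

lemma translation_continuous_approx:
  fixes f :: "'a::euclidean_space \<Rightarrow> real"
  assumes f: "integrable lborel f"
    and ap: "\<And>e. e > 0 \<Longrightarrow> \<exists>g. integrable lborel g \<and> (LBINT x. \<bar>f x - g x\<bar>) < e \<and>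
       (\<lambda>n. \<integral>x. \<bar>g (x - X n) - g x\<bar> \<partial>lborel) \<longlonglongrightarrow> 0"
  shows "(\<lambda>n. \<integral>x. \<bar>f (x - X n) - f x\<bar> \<partial>lborel) \<longlonglongrightarrow> 0"
proof (rule LIMSEQ_I)
  fix e :: real assume e: "e > 0"
  obtain g where g: "integrable lborel g" "(LBINT x. \<bar>f x - g x\<bar>) < e / 3"
    "(\<lambda>n. \<integral>x. \<bar>g (x - X n) - g x\<bar> \<partial>lborel) \<longlonglongrightarrow> 0"
    using ap[of "e / 3"] e by auto
  have "eventually (\<lambda>n. (LBINT x. \<bar>g (x - X n) - g x\<bar>) < e / 3) sequentially"
    using g(3) e by (intro order_tendstoD) auto
  then obtain n0 where n0: "\<And>n. n \<ge> n0 \<Longrightarrow> (LBINT x. \<bar>g (x - X n) - g x\<bar>) < e / 3"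
    by (auto simp: eventually_sequentially)
  show "\<exists>no. \<forall>n\<ge>no. norm ((LBINT x. \<bar>f (x - X n) - f x\<bar>) - 0) < e"
  proof (intro exI allI impI)
    fix n assume n: "n \<ge> n0"
    note [intro] = f g(1) integrable_lborel_translate[OF f] integrable_lborel_translate[OF g(1)]
    let ?k = "\<lambda>x. \<bar>f x - g x\<bar>"
    have ik: "integrable lborel ?k" by (intro integrable_abs Bochner_Integration.integrable_diff f g(1))
    have ik': "integrable lborel (\<lambda>x. ?k (x - X n))" by (rule integrable_lborel_translate[OF ik])
    have im: "integrable lborel (\<lambda>x. \<bar>g (x - X n) - g x\<bar>)"
      by (intro integrable_abs Bochner_Integration.integrable_diff) auto
    have "(LBINT x. \<bar>f (x - X n) - f x\<bar>) \<le> (LBINT x. ?k (x - X n) + (\<bar>g (x - X n) - g x\<bar> + ?k x))"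
      by (intro integral_mono Bochner_Integration.integrable_add ik ik' integrable_abs Bochner_Integration.integrable_diff) auto
    also have "\<dots> = (LBINT x. ?k (x - X n)) + ((LBINT x. \<bar>g (x - X n) - g x\<bar>) + (LBINT x. ?k x))"
      using ik ik' im by simp
    also have "(LBINT x. ?k (x - X n)) = (LBINT x. ?k x)"
      using ik by (intro integral_lborel_translate) auto
    finally have "(LBINT x. \<bar>f (x - X n) - f x\<bar>) < e" using g(2) n0[OF n] by linarith
    then show "norm ((LBINT x. \<bar>f (x - X n) - f x\<bar>) - 0) < e" by simp
  qed
qed

text \<open>Induction over integrable functions; for an indicator, outer regularity supplies an open
  superset that is close in measure.\<close>

lemma translation_continuous_L1:
  fixes f :: "'a::euclidean_space \<Rightarrow> real"
  assumes "integrable lborel f" and X: "X \<longlonglongrightarrow> 0"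
  shows "(\<lambda>n. \<integral>x. \<bar>f (x - X n) - f x\<bar> \<partial>lborel) \<longlonglongrightarrow> 0"
  using assms(1)
proof (induction f rule: integrable_induct)
  case (base A c)
  have [measurable]: "A \<in> sets borel" using base by simp
  have iA: "integrable lborel (indicator A :: 'a \<Rightarrow> real)" using base by simp
  have "(\<lambda>n. \<integral>x. \<bar>indicator A (x - X n) - indicator A x :: real\<bar> \<partial>lborel) \<longlonglongrightarrow> 0"
  proof (rule translation_continuous_approx[OF iA])
    fix e :: real assume e: "e > 0"
    obtain U where U: "open U" "A \<subseteq> U" "emeasure lborel (U - A) < e"
      using outer_regular_lborel[OF _ e, of A] by auto
    have [measurable]: "U \<in> sets borel" using U by simp
    have "emeasure lborel U = emeasure lborel (A \<union> (U - A))" using U by (simp add: Un_absorb1)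
    also have "\<dots> \<le> emeasure lborel A + emeasure lborel (U - A)" by (rule emeasure_subadditive) auto
    also have "\<dots> < \<infinity>" using base U(3) by (auto simp: ennreal_add_less_top intro: less_trans[OF _ ennreal_less_top])
    finally have fU: "emeasure lborel U < \<infinity>" .
    have "(\<lambda>x. \<bar>indicator A x - indicator U x :: real\<bar>) = indicator (U - A)"
      using U by (auto simp: indicator_def fun_eq_iff)
    then have "(LBINT x. \<bar>indicator A x - indicator U x :: real\<bar>) = measure lborel (U - A)" by simp
    also have "\<dots> < e" using U(3) e unfolding measure_def
      by (metis enn2real_less_iff ennreal_less_top less_trans enn2real_ennreal less_imp_le)
    finally show "\<exists>g. integrable lborel g \<and> (LBINT x. \<bar>indicator A x - g x\<bar>) < e \<and>
       (\<lambda>n. \<integral>x. \<bar>g (x - X n) - g x\<bar> \<partial>lborel) \<longlonglongrightarrow> 0"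
      using translation_continuous_open[OF U(1) fU X] fU by (intro exI[of _ "indicator U"]) auto
  qed
  from tendsto_mult_left_zero[OF this, of "\<bar>c\<bar>"]
  have "(\<lambda>n. (LBINT x. \<bar>indicator A (x - X n) - indicator A x :: real\<bar> * \<bar>c\<bar>)) \<longlonglongrightarrow> 0" by simp
  then show ?case by (simp only: real_scaleR_def left_diff_distrib[symmetric] abs_mult)
next
  case (add f g)
  note [intro] = add.hyps(1,2) add.hyps(1,2)[THEN integrable_lborel_translate]
  have "(LBINT x. \<bar>f (x - X n) + g (x - X n) - (f x + g x)\<bar>)
     \<le> (LBINT x. \<bar>f (x - X n) - f x\<bar> + \<bar>g (x - X n) - g x\<bar>)" for n
    by (intro integral_mono integrable_abs Bochner_Integration.integrable_add Bochner_Integration.integrable_diff) auto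
  also have "\<And>n. (LBINT x. \<bar>f (x - X n) - f x\<bar> + \<bar>g (x - X n) - g x\<bar>) =
      (LBINT x. \<bar>f (x - X n) - f x\<bar>) + (LBINT x. \<bar>g (x - X n) - g x\<bar>)"
    by (intro Bochner_Integration.integral_add integrable_abs Bochner_Integration.integrable_diff) auto
  finally have le: "\<And>n. (LBINT x. \<bar>f (x - X n) + g (x - X n) - (f x + g x)\<bar>) \<le>
     (LBINT x. \<bar>f (x - X n) - f x\<bar>) + (LBINT x. \<bar>g (x - X n) - g x\<bar>)" .
  show ?case
    by (rule tendsto_sandwich[OF _ _ tendsto_const tendsto_add_zero[OF add.IH]])
       (use le in auto)
next
  case (lim f s)
  show ?case
  proof (rule translation_continuous_approx[OF lim.hyps(4)])
    fix e :: real assume e: "e > 0"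
    have [measurable]: "f \<in> borel_measurable borel" "s i \<in> borel_measurable borel" for i
      using lim.hyps(1,4) by (auto dest: borel_measurable_integrable)
    have "(\<lambda>i. \<integral>x. \<bar>f x - s i x\<bar> \<partial>lborel) \<longlonglongrightarrow> (\<integral>x. 0 \<partial>(lborel :: 'a measure))"
    proof (rule integral_dominated_convergence[where w="\<lambda>x. 3 * \<bar>f x\<bar>"])
      show "integrable lborel (\<lambda>x. 3 * \<bar>f x\<bar>)" using lim.hyps(4) by auto
      show "AE x in lborel. (\<lambda>i. \<bar>f x - s i x\<bar>) \<longlonglongrightarrow> 0"
      proof (rule AE_I2)
        fix x
        have "(\<lambda>i. f x - s i x) \<longlonglongrightarrow> f x - f x"
          using lim.hyps(2) by (intro tendsto_intros) auto
        then show "(\<lambda>i. \<bar>f x - s i x\<bar>) \<longlonglongrightarrow> 0" by (simp add: tendsto_rabs_zero)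
      qed
      show "AE x in lborel. norm \<bar>f x - s i x\<bar> \<le> 3 * \<bar>f x\<bar>" for i
      proof (rule AE_I2)
        fix x show "norm \<bar>f x - s i x\<bar> \<le> 3 * \<bar>f x\<bar>"
          using lim.hyps(3)[of x i] by auto
      qed
    qed measurable
    then have "eventually (\<lambda>i. (LBINT x. \<bar>f x - s i x\<bar>) < e) sequentially"
      using e by (intro order_tendstoD) auto
    then obtain i where "(LBINT x. \<bar>f x - s i x\<bar>) < e"
      using eventually_happens[of _ sequentially] by auto
    then show "\<exists>g. integrable lborel g \<and> (LBINT x. \<bar>f x - g x\<bar>) < e \<and>
       (\<lambda>n. \<integral>x. \<bar>g (x - X n) - g x\<bar> \<partial>lborel) \<longlonglongrightarrow> 0"
      using lim.hyps(1) lim.IH by blast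
  qed
qed

section \<open>Mollification\<close>

lemma compact_closed_neighbourhood:
  fixes K :: "'a::euclidean_space set"
  assumes "compact K"
  shows "compact {x. \<exists>y\<in>K. dist x y \<le> e}"
proof -
  have "{x. \<exists>y\<in>K. dist x y \<le> e} = (\<Union>y\<in>K. \<Union>z\<in>cball 0 e. {y + z})"
  proof (intro equalityI subsetI)
    fix x assume "x \<in> {x. \<exists>y\<in>K. dist x y \<le> e}"
    then obtain y where "y \<in> K" "dist x y \<le> e" by auto
    then have "x \<in> (\<Union>z\<in>cball 0 e. {y + z})"
      by (intro UN_I[of "x - y"]) (auto simp: dist_norm norm_minus_commute)
    with \<open>y \<in> K\<close> show "x \<in> (\<Union>y\<in>K. \<Union>z\<in>cball 0 e. {y + z})" by blast
  next
    fix x assume "x \<in> (\<Union>y\<in>K. \<Union>z\<in>cball 0 e. {y + z})"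
    then obtain y z where "y \<in> K" "norm z \<le> e" "x = y + z" by auto
    then show "x \<in> {x. \<exists>y\<in>K. dist x y \<le> e}" by (auto simp: dist_norm intro!: bexI[of _ y])
  qed
  then show ?thesis using compact_sums'[OF assms compact_cball] by simp
qed

text \<open>For each \<open>e\<close> a fresh bump is normalised instead of rescaling a fixed one.
  Only smoothness, nonnegativity, support in the ball of radius \<open>e\<close> and unit integral
  are used, so no scaling of integrals enters.\<close>

definition mollifier :: "real \<Rightarrow> 'a::euclidean_space \<Rightarrow> real" where
  "mollifier e z = flat_exp 0 (e\<^sup>2 - z \<bullet> z) / (\<integral>z. flat_exp 0 (e\<^sup>2 - z \<bullet> z) \<partial>(lborel :: 'a measure))"

definition mollify :: "real \<Rightarrow> ('a::euclidean_space \<Rightarrow> real) \<Rightarrow> 'a \<Rightarrow> real" where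
  "mollify e f x = (LBINT y. f y * mollifier e (x - y))"

lemma flat_exp_pos_iff: "e > 0 \<Longrightarrow> flat_exp 0 (e\<^sup>2 - z \<bullet> z) > 0 \<longleftrightarrow> norm z < e"
  by (auto simp: flat_exp_def norm_lt_square)

lemma flat_exp_nonneg: "flat_exp m t \<ge> 0"
  by (auto simp: flat_exp_def)

lemma flat_exp_le_1: "flat_exp 0 t \<le> 1"
  by (auto simp: flat_exp_def)

lemma borel_measurable_flat_exp_bump [measurable]:
  "(\<lambda>z::'a::euclidean_space. flat_exp 0 (a - z \<bullet> z)) \<in> borel_measurable borel"
  using C_k_imp_continuous[OF C_k_flat_exp[of 0 0 a]] by blast

lemma integrable_flat_exp_bump:
  assumes "e > 0"
  shows "integrable lborel (\<lambda>z::'a::euclidean_space. flat_exp 0 (e\<^sup>2 - z \<bullet> z))"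
proof (rule integrable_abs_le[OF integrable_indicator_bounded[OF _ bounded_ball[of 0 e]]])
  show "\<bar>flat_exp 0 (e\<^sup>2 - z \<bullet> z)\<bar> \<le> indicator (ball 0 e) z" for z :: 'a
    using flat_exp_pos_iff[OF assms, of z] flat_exp_nonneg[of 0 "e\<^sup>2 - z \<bullet> z"] flat_exp_le_1[of "e\<^sup>2 - z \<bullet> z"]
    by (auto simp: indicator_def)
qed auto

lemma flat_exp_bump_integral_pos:
  assumes "e > 0"
  shows "(\<integral>z. flat_exp 0 (e\<^sup>2 - z \<bullet> z) \<partial>(lborel :: 'a::euclidean_space measure)) > 0"
proof -
  have "(\<integral>z. flat_exp 0 (e\<^sup>2 - z \<bullet> z) \<partial>(lborel :: 'a measure)) \<noteq> 0"
  proof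
    assume "(\<integral>z. flat_exp 0 (e\<^sup>2 - z \<bullet> z) \<partial>(lborel :: 'a measure)) = 0"
    then have "AE z in (lborel::'a measure). flat_exp 0 (e\<^sup>2 - z \<bullet> z) = 0"
      using integral_nonneg_eq_0_iff_AE[OF integrable_flat_exp_bump[OF assms]] by (auto simp: flat_exp_nonneg)
    then have "AE z in (lborel::'a measure). z \<notin> ball 0 e"
      by eventually_elim (use flat_exp_pos_iff[OF assms] in force)
    then have "emeasure lborel {z::'a. z \<in> ball 0 e} = 0"
      by (subst (asm) AE_iff_measurable[OF _ refl]) auto
    then have "emeasure lborel (ball (0::'a) e) = 0" by (simp only: Collect_mem_eq)
    then show False using assms unit_ball_vol_pos[of "real DIM('a)"] by (simp add: emeasure_ball)
  qed
  moreover have "(\<integral>z. flat_exp 0 (e\<^sup>2 - z \<bullet> z) \<partial>(lborel :: 'a measure)) \<ge> 0"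
    by (simp add: flat_exp_nonneg)
  ultimately show ?thesis by linarith
qed

context
  fixes e :: real
  assumes e: "e > 0"
begin

lemma mollifier_nonneg: "mollifier e z \<ge> 0"
  using flat_exp_bump_integral_pos[OF e] by (auto simp: mollifier_def flat_exp_nonneg less_imp_le)

lemma mollifier_eq_0: "norm z \<ge> e \<Longrightarrow> mollifier e z = 0"
  using flat_exp_pos_iff[OF e, of z] flat_exp_nonneg[of 0 "e\<^sup>2 - z \<bullet> z"] by (auto simp: mollifier_def)

lemma borel_measurable_mollifier [measurable]: "mollifier e \<in> borel_measurable borel"
  unfolding mollifier_def[abs_def] by measurable

lemma integrable_mollifier: "integrable lborel (mollifier e)"
  unfolding mollifier_def[abs_def] using integrable_flat_exp_bump[OF e] by auto

lemma integral_mollifier: "(\<integral>z. mollifier e z \<partial>(lborel :: 'a::euclidean_space measure)) = 1"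
  using flat_exp_bump_integral_pos[OF e, where 'a='a] by (simp add: mollifier_def)

lemma nn_integral_mollifier: "(\<integral>\<^sup>+z. mollifier e z \<partial>(lborel :: 'a::euclidean_space measure)) = 1"
  by (simp add: nn_integral_eq_integral integrable_mollifier mollifier_nonneg integral_mollifier)

lemma C_k_mollifier: "C_k k (mollifier e)"
  using C_k_mult[OF C_k_flat_exp C_k_const, of k 0 "e\<^sup>2" "inverse (LBINT z. flat_exp 0 (e\<^sup>2 - z \<bullet> z))"]
  by (simp add: mollifier_def[abs_def] divide_inverse)

context
  fixes f :: "'a::euclidean_space \<Rightarrow> real" and K :: "'a set"
  assumes f [measurable]: "f \<in> borel_measurable borel"
    and f01: "\<And>x. 0 \<le> f x" "\<And>x. f x \<le> 1"
    and K: "compact K" "\<And>x. x \<notin> K \<Longrightarrow> f x = 0"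
begin

lemma integrable_bounded_compact_support: "integrable lborel f"
proof (rule integrable_abs_le[OF integrable_indicator_bounded[OF _ compact_imp_bounded[OF K(1)]]])
  show "\<bar>f x\<bar> \<le> indicator K x" for x
    using f01 K by (auto simp: indicator_def)
qed (use K in \<open>auto simp: borel_compact\<close>)

lemma C_k_mollify: "C_k k (mollify e f)"
  unfolding mollify_def[abs_def]
proof (rule C_k_convolution[OF integrable_bounded_compact_support C_k_mollifier])
  show "bounded {x::'a. mollifier e x \<noteq> 0}"
    using mollifier_eq_0[where 'a='a] by (intro bounded_subset[OF bounded_ball[of 0 e]]) (auto simp: not_le[symmetric])
qed

lemma mollify_eq: "mollify e f x = (LBINT z. mollifier e z * f (x - z))"
  unfolding mollify_def
  by (subst integral_lborel_reflect[symmetric, of _ x]) (auto simp: mult.commute)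

lemma integrable_mollifier_times:
  assumes [measurable]: "g \<in> borel_measurable borel" and "\<And>x. \<bar>g x\<bar> \<le> B"
  shows "integrable lborel (\<lambda>z. mollifier e z * g z)"
  by (rule Bochner_Integration.integrable_bound[OF integrable_mult_left[OF integrable_mollifier, of B]])
     (auto simp: abs_mult mollifier_nonneg intro!: mult_left_mono order_trans[OF assms(2)])

lemma integrable_mollifier_f: "integrable lborel (\<lambda>z. mollifier e z * f (x - z))"
  by (rule integrable_mollifier_times[where B=1]) (use f01 in auto)

lemma mollify_nonneg: "mollify e f x \<ge> 0"
  unfolding mollify_eq by (intro Bochner_Integration.integral_nonneg) (auto simp: mollifier_nonneg f01)

lemma mollify_le_1: "mollify e f x \<le> 1"
proof -
  have "mollify e f x \<le> (LBINT z. mollifier e (z::'a))"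
    unfolding mollify_eq
    by (intro integral_mono integrable_mollifier_f integrable_mollifier)
       (auto simp: mollifier_nonneg f01 intro: mult_left_le)
  then show ?thesis by (simp add: integral_mollifier)
qed

lemma mollify_eq_0:
  assumes "\<And>y. y \<in> K \<Longrightarrow> dist x y \<ge> e"
  shows "mollify e f x = 0"
proof -
  have "(\<lambda>y. f y * mollifier e (x - y)) = (\<lambda>y. 0)"
  proof
    show "f y * mollifier e (x - y) = 0" for y
      using assms[of y] K(2)[of y] mollifier_eq_0[of "x - y"] by (auto simp: dist_norm)
  qed
  then show ?thesis unfolding mollify_def by simp
qed

lemma mollify_test_function:
  assumes sub: "{x. \<exists>y\<in>K. dist x y \<le> e} \<subseteq> \<Omega>"
  shows "mollify e f \<in> test_functions \<Omega>"
proof -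
  have "compact {x. \<exists>y\<in>K. dist x y \<le> e}" by (rule compact_closed_neighbourhood[OF K(1)])
  moreover have "{x. mollify e f x \<noteq> 0} \<subseteq> {x. \<exists>y\<in>K. dist x y \<le> e}"
  proof clarify
    fix x assume "mollify e f x \<noteq> 0"
    then have "\<not> (\<forall>y\<in>K. e \<le> dist x y)" using mollify_eq_0[of x] by blast
    then show "\<exists>y\<in>K. dist x y \<le> e" by (auto simp: not_le intro: less_imp_le)
  qed
  ultimately have "closure {x. mollify e f x \<noteq> 0} \<subseteq> {x. \<exists>y\<in>K. dist x y \<le> e}"
    "compact (closure {x. mollify e f x \<noteq> 0})"
    by (auto simp: closure_minimal compact_imp_closed compact_closure intro: bounded_subset compact_imp_bounded)
  then show ?thesis using C_k_mollify sub by (auto simp: test_functions_def)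
qed

text \<open>Jensen's inequality for the square and the probability weight
  \<open>mollifier e\<close>, read off from the nonnegativity of the variance of \<open>?g\<close>
  around its mean \<open>m\<close>.\<close>

lemma mollify_jensen:
  "ennreal ((mollify e f x - mollify e f y)\<^sup>2)
     \<le> (\<integral>\<^sup>+z. ennreal (mollifier e z * (f (x - z) - f (y - z))\<^sup>2) \<partial>lborel)"
proof -
  let ?g = "\<lambda>z. f (x - z) - f (y - z)"
  have g1: "\<bar>?g z\<bar> \<le> 1" for z using f01[of "x - z"] f01[of "y - z"] by auto
  have i1: "integrable lborel (\<lambda>z. mollifier e z * ?g z)"
    by (rule integrable_mollifier_times[where B=1]) (use g1 in auto)
  have i2: "integrable lborel (\<lambda>z. mollifier e z * (?g z)\<^sup>2)"
    by (rule integrable_mollifier_times[where B=1]) (use g1 in \<open>auto simp: abs_square_le_1\<close>)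
  define m where "m = mollify e f x - mollify e f y"
  have m: "(LBINT z. mollifier e z * ?g z) = m"
    unfolding m_def mollify_eq by (simp add: right_diff_distrib integrable_mollifier_f)
  have "0 \<le> (LBINT z. mollifier e z * (?g z - m)\<^sup>2)"
    by (intro Bochner_Integration.integral_nonneg) (auto simp: mollifier_nonneg)
  also have "(\<lambda>z. mollifier e z * (?g z - m)\<^sup>2) =
      (\<lambda>z. mollifier e z * (?g z)\<^sup>2 - 2 * m * (mollifier e z * ?g z) + m\<^sup>2 * mollifier e z)"
    by (auto simp: power2_eq_square algebra_simps)
  also have "(LBINT z. mollifier e z * (?g z)\<^sup>2 - 2 * m * (mollifier e z * ?g z) + m\<^sup>2 * mollifier e z)
      = (LBINT z. mollifier e z * (?g z)\<^sup>2) - 2 * m * m + m\<^sup>2"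
    using i1 i2 m integrable_mollifier[where 'a='a]
    by (subst Bochner_Integration.integral_add Bochner_Integration.integral_diff;
        simp add: integral_mollifier)+
  finally have "m\<^sup>2 \<le> (LBINT z. mollifier e z * (?g z)\<^sup>2)" by (simp add: power2_eq_square)
  then show ?thesis
    unfolding m_def by (subst nn_integral_eq_integral[OF i2]) (auto simp: mollifier_nonneg ennreal_leI)
qed

lemma borel_measurable_mollify [measurable]: "mollify e f \<in> borel_measurable borel"
  using C_k_imp_continuous[OF C_k_mollify[of 0]] by blast

text \<open>After Jensen and Fubini the inner integral is the energy of \<open>f\<close> shifted by
  \<open>z\<close> in both variables. The weight depends only on the difference
  \<open>fst p - snd p\<close> and the integral extends over the whole space, so the shift leaves
  the energy unchanged, and the mollifier integrates to 1.\<close>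

lemma mollify_energy:
  fixes W :: "'a \<Rightarrow> real"
  assumes [measurable]: "W \<in> borel_measurable borel" and W: "\<And>z. W z \<ge> 0"
  shows "(\<integral>\<^sup>+p. ennreal ((mollify e f (fst p) - mollify e f (snd p))\<^sup>2 * W (fst p - snd p)) \<partial>lborel)
     \<le> (\<integral>\<^sup>+p. ennreal ((f (fst p) - f (snd p))\<^sup>2 * W (fst p - snd p)) \<partial>lborel)"
proof -
  define F where "F p = ennreal ((f (fst p) - f (snd p))\<^sup>2 * W (fst p - snd p))" for p :: "'a \<times> 'a"
  have [measurable]: "F \<in> borel_measurable borel"
    unfolding F_def[abs_def] borel_prod[symmetric] by measurable
  let ?h = "\<lambda>p z. ennreal (mollifier e z * (f (fst p - z) - f (snd p - z))\<^sup>2 * W (fst p - snd p))"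
  have hm: "case_prod ?h \<in> borel_measurable ((lborel :: ('a \<times> 'a) measure) \<Otimes>\<^sub>M (lborel :: 'a measure))"
    unfolding lborel_prod[symmetric] by measurable
  have "(\<integral>\<^sup>+p. ennreal ((mollify e f (fst p) - mollify e f (snd p))\<^sup>2 * W (fst p - snd p)) \<partial>lborel)
     \<le> (\<integral>\<^sup>+p. (\<integral>\<^sup>+z. ?h p z \<partial>lborel) \<partial>lborel)"
  proof (rule nn_integral_mono)
    fix p :: "'a \<times> 'a"
    have "ennreal ((mollify e f (fst p) - mollify e f (snd p))\<^sup>2 * W (fst p - snd p))
        \<le> (\<integral>\<^sup>+z. ennreal (mollifier e z * (f (fst p - z) - f (snd p - z))\<^sup>2) \<partial>lborel) * ennreal (W (fst p - snd p))"
      using mollify_jensen[of "fst p" "snd p"] by (simp add: ennreal_mult W mult_right_mono)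
    also have "\<dots> = (\<integral>\<^sup>+z. ennreal (mollifier e z * (f (fst p - z) - f (snd p - z))\<^sup>2) * ennreal (W (fst p - snd p)) \<partial>lborel)"
      by (rule nn_integral_multc[symmetric]) measurable
    finally show "ennreal ((mollify e f (fst p) - mollify e f (snd p))\<^sup>2 * W (fst p - snd p)) \<le> (\<integral>\<^sup>+z. ?h p z \<partial>lborel)"
      by (simp add: ennreal_mult W mollifier_nonneg)
  qed
  also have "\<dots> = (\<integral>\<^sup>+z. (\<integral>\<^sup>+p. ?h p z \<partial>lborel) \<partial>lborel)"
    by (rule lborel_pair.Fubini'[OF hm, symmetric])
  also have "\<dots> = (\<integral>\<^sup>+z. ennreal (mollifier e (z::'a)) * (\<integral>\<^sup>+p. F p \<partial>lborel) \<partial>lborel)"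
  proof (rule nn_integral_cong)
    fix z :: 'a
    have "(\<integral>\<^sup>+p. ?h p z \<partial>lborel) = (\<integral>\<^sup>+p. ennreal (mollifier e z) * F (p - (z, z)) \<partial>lborel)"
      by (intro nn_integral_cong) (simp add: F_def ennreal_mult[symmetric] W mollifier_nonneg mult.assoc)
    also have "\<dots> = ennreal (mollifier e z) * (\<integral>\<^sup>+p. F (p - (z, z)) \<partial>lborel)"
      by (rule nn_integral_cmult) measurable
    also have "(\<integral>\<^sup>+p. F (p - (z, z)) \<partial>lborel) = (\<integral>\<^sup>+p. F p \<partial>lborel)"
      by (rule nn_integral_lborel_translate) measurable
    finally show "(\<integral>\<^sup>+p. ?h p z \<partial>lborel) = ennreal (mollifier e z) * (\<integral>\<^sup>+p. F p \<partial>lborel)" .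
  qed
  also have "\<dots> = (\<integral>\<^sup>+p. F p \<partial>lborel)"
    by (subst nn_integral_multc) (auto simp: nn_integral_mollifier)
  finally show ?thesis by (simp only: F_def)
qed

text \<open>Minkowski's integral inequality in L1: the mollification is an average of translates by
  less than \<open>e\<close>, so its distance to \<open>f\<close> is at most the largest distance of
  these translates.\<close>

lemma mollify_L1_distance:
  assumes d: "\<And>z. norm z < e \<Longrightarrow> (LBINT x. \<bar>f (x - z) - f x\<bar>) \<le> d"
  shows "(\<integral>\<^sup>+x. ennreal \<bar>mollify e f x - f x\<bar> \<partial>lborel) \<le> ennreal d"
proof -
  let ?h = "\<lambda>x z. ennreal (mollifier e z * \<bar>f (x - z) - f x\<bar>)"
  have "(\<integral>\<^sup>+x. ennreal \<bar>mollify e f x - f x\<bar> \<partial>lborel) \<le> (\<integral>\<^sup>+x. (\<integral>\<^sup>+z. ?h x z \<partial>lborel) \<partial>lborel)"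
  proof (rule nn_integral_mono)
    fix x
    have "\<bar>f (x - z) - f x\<bar> \<le> 1" for z using f01[of "x - z"] f01[of x] by auto
    then have i: "integrable lborel (\<lambda>z. mollifier e z * \<bar>f (x - z) - f x\<bar>)"
      by (intro integrable_mollifier_times[where B=1]) auto
    have "mollify e f x - f x = (LBINT z. mollifier e z * f (x - z)) - (\<integral>z. mollifier e z * f x \<partial>(lborel :: 'a measure))"
      by (simp add: mollify_eq integral_mollifier)
    also have "\<dots> = (LBINT z. mollifier e z * (f (x - z) - f x))"
      using integrable_mollifier_f[of x] integrable_mollifier[where 'a='a] by (simp add: right_diff_distrib)
    finally have "\<bar>mollify e f x - f x\<bar> \<le> (LBINT z. norm (mollifier e z * (f (x - z) - f x)))"
      using integral_norm_bound[of lborel "\<lambda>z. mollifier e z * (f (x - z) - f x)"] by simp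
    also have "\<dots> = (LBINT z. mollifier e z * \<bar>f (x - z) - f x\<bar>)"
      by (simp add: abs_mult mollifier_nonneg)
    finally show "ennreal \<bar>mollify e f x - f x\<bar> \<le> (\<integral>\<^sup>+z. ?h x z \<partial>lborel)"
      by (subst nn_integral_eq_integral[OF i]) (auto simp: mollifier_nonneg ennreal_leI)
  qed
  also have "\<dots> = (\<integral>\<^sup>+z. (\<integral>\<^sup>+x. ?h x z \<partial>lborel) \<partial>lborel)"
    by (rule lborel_pair.Fubini'[symmetric]) measurable
  also have "\<dots> \<le> (\<integral>\<^sup>+z. ennreal (mollifier e z) * ennreal d \<partial>(lborel :: 'a measure))"
  proof (rule nn_integral_mono)
    fix z :: 'a
    have i: "integrable lborel (\<lambda>x. \<bar>f (x - z) - f x\<bar>)"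
      using integrable_bounded_compact_support integrable_lborel_translate[OF integrable_bounded_compact_support]
      by (intro integrable_abs Bochner_Integration.integrable_diff)
    have "(\<integral>\<^sup>+x. ?h x z \<partial>lborel) = ennreal (mollifier e z) * ennreal (LBINT x. \<bar>f (x - z) - f x\<bar>)"
      using i by (simp add: ennreal_mult mollifier_nonneg nn_integral_cmult nn_integral_eq_integral)
    also have "\<dots> \<le> ennreal (mollifier e z) * ennreal d"
      using d[of z] mollifier_eq_0[of z] by (cases "norm z < e") (auto intro!: mult_left_mono ennreal_leI)
    finally show "(\<integral>\<^sup>+x. ?h x z \<partial>lborel) \<le> ennreal (mollifier e z) * ennreal d" .
  qed
  also have "\<dots> = ennreal d"
    by (subst nn_integral_multc) (auto simp: nn_integral_mollifier)
  finally show ?thesis .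
qed

end

end

text \<open>The radii are chosen so that the L1 distance is at most 1/(n+1), and a subsequence then
  converges almost everywhere. This replaces an argument with Lebesgue points, and one suitable
  sequence of radii is all that is needed later.\<close>

lemma mollify_AE_converges:
  fixes f :: "'a::euclidean_space \<Rightarrow> real"
  assumes f [measurable]: "f \<in> borel_measurable borel"
    and f01: "\<And>x. 0 \<le> f x" "\<And>x. f x \<le> 1"
    and K: "compact K" "\<And>x. x \<notin> K \<Longrightarrow> f x = 0" and d: "d > 0"
  obtains e where "\<And>n. 0 < e n" "\<And>n::nat. e n \<le> d" "AE x in lborel. (\<lambda>n. mollify (e n) f x) \<longlonglongrightarrow> f x"
proof -
  note fint = integrable_bounded_compact_support[OF zero_less_one f f01 K]
  \<comment> \<open>If no radius worked, there would be shifts tending to 0 whose L1 distance stays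
    above 1/(n+1), against the sequential continuity of translations.\<close>
  have "\<exists>e. 0 < e \<and> e \<le> d \<and> (\<forall>z. norm z < e \<longrightarrow> (LBINT x. \<bar>f (x - z) - f x\<bar>) \<le> 1 / real (Suc n))" for n
  proof (rule ccontr)
    assume "\<not> ?thesis"
    then have *: "\<exists>z. norm z < min d (1 / real (Suc m)) \<and> \<not> (LBINT x. \<bar>f (x - z) - f x\<bar>) \<le> 1 / real (Suc n)" for m
      using d by (smt (verit, ccfv_threshold) divide_pos_pos of_nat_0_less_iff zero_less_Suc min.cobounded1)
    then obtain X where X: "\<And>m. norm (X m) < min d (1 / real (Suc m))"
        "\<And>m. \<not> (LBINT x. \<bar>f (x - X m) - f x\<bar>) \<le> 1 / real (Suc n)"
      by metis
    have "X \<longlonglongrightarrow> 0"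
    proof (rule Lim_null_comparison)
      show "eventually (\<lambda>m. norm (X m) \<le> 1 / real (Suc m)) sequentially"
        using X(1) by (auto intro!: always_eventually less_imp_le)
      show "(\<lambda>m. 1 / real (Suc m)) \<longlonglongrightarrow> 0" using LIMSEQ_inverse_real_of_nat by (simp add: inverse_eq_divide)
    qed
    from translation_continuous_L1[OF fint this]
    have "eventually (\<lambda>m. (LBINT x. \<bar>f (x - X m) - f x\<bar>) < 1 / real (Suc n)) sequentially"
      by (intro order_tendstoD) auto
    then show False using X(2) by (auto simp: eventually_sequentially) (meson less_imp_le order_refl)
  qed
  then obtain e where e: "\<And>n. 0 < e n" "\<And>n. e n \<le> d"
      "\<And>n z. norm z < e n \<Longrightarrow> (LBINT x. \<bar>f (x - z) - f x\<bar>) \<le> 1 / real (Suc n)" by metis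
  have [measurable]: "mollify (e n) f \<in> borel_measurable borel" for n
    using borel_measurable_mollify[OF e(1) f f01 K] .
  have le: "(\<integral>\<^sup>+x. ennreal \<bar>mollify (e n) f x - f x\<bar> \<partial>lborel) \<le> ennreal (1 / real (Suc n))" for n
    by (rule mollify_L1_distance[OF e(1) f f01 K e(3)])
  have i: "integrable lborel (\<lambda>x. mollify (e n) f x - f x)" for n
    using le[of n] by (intro integrableI_bounded) (auto intro: le_less_trans)
  have "(LBINT x. norm (mollify (e n) f x - f x)) \<le> 1 / real (Suc n)" for n
    using le[of n] i[of n, THEN integrable_norm] by (simp add: nn_integral_eq_integral)
  then have "(\<lambda>n. \<integral>x. norm (mollify (e n) f x - f x) \<partial>lborel) \<longlonglongrightarrow> 0"
    by (intro tendsto_sandwich[OF _ _ tendsto_const LIMSEQ_inverse_real_of_nat])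
       (auto simp: inverse_eq_divide intro!: always_eventually)
  from tendsto_L1_AE_subseq[OF i this]
  obtain r :: "nat \<Rightarrow> nat" where "AE x in lborel. (\<lambda>n. mollify (e (r n)) f x - f x) \<longlonglongrightarrow> 0" by auto
  then have "AE x in lborel. (\<lambda>n. mollify (e (r n)) f x) \<longlonglongrightarrow> f x"
    by eventually_elim (rule LIM_zero_cancel)
  then show ?thesis using e by (intro that[of "\<lambda>n. e (r n)"]) auto
qed

section \<open>Boundary strips of Lipschitz domains\<close>

lemma open_near_complement: "open {x::'a::metric_space. \<exists>q. q \<notin> \<Omega> \<and> dist x q < e}"
proof -
  have "{x. \<exists>q. q \<notin> \<Omega> \<and> dist x q < e} = (\<Union>q\<in>-\<Omega>. ball q e)"
    by (auto simp: dist_commute)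
  then show ?thesis by auto
qed

text \<open>Packing disjoint translates bounds the volume of a thin set. It stands in for
  integration along the direction \<open>v\<close>, which would require coordinates adapted to that
  direction.\<close>

lemma sum_translates_le:
  fixes A :: "'a::euclidean_space set" and v :: 'a
  assumes A: "A \<in> lmeasurable" and B: "B \<in> lmeasurable"
    and sub: "\<And>j x. j < m \<Longrightarrow> x \<in> A \<Longrightarrow> real j *\<^sub>R v + x \<in> B"
    and dis: "\<And>x y i j. x \<in> A \<Longrightarrow> y \<in> A \<Longrightarrow> i < (j::nat) \<Longrightarrow> real i *\<^sub>R v + x \<noteq> real j *\<^sub>R v + y"
  shows "real m * measure lebesgue A \<le> measure lebesgue B"
proof -
  let ?T = "\<lambda>j::nat. (+) (real j *\<^sub>R v) ` A"
  have T: "?T j \<in> lmeasurable" for j using A by (rule measurable_translation)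
  have "disjoint_family_on ?T {..<m}"
    unfolding disjoint_family_on_def
  proof (intro ballI impI)
    fix i j :: nat assume "i \<noteq> j"
    then show "?T i \<inter> ?T j = {}"
      using dis[of _ _ i j] dis[of _ _ j i] by (auto simp: image_iff) (metis nat_neq_iff)
  qed
  then have "measure lebesgue (\<Union>j<m. ?T j) = (\<Sum>j<m. measure lebesgue (?T j))"
  proof (rule measure_finite_Union[rotated 2])
    show "emeasure lebesgue (?T j) \<noteq> \<infinity>" for j
      using fmeasurableD2[OF T[of j]] unfolding infinity_ennreal_def .
  qed (use fmeasurableD[OF T] in blast)+
  also have "\<dots> = real m * measure lebesgue A"
    by (simp add: measure_translation)
  finally have "real m * measure lebesgue A = measure lebesgue (\<Union>j<m. ?T j)" by simp
  also have "\<dots> \<le> measure lebesgue B"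
    using T B sub by (intro measure_mono_fmeasurable) (auto intro!: fmeasurableD fmeasurable.finite_UN)
  finally show ?thesis .
qed

text \<open>The translates of a strip of height \<open>d\<close> by multiples of \<open>d *\<^sub>R e\<close> are disjoint, and about
  \<open>1 / d\<close> of them fit into a fixed ball.\<close>

lemma lipschitz_graph_strip:
  fixes \<Omega> :: "'a::euclidean_space set"
  assumes \<Omega>: "open \<Omega>" and U: "open U" "p \<in> U" and e: "norm e = 1"
    and g: "L-lipschitz_on {z. z \<bullet> e = 0} (g :: 'a \<Rightarrow> real)"
    and graph: "\<Omega> \<inter> U = {x \<in> U. x \<bullet> e > g (x - (x \<bullet> e) *\<^sub>R e)}"
  shows "\<exists>r>0. \<exists>C\<ge>0. \<exists>s0>0. \<forall>s. 0 < s \<and> s < s0 \<longrightarrow>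
    measure lebesgue {x \<in> \<Omega> \<inter> ball p r. \<exists>q. q \<notin> \<Omega> \<and> dist x q < s} \<le> C * s"
proof -
  obtain R where R: "R > 0" "ball p R \<subseteq> U" using U openE by blast
  have L: "L \<ge> 0" using g by (rule lipschitz_on_nonneg)
  have ee: "e \<bullet> e = 1" using e by (simp add: norm_eq_1)
  \<comment> \<open>The signed height above the graph in direction \<open>e\<close>. Shifting a
    point by \<open>s *\<^sub>R e\<close> leaves its projection fixed and adds exactly
    \<open>s\<close> to the height.\<close>
  define t where "t x = x \<bullet> e - g (x - (x \<bullet> e) *\<^sub>R e)" for x
  have t_shift: "t (s *\<^sub>R e + x) = s + t x" for s x
    by (simp add: t_def inner_add_left ee scaleR_add_left add_diff_eq)
  let ?B = "ball p (R / 2 + 1)"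
  \<comment> \<open>The packing bound |A| \<le> 2 d |B| with d = (2L+1) s gives \<open>C\<close>. In
    \<open>s0\<close>, the bound R/2 keeps the nearby point of the complement inside
    \<open>U\<close>, and the other bound makes d at most 1/2.\<close>
  define C where "C = 2 * (2 * L + 1) * measure lebesgue ?B"
  define s0 where "s0 = min (R / 2) (1 / (2 * (2 * L + 1)))"
  have "measure lebesgue {x \<in> \<Omega> \<inter> ball p (R / 2). \<exists>q. q \<notin> \<Omega> \<and> dist x q < s} \<le> C * s"
    if s: "0 < s" "s < s0" for s
  proof -
    define A where "A = {x \<in> \<Omega> \<inter> ball p (R / 2). \<exists>q. q \<notin> \<Omega> \<and> dist x q < s}"
    \<comment> \<open>Moving by less than \<open>s\<close> changes the height by less than (2L+1) s:
      at most \<open>s\<close> through the component along \<open>e\<close>, and 2 L s through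
      \<open>g\<close>, since the triangle inequality bounds the change of the projection by twice
      the step.\<close>
    define d where "d = (2 * L + 1) * s"
    have d: "d > 0" "d \<le> 1 / 2"
      using s L mult_pos_pos[of "2 * L + 1" s] by (auto simp: d_def s0_def field_simps)
    have tA: "0 < t x \<and> t x < d" if xA: "x \<in> A" for x
    proof -
      obtain q where x: "x \<in> \<Omega>" "dist p x < R / 2" and q: "q \<notin> \<Omega>" "dist x q < s"
        using xA by (auto simp: A_def)
      have "dist p q < R" using x q s dist_triangle[of p q x] by (auto simp: s0_def)
      then have qU: "q \<in> U" using R by auto
      have xU: "x \<in> U" using x R by auto
      have "t x > 0" "t q \<le> 0"
        using x xU q qU graph[THEN eqset_imp_iff, of x] graph[THEN eqset_imp_iff, of q]
        by (simp_all add: t_def)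
      then have tx: "t x > 0" and tq: "t q \<le> 0" .
      have n: "norm (x - q) < s" using q by (simp add: dist_norm)
      have ie: "\<bar>(x - q) \<bullet> e\<bar> \<le> norm (x - q)" using Cauchy_Schwarz_ineq2[of "x - q" e] e by simp
      let ?pr = "\<lambda>x. x - (x \<bullet> e) *\<^sub>R e"
      have "?pr x - ?pr q = (x - q) - ((x - q) \<bullet> e) *\<^sub>R e"
        by (simp add: inner_diff_left scaleR_diff_left)
      also have "norm \<dots> \<le> norm (x - q) + \<bar>(x - q) \<bullet> e\<bar>"
        using norm_triangle_ineq4[of "x - q" "((x - q) \<bullet> e) *\<^sub>R e"] e by simp
      finally have npr: "norm (?pr x - ?pr q) \<le> 2 * norm (x - q)" using ie by linarith
      have "dist (g (?pr x)) (g (?pr q)) \<le> L * dist (?pr x) (?pr q)"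
        by (rule lipschitz_onD[OF g]) (simp_all add: inner_diff_left ee)
      also have "\<dots> \<le> L * (2 * norm (x - q))" using L npr by (auto simp: dist_norm intro: mult_left_mono)
      finally have "\<bar>g (?pr x) - g (?pr q)\<bar> \<le> L * (2 * norm (x - q))" by (simp add: dist_real_def)
      then have "t x \<le> t q + (2 * L + 1) * norm (x - q)"
        using ie by (simp add: t_def inner_diff_left algebra_simps)
      moreover have "(2 * L + 1) * norm (x - q) < d" using n L by (simp add: d_def)
      ultimately show ?thesis using tx tq by linarith
    qed
    have "A = \<Omega> \<inter> ball p (R / 2) \<inter> {x. \<exists>q. q \<notin> \<Omega> \<and> dist x q < s}" by (auto simp: A_def)
    then have "open A" using \<Omega> open_near_complement[of \<Omega> s] by (simp only: open_Int open_ball)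
    then have A: "A \<in> lmeasurable"
      by (intro lmeasurable_open) (auto simp: A_def intro: bounded_subset[OF bounded_ball[of p "R/2"]])
    \<comment> \<open>Shifts by \<open>j * d\<close> with \<open>j < m\<close> have length at most
      1, so they stay in \<open>?B\<close>; since d \<le> 1/2, rounding 1/d down loses at most half
      of it.\<close>
    define m where "m = nat \<lfloor>1 / d\<rfloor>"
    have "1 / d \<ge> 2" using d by (simp add: field_simps)
    then have m: "real m \<le> 1 / d" "real m \<ge> 1 / (2 * d)"
      using floor_correct[of "1 / d"] d by (auto simp: m_def of_nat_nat field_simps)
    \<comment> \<open>The translates may leave \<open>U\<close>. Their disjointness only compares
      heights: \<open>t\<close> takes values in (0, d) on \<open>A\<close>, and
      \<open>t_shift\<close> holds at every point of the space.\<close>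
    have "real m * measure lebesgue A \<le> measure lebesgue ?B"
    proof (rule sum_translates_le[OF A, where v="d *\<^sub>R e"])
      fix j x assume j: "j < m" and x: "x \<in> A"
      have "real j * d \<le> real m * d" using j d by simp
      also have "\<dots> \<le> 1" using m d by (simp add: field_simps)
      finally have "dist x (real j *\<^sub>R d *\<^sub>R e + x) \<le> 1" using d e by (simp add: dist_norm abs_mult)
      then show "real j *\<^sub>R d *\<^sub>R e + x \<in> ?B"
        using x dist_triangle[of p "real j *\<^sub>R d *\<^sub>R e + x" x] by (auto simp: A_def)
    next
      fix x y and i j :: nat assume xy: "x \<in> A" "y \<in> A" and ij: "i < j"
      have "real i * d + t x < real i * d + d" using tA[OF xy(1)] by simp
      also have "\<dots> = real (Suc i) * d" by (simp add: algebra_simps)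
      also have "\<dots> \<le> real j * d" using ij d by (intro mult_right_mono) auto
      also have "\<dots> < real j * d + t y" using tA[OF xy(2)] by simp
      finally have "t ((real i * d) *\<^sub>R e + x) < t ((real j * d) *\<^sub>R e + y)" by (simp only: t_shift)
      then show "real i *\<^sub>R d *\<^sub>R e + x \<noteq> real j *\<^sub>R d *\<^sub>R e + y" by auto
    qed auto
    then have "1 / (2 * d) * measure lebesgue A \<le> measure lebesgue ?B"
      using mult_right_mono[OF m(2), of "measure lebesgue A"] by simp
    then have "measure lebesgue A \<le> C * s"
      using d by (simp add: C_def d_def field_simps)
    then show ?thesis by (simp add: A_def)
  qed
  moreover have "C \<ge> 0" "s0 > 0" using L R by (auto simp: C_def s0_def)
  ultimately have "\<exists>C\<ge>0. \<exists>s0>0. \<forall>s. 0 < s \<and> s < s0 \<longrightarrow>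
    measure lebesgue {x \<in> \<Omega> \<inter> ball p (R / 2). \<exists>q. q \<notin> \<Omega> \<and> dist x q < s} \<le> C * s" by blast
  moreover have "R / 2 > 0" using R by simp
  ultimately show ?thesis by blast
qed

lemma frontier_between:
  fixes \<Omega> :: "'a::euclidean_space set"
  assumes "x \<in> \<Omega>" "q \<notin> \<Omega>"
  obtains z where "z \<in> frontier \<Omega>" "dist x z \<le> dist x q"
proof -
  have "closed_segment x q \<inter> frontier \<Omega> \<noteq> {}"
    by (rule connected_Int_frontier) (use assms in auto)
  then obtain z where "z \<in> closed_segment x q" "z \<in> frontier \<Omega>" by blast
  then show ?thesis using that segment_bound(1)[of z x q] by (auto simp: dist_norm norm_minus_commute)
qed

text \<open>Compactness of the frontier glues the local estimates. The cover uses balls of half the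
  radius: a point of \<Omega> within \<open>s\<close> of the complement is within \<open>s\<close>
  of a frontier point, that point lies in some half ball, and \<open>s < E \<le> r p / 2\<close>
  then puts the original point into the full ball.\<close>

lemma lipschitz_domain_strip:
  fixes \<Omega> :: "'a::euclidean_space set"
  assumes \<Omega>: "bounded_lipschitz_domain \<Omega>"
  obtains C s0 where "C \<ge> 0" "s0 > 0"
    "\<And>s. 0 < s \<Longrightarrow> s < s0 \<Longrightarrow> measure lebesgue {x \<in> \<Omega>. \<exists>q. q \<notin> \<Omega> \<and> dist x q < s} \<le> C * s"
proof -
  have o: "open \<Omega>" and b: "bounded \<Omega>" using \<Omega> by (auto simp: bounded_lipschitz_domain_def)
  \<comment> \<open>The local estimate in one predicate, so that radius, constant and threshold can
    be chosen together as functions of \<open>p\<close>.\<close>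
  define Q where "Q p r C s0 \<longleftrightarrow> r > 0 \<and> C \<ge> 0 \<and> s0 > 0 \<and> (\<forall>s. 0 < s \<and> s < s0 \<longrightarrow>
    measure lebesgue {x \<in> \<Omega> \<inter> ball p r. \<exists>q. q \<notin> \<Omega> \<and> dist x q < s} \<le> C * s)" for p r C s0
  have "\<forall>p\<in>frontier \<Omega>. \<exists>r C s0. Q p r C s0"
  proof
    fix p assume "p \<in> frontier \<Omega>"
    then obtain U e L g where "open U" "p \<in> U" "norm e = 1"
        "L-lipschitz_on {z. z \<bullet> e = 0} (g :: 'a \<Rightarrow> real)"
        "\<Omega> \<inter> U = {x \<in> U. x \<bullet> e > g (x - (x \<bullet> e) *\<^sub>R e)}"
      using \<Omega> unfolding bounded_lipschitz_domain_def by blast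
    from lipschitz_graph_strip[OF o this] show "\<exists>r C s0. Q p r C s0" unfolding Q_def by blast
  qed
  then obtain r C s0 where Q: "\<And>p. p \<in> frontier \<Omega> \<Longrightarrow> Q p (r p) (C p) (s0 p)"
    by metis
  then have *: "\<And>p. p \<in> frontier \<Omega> \<Longrightarrow> r p > 0 \<and> C p \<ge> 0 \<and> s0 p > 0"
    and le: "\<And>p s. p \<in> frontier \<Omega> \<Longrightarrow> 0 < s \<Longrightarrow> s < s0 p \<Longrightarrow>
      measure lebesgue {x \<in> \<Omega> \<inter> ball p (r p). \<exists>q. q \<notin> \<Omega> \<and> dist x q < s} \<le> C p * s"
    unfolding Q_def by blast+
  have "compact (frontier \<Omega>)" using b by (simp add: compact_frontier_bounded)
  moreover have "frontier \<Omega> \<subseteq> (\<Union>p\<in>frontier \<Omega>. ball p (r p / 2))" using * by force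
  ultimately obtain F where F: "F \<subseteq> frontier \<Omega>" "finite F" "frontier \<Omega> \<subseteq> (\<Union>p\<in>F. ball p (r p / 2))"
    by (elim compactE_image) auto
  define E where "E = Min (insert 1 ((\<lambda>p. min (s0 p) (r p / 2)) ` F))"
  have E: "E > 0" "\<And>p. p \<in> F \<Longrightarrow> E \<le> s0 p" "\<And>p. p \<in> F \<Longrightarrow> E \<le> r p / 2"
  proof -
    show "E > 0" using F * by (auto simp: E_def subset_iff)
    have "E \<le> min (s0 p) (r p / 2)" if "p \<in> F" for p
      unfolding E_def using F that by (intro Min_le) auto
    then show "\<And>p. p \<in> F \<Longrightarrow> E \<le> s0 p" "\<And>p. p \<in> F \<Longrightarrow> E \<le> r p / 2" by force+
  qed
  have "measure lebesgue {x \<in> \<Omega>. \<exists>q. q \<notin> \<Omega> \<and> dist x q < s} \<le> (\<Sum>p\<in>F. C p) * s"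
    if s: "0 < s" "s < E" for s
  proof -
    let ?S = "{x. \<exists>q. q \<notin> \<Omega> \<and> dist x q < s}"
    let ?A = "\<lambda>p. {x \<in> \<Omega> \<inter> ball p (r p). \<exists>q. q \<notin> \<Omega> \<and> dist x q < s}"
    have sub: "{x \<in> \<Omega>. \<exists>q. q \<notin> \<Omega> \<and> dist x q < s} \<subseteq> (\<Union>p\<in>F. ?A p)"
    proof
      fix x assume "x \<in> {x \<in> \<Omega>. \<exists>q. q \<notin> \<Omega> \<and> dist x q < s}"
      then obtain q where q: "x \<in> \<Omega>" "q \<notin> \<Omega>" "dist x q < s" by auto
      obtain z where z: "z \<in> frontier \<Omega>" "dist x z \<le> dist x q" using frontier_between[OF q(1,2)] .
      then obtain p where p: "p \<in> F" "dist p z < r p / 2" using F by auto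
      have "dist p x < r p"
        using p z q s E(3)[OF p(1)] dist_triangle[of p x z] by (simp add: dist_commute)
      then show "x \<in> (\<Union>p\<in>F. ?A p)" using p q by auto
    qed
    have oA: "open (?A p)" for p
    proof -
      have "?A p = \<Omega> \<inter> ball p (r p) \<inter> ?S" by auto
      then show ?thesis using o open_near_complement[of \<Omega> s] by (simp only: open_Int open_ball)
    qed
    have mA: "?A p \<in> lmeasurable" for p
      by (intro lmeasurable_open oA) (auto intro: bounded_subset[OF bounded_ball[of p "r p"]])
    have oS: "open {x \<in> \<Omega>. \<exists>q. q \<notin> \<Omega> \<and> dist x q < s}"
      using o open_near_complement[of \<Omega> s] by (simp add: open_Int Collect_conj_eq)
    have "measure lebesgue {x \<in> \<Omega>. \<exists>q. q \<notin> \<Omega> \<and> dist x q < s} \<le> measure lebesgue (\<Union>p\<in>F. ?A p)"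
      using oS F(2) mA by (intro measure_mono_fmeasurable sub fmeasurable.finite_UN) auto
    also have "\<dots> \<le> (\<Sum>p\<in>F. measure lebesgue (?A p))"
      by (rule measure_UNION_le) (use F mA in auto)
    also have "\<dots> \<le> (\<Sum>p\<in>F. C p * s)"
      using F(1) E(2) s by (intro sum_mono le) (auto intro: less_le_trans)
    finally show ?thesis by (simp add: sum_distrib_right)
  qed
  moreover have "(\<Sum>p\<in>F. C p) \<ge> 0" using * F by (intro sum_nonneg) auto
  ultimately show ?thesis using E(1) that by blast
qed

section \<open>The kernel and the function h\<close>

lemma sets_borel_ball [measurable]: "ball (x::'a::metric_space) r \<in> sets borel"
  by simp

text \<open>Polar coordinates for radial functions. The law of the norm is determined by its values
  on half-lines, and these are volumes of closed balls, whose derivative in \<open>r\<close> is the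
  stated density, the area of the sphere of radius \<open>r\<close>.\<close>

lemma distr_norm_lborel:
  "distr (lborel :: 'a::euclidean_space measure) borel norm =
    density lborel (\<lambda>r. ennreal (real DIM('a) * unit_ball_vol (real DIM('a)) * r ^ (DIM('a) - 1)) * indicator {0..} r)"
    (is "?M = ?N")
proof (rule measure_eqI_generator_eq[where E="range atMost" and \<Omega>=UNIV and A="\<lambda>n. {..real n}"])
  let ?c = "unit_ball_vol (real DIM('a))"
  have M: "emeasure ?M {..r} = ennreal (if r \<ge> 0 then ?c * r ^ DIM('a) else 0)" for r
  proof -
    have "emeasure ?M {..r} = emeasure lborel (norm -` {..r} :: 'a set)"
      by (simp add: emeasure_distr)
    also have "norm -` {..r} = (cball 0 r :: 'a set)" by auto
    finally show ?thesis by (simp add: emeasure_cball)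
  qed
  have N: "emeasure ?N {..r} = ennreal (if r \<ge> 0 then ?c * r ^ DIM('a) else 0)" for r
  proof -
    have "emeasure ?N {..r} = (\<integral>\<^sup>+s. ennreal (real DIM('a) * ?c * s ^ (DIM('a) - 1)) * indicator {0..r} s \<partial>lborel)"
      by (auto simp: emeasure_density intro!: nn_integral_cong split: split_indicator)
    also have "\<dots> = ennreal (if r \<ge> 0 then ?c * r ^ DIM('a) else 0)"
    proof (cases "r \<ge> 0")
      case True
      have "(\<integral>\<^sup>+s. ennreal (real DIM('a) * ?c * s ^ (DIM('a) - 1)) * indicator {0..r} s \<partial>lborel)
         = ennreal (?c * r ^ DIM('a) - ?c * 0 ^ DIM('a))"
        by (rule nn_integral_FTC_Icc[OF _ _ _ True])
           (auto intro!: derivative_eq_intros mult_nonneg_nonneg)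
      then show ?thesis using True by simp
    qed auto
    finally show ?thesis .
  qed
  show "emeasure ?M X = emeasure ?N X" if "X \<in> range atMost" for X
    using that M N by auto
  show "emeasure ?M {..real n} \<noteq> \<infinity>" for n by (subst M) simp
  show "Int_stable (range (atMost :: real \<Rightarrow> real set))"
    by (auto simp: Int_stable_def Int_atMost)
  show "sets ?M = sigma_sets UNIV (range atMost)" "sets ?N = sigma_sets UNIV (range atMost)"
    by (simp_all add: borel_eq_atMost[where 'a=real])
  show "(\<Union>n. {..real n}) = UNIV"
    using real_arch_simple by auto
qed auto

lemma nn_integral_radial:
  assumes [measurable]: "g \<in> borel_measurable borel"
  shows "(\<integral>\<^sup>+z. g (norm z) \<partial>(lborel :: 'a::euclidean_space measure)) =
    (\<integral>\<^sup>+r. ennreal (real DIM('a) * unit_ball_vol (real DIM('a)) * r ^ (DIM('a) - 1)) * indicator {0..} r * g r \<partial>lborel)"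
proof -
  have "(\<integral>\<^sup>+z. g (norm z) \<partial>(lborel :: 'a measure)) = (\<integral>\<^sup>+r. g r \<partial>distr (lborel :: 'a measure) borel norm)"
    by (simp add: nn_integral_distr)
  then show ?thesis by (simp add: distr_norm_lborel nn_integral_density)
qed

lemma power_DIM: "(r :: real) ^ DIM('a::euclidean_space) = r * r ^ (DIM('a) - 1)"
  using DIM_positive[where 'a='a] by (metis power_eq_if not_gr_zero)

text \<open>The factor |z| lowers the singularity to |z|^(1-N), which the radial density r^(N-1)
  cancels exactly; a bounded integrand on a bounded interval is left.\<close>

lemma nn_integral_radial_lipschitz_kernel:
  "(\<integral>\<^sup>+z. ennreal (norm z / norm z ^ DIM('a)) * indicator (ball 0 D) z \<partial>(lborel :: 'a::euclidean_space measure)) < \<infinity>"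
proof -
  let ?c = "real DIM('a) * unit_ball_vol (real DIM('a))"
  have "(\<integral>\<^sup>+z. ennreal (norm z / norm z ^ DIM('a)) * indicator (ball 0 D) z \<partial>(lborel :: 'a measure))
     = (\<integral>\<^sup>+z. ennreal (norm z / norm z ^ DIM('a)) * indicator {..<D} (norm z) \<partial>(lborel :: 'a measure))"
    by (auto intro!: nn_integral_cong split: split_indicator)
  also have "\<dots> = (\<integral>\<^sup>+r. ennreal (?c * r ^ (DIM('a) - 1)) * indicator {0..} r *
      (ennreal (r / r ^ DIM('a)) * indicator {..<D} r) \<partial>lborel)"
    by (rule nn_integral_radial) measurable
  also have "\<dots> \<le> (\<integral>\<^sup>+r. ennreal ?c * indicator {0..D} r \<partial>lborel)"
  proof (rule nn_integral_mono)
    fix r :: real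
    have "?c * r ^ (DIM('a) - 1) * (r / r ^ DIM('a)) \<le> ?c" if "r \<ge> 0"
      using that by (cases "r = 0") (auto simp: power_DIM[where 'a='a])
    then show "ennreal (?c * r ^ (DIM('a) - 1)) * indicator {0..} r * (ennreal (r / r ^ DIM('a)) * indicator {..<D} r)
       \<le> ennreal ?c * indicator {0..D} r"
      by (auto split: split_indicator simp: ennreal_mult'[symmetric] ennreal_leI)
  qed
  also have "\<dots> < \<infinity>"
    by (simp add: nn_integral_cmult_indicator ennreal_mult_less_top emeasure_lborel_Icc_eq)
  finally show ?thesis .
qed

lemma nn_integral_annulus:
  assumes ab: "0 < a" "a \<le> b"
  shows "(\<integral>\<^sup>+z. ennreal (1 / norm z ^ DIM('a)) * indicator (ball 0 b - ball 0 a) z \<partial>(lborel :: 'a::euclidean_space measure))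
    = ennreal (real DIM('a) * unit_ball_vol (real DIM('a)) * ln (b / a))"
proof -
  let ?c = "real DIM('a) * unit_ball_vol (real DIM('a))"
  have "(\<integral>\<^sup>+z. ennreal (1 / norm z ^ DIM('a)) * indicator (ball 0 b - ball 0 a) z \<partial>(lborel :: 'a measure))
     = (\<integral>\<^sup>+z. ennreal (1 / norm z ^ DIM('a)) * indicator {a..<b} (norm z) \<partial>(lborel :: 'a measure))"
    by (auto intro!: nn_integral_cong split: split_indicator)
  also have "\<dots> = (\<integral>\<^sup>+r. ennreal (?c * r ^ (DIM('a) - 1)) * indicator {0..} r *
      (ennreal (1 / r ^ DIM('a)) * indicator {a..<b} r) \<partial>lborel)"
    by (rule nn_integral_radial) measurable
  also have "\<dots> = (\<integral>\<^sup>+r. ennreal (?c / r) * indicator {a..b} r \<partial>lborel)"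
  proof (rule nn_integral_cong_AE, use AE_lborel_singleton[of b] in eventually_elim)
    fix r :: real assume "r \<noteq> b"
    moreover have "?c * r ^ (DIM('a) - 1) * (1 / r ^ DIM('a)) = ?c / r" if "r > 0"
      using that by (simp add: power_DIM[where 'a='a])
    ultimately show "ennreal (?c * r ^ (DIM('a) - 1)) * indicator {0..} r * (ennreal (1 / r ^ DIM('a)) * indicator {a..<b} r)
       = ennreal (?c / r) * indicator {a..b} r"
      using ab by (auto split: split_indicator simp: ennreal_mult'[symmetric])
  qed
  also have "\<dots> = ennreal (?c * ln b - ?c * ln a)"
    by (rule nn_integral_FTC_Icc) (use ab in \<open>auto intro!: derivative_eq_intros divide_nonneg_nonneg\<close>)
  also have "?c * ln b - ?c * ln a = ?c * ln (b / a)"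
    using ab by (simp add: ln_div right_diff_distrib)
  finally show ?thesis .
qed

text \<open>The integral over the annulus from radius a to 1 grows like -ln a, so no finite value is
  possible.\<close>

lemma nn_integral_kernel_infinite:
  "(\<integral>\<^sup>+z. ennreal (1 / norm z ^ DIM('a)) * indicator (ball 0 1) z \<partial>(lborel :: 'a::euclidean_space measure)) = \<infinity>"
proof (rule ccontr)
  let ?I = "\<integral>\<^sup>+z. ennreal (1 / norm z ^ DIM('a)) * indicator (ball 0 1) z \<partial>(lborel :: 'a measure)"
  let ?c = "real DIM('a) * unit_ball_vol (real DIM('a))"
  assume "?I \<noteq> \<infinity>"
  then obtain t where t: "?I = ennreal t" "t \<ge> 0" by (cases ?I) auto
  have c: "unit_ball_vol (real DIM('a)) \<noteq> 0" by (metis less_irrefl unit_ball_vol_pos of_nat_0_le_iff)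
  \<comment> \<open>The inner radius for which the annulus contributes exactly
    \<open>t + 1\<close>.\<close>
  let ?a = "exp (- ((t + 1) / ?c))"
  have "ennreal (?c * ln (1 / ?a)) \<le> ?I"
    using t(2) by (subst nn_integral_annulus[symmetric]) (auto intro!: nn_integral_mono split: split_indicator)
  also have "?c * ln (1 / ?a) = t + 1" by (simp add: ln_div) (use c in auto)
  finally show False using t by simp
qed

text \<open>The second factor is the area of the unit sphere. This normalisation makes
  \<open>c_const\<close> times the kernel integral over an annulus equal to 2 ln(b/a).\<close>

lemma c_const_unit_ball:
  assumes "n > 0"
  shows "c_const n * (real n * unit_ball_vol (real n)) = 2"
proof -
  have G: "Gamma (real n / 2 + 1) = real n / 2 * Gamma (real n / 2)"
    using assms Gamma_plus1[of "real n / 2"] by (simp add: nonpos_Ints_def)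
  have "Gamma (real n / 2) > 0" by (rule Gamma_real_pos) (use assms in simp)
  then have "Gamma (real n / 2) \<noteq> 0" by (metis less_irrefl)
  then show ?thesis
    using assms unfolding c_const_def unit_ball_vol_def G by (simp add: powr_minus field_simps)
qed

lemma c_const_pos: "n > 0 \<Longrightarrow> c_const n > 0"
  by (simp add: c_const_def)

section \<open>Convergence of the integrals defining h and lower bounds for h\<close>

lemma integrable_kernel_away:
  fixes x :: "'a::euclidean_space"
  assumes A: "A \<in> sets borel" "bounded A" and d: "d > 0" "\<And>y. y \<in> A \<Longrightarrow> d \<le> norm (x - y)"
  shows "integrable lborel (\<lambda>y. indicator A y * (1 / norm (x - y) ^ DIM('a)))"
proof (rule integrable_abs_le[OF integrable_mult_left[OF integrable_indicator_bounded[OF A], of "1 / d ^ DIM('a)"]])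
  fix y
  have "1 / norm (x - y) ^ DIM('a) \<le> 1 / d ^ DIM('a)" if "y \<in> A"
    using d(1) d(2)[OF that]
    by (intro divide_left_mono power_mono mult_pos_pos zero_less_power) auto
  then show "\<bar>indicator A y * (1 / norm (x - y) ^ DIM('a))\<bar> \<le> indicator A y * (1 / d ^ DIM('a))"
    using d(1) by (auto split: split_indicator)
qed (use A in measurable)

lemma open_contains_ball_norm:
  fixes x :: "'a::euclidean_space"
  assumes "open \<Omega>" "x \<in> \<Omega>"
  obtains d where "d > 0" "\<And>y. y \<notin> \<Omega> \<Longrightarrow> d \<le> norm (x - y)"
proof -
  obtain d where "d > 0" "ball x d \<subseteq> \<Omega>" using assms openE by blast
  then show ?thesis using that[of d] by (force simp: dist_norm subset_iff not_less[symmetric])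
qed

text \<open>Neither integral meets the singularity: \<Omega> contains a ball around
  \<open>x\<close>, which keeps the first domain away from \<open>x\<close>, and the second domain
  lies outside the unit ball. Hence both converge and the difference may be rearranged.\<close>

lemma h_fun_lborel:
  fixes \<Omega> :: "'a::euclidean_space set"
  assumes \<Omega>: "open \<Omega>" "bounded \<Omega>" and x: "x \<in> \<Omega>"
  shows "integrable lborel (\<lambda>y. indicator (ball x 1 - \<Omega>) y * (1 / norm (x - y) ^ DIM('a)))" (is ?near)
    "integrable lborel (\<lambda>y. indicator (\<Omega> - ball x 1) y * (1 / norm (x - y) ^ DIM('a)))" (is ?far)
    "h_fun \<Omega> x = c_const DIM('a) *
       ((LBINT y. indicator (ball x 1 - \<Omega>) y * (1 / norm (x - y) ^ DIM('a))) -
        (LBINT y. indicator (\<Omega> - ball x 1) y * (1 / norm (x - y) ^ DIM('a))))" (is ?h)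
proof -
  have [measurable]: "\<Omega> \<in> sets borel" using \<Omega> by simp
  obtain d where d: "d > 0" "\<And>y. y \<notin> \<Omega> \<Longrightarrow> d \<le> norm (x - y)"
    using open_contains_ball_norm[OF \<Omega>(1) x] by blast
  show ?near
    by (rule integrable_kernel_away[OF _ _ d(1)]) (use d(2) in \<open>auto intro: bounded_subset[OF bounded_ball[of x 1]]\<close>)
  show ?far
    by (rule integrable_kernel_away[OF _ _ zero_less_one])
       (use \<Omega> in \<open>auto intro: bounded_subset simp: dist_norm\<close>)
  show ?h
    unfolding h_fun_def set_lebesgue_integral_def
    by (subst (1 2) integral_completion; (measurable | simp))
qed

lemma integral_kernel_annulus:
  fixes x :: "'a::euclidean_space"
  assumes ab: "0 < a" "a \<le> b"
  shows "(LBINT y. indicator (ball x b - ball x a) y * (1 / norm (x - y) ^ DIM('a)))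
    = real DIM('a) * unit_ball_vol (real DIM('a)) * ln (b / a)"
proof -
  have "(\<integral>\<^sup>+y. ennreal (indicator (ball x b - ball x a) y * (1 / norm (x - y) ^ DIM('a))) \<partial>lborel)
     = (\<integral>\<^sup>+y. ennreal (1 / norm (x - y) ^ DIM('a)) * indicator (ball 0 b - ball 0 a) (x - y) \<partial>lborel)"
    by (intro nn_integral_cong) (auto split: split_indicator simp: dist_norm norm_minus_commute)
  also have "\<dots> = (\<integral>\<^sup>+z. ennreal (1 / norm z ^ DIM('a)) * indicator (ball 0 b - ball 0 a) z \<partial>(lborel :: 'a measure))"
    by (rule nn_integral_lborel_reflect) measurable
  also have "\<dots> = ennreal (real DIM('a) * unit_ball_vol (real DIM('a)) * ln (b / a))"
    by (rule nn_integral_annulus[OF ab])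
  finally show ?thesis
    using ab by (subst integral_eq_nn_integral) auto
qed

text \<open>Exchanging mass between \<open>\<Omega>\<close> and the ball of the same volume centred at \<open>x\<close> can only
  decrease \<open>h\<close>, because the kernel is at least \<open>r^(-N)\<close> inside that ball and at most \<open>r^(-N)\<close> outside.\<close>

lemma h_fun_ge_ball:
  fixes \<Omega> :: "'a::euclidean_space set"
  assumes \<Omega>: "open \<Omega>" "bounded \<Omega>" and x: "x \<in> \<Omega>" and r: "r > 0"
    and vol: "measure lborel \<Omega> = unit_ball_vol (real DIM('a)) * r ^ DIM('a)"
  shows "h_fun \<Omega> x \<ge> - 2 * ln r"
proof -
  let ?k = "\<lambda>y. 1 / norm (x - y) ^ DIM('a)"
  let ?I = "\<lambda>A. \<integral>y. indicator A y * ?k y \<partial>lborel"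
  let ?c = "real DIM('a) * unit_ball_vol (real DIM('a))"
  let ?D1 = "ball x 1 - ball x r" and ?D2 = "ball x r - ball x 1"
  note h = h_fun_lborel[OF \<Omega> x]
  have i1: "integrable lborel (\<lambda>y. indicator ?D1 y * ?k y)"
    by (rule integrable_kernel_away[OF _ _ r]) (auto simp: dist_norm intro: bounded_subset[OF bounded_ball[of x 1]])
  have i2: "integrable lborel (\<lambda>y. indicator ?D2 y * ?k y)"
    by (rule integrable_kernel_away[OF _ _ zero_less_one]) (auto simp: dist_norm intro: bounded_subset[OF bounded_ball[of x r]])
  \<comment> \<open>Up to the factor c_N this is the value at \<open>x\<close> of the function h
    belonging to the ball \<open>ball x r\<close>. One of the two annuli is empty, according to
    whether \<open>r\<close> is at most 1.\<close>
  have D: "?I ?D1 - ?I ?D2 = - ?c * ln r"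
  proof (cases "r \<le> 1")
    case True
    then have "?D2 = {}" by auto
    then show ?thesis using True r integral_kernel_annulus[OF r True, of x] by (simp add: ln_div)
  next
    case False
    then have "?D1 = {}" by auto
    then show ?thesis using False integral_kernel_annulus[of 1 r x] by simp
  qed
  have i\<Omega>: "integrable lborel (indicator \<Omega> :: 'a \<Rightarrow> real)"
    using \<Omega> by (intro integrable_indicator_bounded) auto
  have iB: "integrable lborel (indicator (ball x r) :: 'a \<Rightarrow> real)"
    by (intro integrable_indicator_bounded) auto
  \<comment> \<open>The integrand on the right of the next comparison equals (1_B - 1_\<Omega>)
    \<open>?k\<close>, with B = \<open>ball x r\<close>. The comparison is thus (1_B - 1_\<Omega>)
    (\<open>?k\<close> - r^(-N)) \<ge> 0, and equality of volumes makes the constant part integrate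
    to 0. At \<open>y = x\<close>, where \<open>?k\<close> is 0 by division by zero, the indicators
    cancel.\<close>
  have "0 = (LBINT y. (indicator (ball x r) y - indicator \<Omega> y) * (1 / r ^ DIM('a)))"
    using i\<Omega> iB vol r by (simp add: content_ball)
  also have "\<dots> \<le> (LBINT y. (indicator (ball x 1 - \<Omega>) y * ?k y - indicator (\<Omega> - ball x 1) y * ?k y)
      - (indicator ?D1 y * ?k y - indicator ?D2 y * ?k y))"
  proof (rule integral_mono)
    fix y
    have "?k y \<ge> 1 / r ^ DIM('a)" if "dist x y < r" "y \<notin> \<Omega>"
      using that x r by (intro divide_left_mono power_mono mult_pos_pos zero_less_power) (auto simp: dist_norm)
    moreover have "?k y \<le> 1 / r ^ DIM('a)" if "\<not> dist x y < r"
      using that r by (intro divide_left_mono power_mono mult_pos_pos zero_less_power) (auto simp: dist_norm)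
    ultimately show "(indicator (ball x r) y - indicator \<Omega> y) * (1 / r ^ DIM('a)) \<le>
      (indicator (ball x 1 - \<Omega>) y * ?k y - indicator (\<Omega> - ball x 1) y * ?k y)
      - (indicator ?D1 y * ?k y - indicator ?D2 y * ?k y)"
      by (cases "y \<in> \<Omega>"; cases "dist x y < r"; cases "dist x y < 1") auto
  qed (use h i1 i2 i\<Omega> iB in \<open>auto intro!: Bochner_Integration.integrable_diff integrable_mult_left\<close>)
  also have "\<dots> = (?I (ball x 1 - \<Omega>) - ?I (\<Omega> - ball x 1)) - (?I ?D1 - ?I ?D2)"
    using h(1,2) i1 i2
    by (simp only: Bochner_Integration.integral_diff Bochner_Integration.integrable_diff)
  finally have "?I (ball x 1 - \<Omega>) - ?I (\<Omega> - ball x 1) \<ge> - ?c * ln r" unfolding D by linarith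
  then have "c_const DIM('a) * (- ?c * ln r) \<le> h_fun \<Omega> x"
    unfolding h(3) using c_const_pos[of "DIM('a)"] by (intro mult_left_mono) auto
  also have "c_const DIM('a) * (- ?c * ln r) = - 2 * ln r"
    using c_const_unit_ball[of "DIM('a)"] by (simp add: mult.assoc[symmetric])
  finally show ?thesis .
qed

text \<open>Reflection in the origin exchanges the two halves of the unit ball, and the hyperplane
  between them is null, so each half carries an infinite integral. Monotone convergence as
  \<open>d\<close> decreases to 0 keeps the value above \<open>M\<close> on a half space at positive
  distance from the origin; this margin is what permits moving from a boundary point into
  \<Omega>.\<close>

lemma nn_integral_half_space_kernel_large:
  fixes e :: "'a::euclidean_space"
  assumes e: "e \<noteq> 0"
  shows "\<exists>d>0. (\<integral>\<^sup>+z. ennreal (1 / norm z ^ DIM('a)) * indicator {z. norm z < 1 \<and> z \<bullet> e < - d} z \<partial>lborel) > ennreal M"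
proof (rule ccontr)
  let ?k = "\<lambda>z::'a. ennreal (1 / norm z ^ DIM('a))"
  let ?S = "\<lambda>d. {z. norm z < 1 \<and> z \<bullet> e < - d}"
  let ?J = "\<lambda>d. \<integral>\<^sup>+z. ?k z * indicator (?S d) z \<partial>lborel"
  assume "\<not> ?thesis"
  moreover have "1 / real (Suc n) > 0" for n by simp
  ultimately have le: "?J (1 / real (Suc n)) \<le> ennreal M" for n by (meson not_less)
  have "(SUP n. ?J (1 / real (Suc n))) = (\<integral>\<^sup>+z. (SUP n. ?k z * indicator (?S (1 / real (Suc n))) z) \<partial>lborel)"
  proof (rule nn_integral_monotone_convergence_SUP[symmetric])
    show "incseq (\<lambda>n z. ?k z * indicator (?S (1 / real (Suc n))) z)"
    proof (intro incseq_SucI le_funI)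
      fix n z
      have "1 / real (Suc (Suc n)) \<le> 1 / real (Suc n)" by (simp add: frac_le)
      then show "?k z * indicator (?S (1 / real (Suc n))) z
         \<le> ?k z * indicator (?S (1 / real (Suc (Suc n)))) z"
        by (auto split: split_indicator)
    qed
  qed measurable
  also have "\<dots> \<ge> (\<integral>\<^sup>+z. ?k z * indicator {z. norm z < 1 \<and> z \<bullet> e < 0} z \<partial>lborel)"
  proof (rule nn_integral_mono)
    fix z
    show "?k z * indicator {z. norm z < 1 \<and> z \<bullet> e < 0} z \<le> (SUP n. ?k z * indicator (?S (1 / real (Suc n))) z)"
    proof (cases "norm z < 1 \<and> z \<bullet> e < 0")
      case True
      then obtain n where "1 / real (Suc n) < - (z \<bullet> e)"
        using reals_Archimedean[of "- (z \<bullet> e)"] by (auto simp: inverse_eq_divide)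
      then show ?thesis using True by (intro SUP_upper2[of n]) auto
    qed auto
  qed
  finally have "(\<integral>\<^sup>+z. ?k z * indicator {z. norm z < 1 \<and> z \<bullet> e < 0} z \<partial>lborel) \<le> (SUP n. ?J (1 / real (Suc n)))" .
  also have "\<dots> \<le> ennreal M" using le by (rule SUP_least)
  finally have J0: "(\<integral>\<^sup>+z. ?k z * indicator {z. norm z < 1 \<and> z \<bullet> e < 0} z \<partial>lborel) \<le> ennreal M" .
  have J1: "(\<integral>\<^sup>+z. ?k z * indicator {z. norm z < 1 \<and> z \<bullet> e > 0} z \<partial>lborel) = (\<integral>\<^sup>+z. ?k z * indicator {z. norm z < 1 \<and> z \<bullet> e < 0} z \<partial>lborel)"
    using nn_integral_lborel_reflect[of "\<lambda>z. ?k z * indicator {z. norm z < 1 \<and> z \<bullet> e < 0} z" 0]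
    by (simp add: indicator_def)
  have ae: "AE z in lborel. z \<bullet> e \<noteq> 0"
  proof -
    have "{z. e \<bullet> z = 0} \<in> null_sets lebesgue"
      using negligible_hyperplane[of e 0] e by (simp add: negligible_iff_null_sets)
    then have "AE z in lebesgue. z \<notin> {z. e \<bullet> z = 0}" by (rule AE_not_in)
    then show ?thesis by (simp add: AE_completion_iff inner_commute)
  qed
  have "\<infinity> = (\<integral>\<^sup>+z. ?k z * indicator (ball 0 1) z \<partial>lborel)"
    by (rule nn_integral_kernel_infinite[symmetric])
  also have "\<dots> = (\<integral>\<^sup>+z. ?k z * indicator {z. norm z < 1 \<and> z \<bullet> e < 0} z + ?k z * indicator {z. norm z < 1 \<and> z \<bullet> e > 0} z \<partial>lborel)"
    using ae by (intro nn_integral_cong_AE, eventually_elim) (auto split: split_indicator)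
  also have "\<dots> \<le> ennreal M + ennreal M"
    using J0 by (subst nn_integral_add) (auto simp: J1 intro!: add_mono)
  also have "\<dots> < \<infinity>" by simp
  finally show False by simp
qed

text \<open>At a point of maximal norm the complement of \<open>\<Omega>\<close> contains a half space, so \<open>h\<close> blows up there.\<close>

lemma h_fun_large:
  fixes \<Omega> :: "'a::euclidean_space set"
  assumes \<Omega>: "open \<Omega>" "bounded \<Omega>" "\<Omega> \<noteq> {}"
  obtains G where "open G" "G \<noteq> {}" "G \<subseteq> \<Omega>" "\<And>x. x \<in> G \<Longrightarrow> h_fun \<Omega> x > M"
proof -
  let ?c = "c_const DIM('a)"
  have [measurable]: "\<Omega> \<in> sets borel" using \<Omega> by simp
  have "compact (closure \<Omega>)" using \<Omega> by (simp add: compact_closure)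
  then obtain p where p: "p \<in> closure \<Omega>" "\<And>y. y \<in> closure \<Omega> \<Longrightarrow> norm y \<le> norm p"
    using continuous_attains_sup[of "closure \<Omega>" norm] \<Omega>(3) by (auto intro: continuous_intros)
  have p0: "p \<noteq> 0"
  proof
    assume "p = 0"
    then have "\<Omega> \<subseteq> {0}" using p(2) closure_subset[of \<Omega>] by auto
    then have "\<Omega> = {0}" using \<Omega>(3) by auto
    then show False using \<Omega>(1) not_open_singleton by metis
  qed
  define e where "e = p /\<^sub>R norm p"
  have e: "norm e = 1" "p \<bullet> e = norm p" using p0 by (auto simp: e_def dot_square_norm power2_eq_square)
  have c: "?c > 0" by (simp add: c_const_pos)
  \<comment> \<open>The far part of h is at most the volume of \<Omega>, since the kernel is at most
    1 there; the near part has to exceed it by more than |M| / c_N.\<close>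
  define M' where "M' = \<bar>M\<bar> / ?c + measure lborel \<Omega>"
  have e0: "e \<noteq> 0" using e by auto
  obtain d where d: "d > 0" "(\<integral>\<^sup>+z. ennreal (1 / norm z ^ DIM('a)) * indicator {z. norm z < 1 \<and> z \<bullet> e < - d} z \<partial>lborel) > ennreal M'"
    using nn_integral_half_space_kernel_large[OF e0, of M'] by blast
  let ?G = "\<Omega> \<inter> ball p d"
  have "h_fun \<Omega> x > M" if x: "x \<in> ?G" for x
  proof -
    let ?k = "\<lambda>y. 1 / norm (x - y) ^ DIM('a)"
    have x\<Omega>: "x \<in> \<Omega>" using x by auto
    note h = h_fun_lborel[OF \<Omega>(1,2) x\<Omega>]
    \<comment> \<open>Such a \<open>y\<close> lies beyond the supporting hyperplane at
      \<open>p\<close>: its component along \<open>e\<close> exceeds that of \<open>x\<close> by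
      more than \<open>d\<close>, and \<open>x\<close> is closer than \<open>d\<close> to
      \<open>p\<close>.\<close>
    have out: "y \<notin> \<Omega>" if "(x - y) \<bullet> e < - d" for y
    proof
      assume "y \<in> \<Omega>"
      then have "norm y \<le> norm p" using p closure_subset[of \<Omega>] by auto
      then have "y \<bullet> e \<le> norm p" using norm_cauchy_schwarz[of y e] e by simp
      moreover have "(p - x) \<bullet> e \<le> norm (p - x)" using norm_cauchy_schwarz[of "p - x" e] e by simp
      moreover have "norm (p - x) < d" using x by (simp add: dist_norm)
      ultimately show False using that e by (simp add: inner_diff_left)
    qed
    have "ennreal M' < (\<integral>\<^sup>+y. ennreal (?k y) * indicator {z. norm z < 1 \<and> z \<bullet> e < - d} (x - y) \<partial>lborel)"
      using d(2) nn_integral_lborel_reflect[of "\<lambda>z. ennreal (1 / norm z ^ DIM('a)) * indicator {z. norm z < 1 \<and> z \<bullet> e < - d} z" x]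
      by simp
    also have "\<dots> \<le> (\<integral>\<^sup>+y. ennreal (indicator (ball x 1 - \<Omega>) y * ?k y) \<partial>lborel)"
      using out by (intro nn_integral_mono) (auto split: split_indicator simp: dist_norm)
    also have "\<dots> = ennreal (LBINT y. indicator (ball x 1 - \<Omega>) y * ?k y)"
      using h(1) by (subst nn_integral_eq_integral) auto
    finally have 1: "M' < (LBINT y. indicator (ball x 1 - \<Omega>) y * ?k y)"
      by (rule ennreal_less_iff[THEN iffD1, rotated]) (simp add: M'_def c less_imp_le)
    have "(LBINT y. indicator (\<Omega> - ball x 1) y * ?k y) \<le> (LBINT y. indicator \<Omega> y)"
    proof (rule integral_mono[OF h(2)])
      show "integrable lborel (indicator \<Omega> :: 'a \<Rightarrow> real)"
        using \<Omega> by (intro integrable_indicator_bounded) auto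
      fix y
      have "?k y \<le> 1" if "1 \<le> norm (x - y)"
      proof -
        have "1 \<le> norm (x - y) ^ DIM('a)" using that by (rule one_le_power)
        moreover from this have "0 < norm (x - y) ^ DIM('a)" by linarith
        ultimately show ?thesis by (simp add: divide_le_eq_1)
      qed
      then show "indicator (\<Omega> - ball x 1) y * ?k y \<le> indicator \<Omega> y"
        by (auto split: split_indicator simp: dist_norm)
    qed
    then have 2: "(LBINT y. indicator (\<Omega> - ball x 1) y * ?k y) \<le> measure lborel \<Omega>" by simp
    have "?c * (\<bar>M\<bar> / ?c) < h_fun \<Omega> x"
      unfolding h(3) using c 1 2 by (intro mult_strict_left_mono) (auto simp: M'_def)
    then show "h_fun \<Omega> x > M" using c by simp
  qed
  moreover have "open ?G" using \<Omega> by auto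
  moreover have "?G \<noteq> {}"
    using p(1) d(1) \<Omega>(1) by (metis closure_iff_nhds_not_empty centre_in_ball open_ball Int_commute order_refl)
  ultimately show ?thesis using that[of ?G] by blast
qed

section \<open>The energy measure and cutoff functions\<close>

text \<open>Putting the kernel into the measure makes \<open>energy\<close> a squared L2 norm of the
  difference function, so that general L2 results apply. Division by zero gives the density the
  value 0 on the diagonal.\<close>

definition energy_measure :: "'a::euclidean_space set \<Rightarrow> ('a \<times> 'a) measure" where
  "energy_measure \<Omega> = density lborel
     (\<lambda>p. ennreal (indicator (\<Omega> \<times> \<Omega>) p / norm (fst p - snd p) ^ DIM('a)))"

abbreviation energy :: "'a::euclidean_space set \<Rightarrow> ('a \<Rightarrow> real) \<Rightarrow> ennreal" where
  "energy \<Omega> g \<equiv> (\<integral>\<^sup>+p. ennreal ((g (fst p) - g (snd p))\<^sup>2) \<partial>energy_measure \<Omega>)"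

lemma measurable_energy_measure [simp]: "measurable (energy_measure \<Omega>) M = measurable borel M"
  by (rule measurable_cong_sets) (simp_all add: energy_measure_def)

lemma borel_measurable_pairI:
  fixes f :: "'a::euclidean_space \<times> 'b::euclidean_space \<Rightarrow> 'c::topological_space"
  assumes "f \<in> borel_measurable (borel \<Otimes>\<^sub>M borel)"
  shows "f \<in> borel_measurable borel"
  using assms by (simp add: borel_prod)

lemma borel_measurable_diff_pair:
  fixes f :: "'a::euclidean_space \<Rightarrow> real"
  assumes [measurable]: "f \<in> borel_measurable borel"
  shows "(\<lambda>p. f (fst p) - f (snd p)) \<in> borel_measurable borel"
  by (rule borel_measurable_pairI) measurable

lemma borel_measurable_kernel_density:
  fixes \<Omega> :: "'a::euclidean_space set"
  assumes [measurable]: "\<Omega> \<in> sets borel"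
  shows "(\<lambda>p. indicator (\<Omega> \<times> \<Omega>) p / norm (fst p - snd p) ^ DIM('a) :: real) \<in> borel_measurable borel"
  unfolding indicator_times by (rule borel_measurable_pairI) measurable

lemma nn_integral_energy_measure:
  fixes \<Omega> :: "'a::euclidean_space set"
  assumes "\<Omega> \<in> sets borel" "g \<in> borel_measurable borel"
  shows "(\<integral>\<^sup>+p. g p \<partial>energy_measure \<Omega>) =
    (\<integral>\<^sup>+p. ennreal (indicator (\<Omega> \<times> \<Omega>) p / norm (fst p - snd p) ^ DIM('a)) * g p \<partial>lborel)"
  unfolding energy_measure_def
  using borel_measurable_kernel_density[OF assms(1)] assms(2) by (simp add: nn_integral_density)

lemma integral_energy_measure:
  fixes \<Omega> :: "'a::euclidean_space set" and g :: "'a \<times> 'a \<Rightarrow> real"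
  assumes "\<Omega> \<in> sets borel" "g \<in> borel_measurable borel"
  shows "integrable (energy_measure \<Omega>) g \<longleftrightarrow>
      integrable lborel (\<lambda>p. indicator (\<Omega> \<times> \<Omega>) p / norm (fst p - snd p) ^ DIM('a) * g p)"
    "(\<integral>p. g p \<partial>energy_measure \<Omega>) =
      (LBINT p. indicator (\<Omega> \<times> \<Omega>) p / norm (fst p - snd p) ^ DIM('a) * g p)"
  unfolding energy_measure_def
  using borel_measurable_kernel_density[OF assms(1)] assms(2)
  by (simp_all add: integrable_density integral_density)

lemma AE_fst_snd_lborel:
  assumes "AE x in (lborel :: 'a::euclidean_space measure). P x"
  shows "AE p in (lborel :: ('a \<times> 'a) measure). P (fst p) \<and> P (snd p)"
proof -
  obtain N where N: "{x \<in> space (lborel :: 'a measure). \<not> P x} \<subseteq> N" "N \<in> null_sets (lborel :: 'a measure)"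
    using assms by (auto simp: eventually_ae_filter)
  then have [measurable]: "N \<in> sets (lborel :: 'a measure)" by auto
  have "N \<times> UNIV \<in> null_sets (lborel \<Otimes>\<^sub>M lborel :: ('a \<times> 'a) measure)"
    "UNIV \<times> N \<in> null_sets (lborel \<Otimes>\<^sub>M lborel :: ('a \<times> 'a) measure)"
    using N(2) by (auto simp: null_sets_def lborel.emeasure_pair_measure_Times)
  from AE_not_in[OF this(1)] AE_not_in[OF this(2)]
  have "AE p in (lborel :: ('a \<times> 'a) measure). p \<notin> N \<times> UNIV \<and> p \<notin> UNIV \<times> N"
    unfolding lborel_prod by eventually_elim auto
  then show ?thesis
    by eventually_elim (use N(1) in \<open>auto simp: mem_Times_iff\<close>)
qed

lemma AE_energy_measure:
  fixes \<Omega> :: "'a::euclidean_space set"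
  assumes "\<Omega> \<in> sets borel" "AE p in lborel. p \<in> \<Omega> \<times> \<Omega> \<longrightarrow> P p"
  shows "AE p in energy_measure \<Omega>. P p"
proof -
  have "AE p in lborel. 0 < ennreal (indicator (\<Omega> \<times> \<Omega>) p / norm (fst p - snd p) ^ DIM('a)) \<longrightarrow> P p"
    using assms(2) by eventually_elim (auto split: split_indicator_asm)
  then show ?thesis
    unfolding energy_measure_def
    using borel_measurable_kernel_density[OF assms(1)] by (subst AE_density) auto
qed

lemma nn_integral_pair_fst_kernel:
  fixes \<kappa> :: "'a::euclidean_space \<Rightarrow> ennreal"
  assumes [measurable]: "\<kappa> \<in> borel_measurable borel" "S \<in> sets borel"
  shows "(\<integral>\<^sup>+p. indicator S (fst p) * \<kappa> (fst p - snd p) \<partial>lborel) = emeasure lborel S * (\<integral>\<^sup>+z. \<kappa> z \<partial>lborel)" (is ?fst)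
    "(\<integral>\<^sup>+p. indicator S (snd p) * \<kappa> (fst p - snd p) \<partial>lborel) = emeasure lborel S * (\<integral>\<^sup>+z. \<kappa> z \<partial>lborel)" (is ?snd)
proof -
  have "(\<integral>\<^sup>+p. indicator S (fst p) * \<kappa> (fst p - snd p) \<partial>lborel)
      = (\<integral>\<^sup>+x. (\<integral>\<^sup>+y. indicator S x * \<kappa> (x - y) \<partial>lborel) \<partial>lborel)"
    unfolding lborel_prod[symmetric] by (subst lborel.nn_integral_fst[symmetric]; (measurable | simp))
  also have "\<dots> = (\<integral>\<^sup>+x. indicator S x * (\<integral>\<^sup>+z. \<kappa> z \<partial>lborel) \<partial>lborel)"
    by (simp add: nn_integral_cmult nn_integral_lborel_reflect[of \<kappa>])
  also have "\<dots> = emeasure lborel S * (\<integral>\<^sup>+z. \<kappa> z \<partial>lborel)"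
    by (simp add: nn_integral_multc)
  finally show ?fst .
  have "(\<integral>\<^sup>+p. indicator S (snd p) * \<kappa> (fst p - snd p) \<partial>lborel)
      = (\<integral>\<^sup>+x. (\<integral>\<^sup>+y. indicator S y * \<kappa> (x - y) \<partial>lborel) \<partial>lborel)"
    unfolding lborel_prod[symmetric] by (subst lborel.nn_integral_fst[symmetric]; (measurable | simp))
  also have "\<dots> = (\<integral>\<^sup>+y. (\<integral>\<^sup>+x. indicator S y * \<kappa> (x - y) \<partial>lborel) \<partial>lborel)"
    by (rule lborel_pair.Fubini'[symmetric]) measurable
  also have "\<dots> = (\<integral>\<^sup>+y. indicator S y * (\<integral>\<^sup>+z. \<kappa> z \<partial>lborel) \<partial>lborel)"
    by (simp add: nn_integral_cmult nn_integral_lborel_translate[of \<kappa>])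
  also have "\<dots> = emeasure lborel S * (\<integral>\<^sup>+z. \<kappa> z \<partial>lborel)"
    by (simp add: nn_integral_multc)
  finally show ?snd .
qed

text \<open>For values in [0,1] the square of a difference is at most the difference itself, hence
  at most m |x-y|. Only the first power of the slope appears, which a strip of volume O(1/m) can
  balance, and the kernel improves to the integrable |x-y|^(1-N). A pair contributes only if one of
  its points lies in \<open>S\<close>, whence the factor 2.\<close>

lemma energy_lipschitz_cutoff:
  fixes \<Omega> S :: "'a::euclidean_space set"
  assumes [measurable]: "\<Omega> \<in> sets borel" "S \<in> sets borel" "\<eta> \<in> borel_measurable borel"
    and \<eta>01: "\<And>x. 0 \<le> \<eta> x" "\<And>x. \<eta> x \<le> 1" and lip: "\<And>x y. \<bar>\<eta> x - \<eta> y\<bar> \<le> m * norm (x - y)"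
    and const: "\<And>x. x \<in> \<Omega> \<Longrightarrow> x \<notin> S \<Longrightarrow> \<eta> x = 1"
    and D: "\<And>x y. x \<in> \<Omega> \<Longrightarrow> y \<in> \<Omega> \<Longrightarrow> norm (x - y) < D" and m: "m \<ge> 0"
  shows "energy \<Omega> \<eta> \<le>
    2 * ennreal m * emeasure lborel S *
    (\<integral>\<^sup>+z. ennreal (norm z / norm z ^ DIM('a)) * indicator (ball 0 D) z \<partial>(lborel :: 'a measure))"
proof -
  define \<kappa> where "\<kappa> z = ennreal m * (ennreal (norm z / norm z ^ DIM('a)) * indicator (ball 0 D) z)" for z :: 'a
  have [measurable]: "\<kappa> \<in> borel_measurable borel" unfolding \<kappa>_def by measurable
  have "energy \<Omega> \<eta> =
     (\<integral>\<^sup>+p. ennreal (indicator (\<Omega> \<times> \<Omega>) p / norm (fst p - snd p) ^ DIM('a)) * ennreal ((\<eta> (fst p) - \<eta> (snd p))\<^sup>2) \<partial>lborel)"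
    by (intro nn_integral_energy_measure borel_measurable_pairI) measurable
  also have "\<dots> \<le> (\<integral>\<^sup>+p. indicator S (fst p) * \<kappa> (fst p - snd p) + indicator S (snd p) * \<kappa> (fst p - snd p) \<partial>lborel)"
  proof (rule nn_integral_mono)
    fix p :: "'a \<times> 'a"
    obtain x y where p: "p = (x, y)" by (cases p)
    show "ennreal (indicator (\<Omega> \<times> \<Omega>) p / norm (fst p - snd p) ^ DIM('a)) * ennreal ((\<eta> (fst p) - \<eta> (snd p))\<^sup>2)
      \<le> indicator S (fst p) * \<kappa> (fst p - snd p) + indicator S (snd p) * \<kappa> (fst p - snd p)"
    proof (cases "x \<in> \<Omega> \<and> y \<in> \<Omega> \<and> (x \<in> S \<or> y \<in> S)")
      case True
      have "\<bar>\<eta> x - \<eta> y\<bar> \<le> 1" using \<eta>01[of x] \<eta>01[of y] by auto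
      then have "(\<eta> x - \<eta> y)\<^sup>2 \<le> \<bar>\<eta> x - \<eta> y\<bar>"
        using mult_left_le[of "\<bar>\<eta> x - \<eta> y\<bar>" "\<bar>\<eta> x - \<eta> y\<bar>"] by (simp add: power2_eq_square abs_mult[symmetric])
      also have "\<dots> \<le> m * norm (x - y)" by (rule lip)
      finally have "1 / norm (x - y) ^ DIM('a) * (\<eta> x - \<eta> y)\<^sup>2 \<le> 1 / norm (x - y) ^ DIM('a) * (m * norm (x - y))"
        by (rule mult_left_mono) simp
      then have "ennreal (1 / norm (x - y) ^ DIM('a)) * ennreal ((\<eta> x - \<eta> y)\<^sup>2) \<le> ennreal (m * (norm (x - y) / norm (x - y) ^ DIM('a)))"
        by (subst ennreal_mult[symmetric]) (auto intro!: ennreal_leI simp: mult_ac)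
      also have "\<dots> = \<kappa> (x - y)"
        using D[of x y] True m by (simp add: \<kappa>_def ennreal_mult[symmetric])
      finally have "ennreal (1 / norm (x - y) ^ DIM('a)) * ennreal ((\<eta> x - \<eta> y)\<^sup>2) \<le> \<kappa> (x - y)" .
      moreover have "\<kappa> (x - y) \<le> indicator S x * \<kappa> (x - y) + indicator S y * \<kappa> (x - y)"
        using True by (auto simp: indicator_def)
      ultimately show ?thesis using True by (simp add: p indicator_times)
    next
      case False
      then show ?thesis using const[of x] const[of y] by (auto simp: p indicator_def)
    qed
  qed
  also have "\<dots> = (\<integral>\<^sup>+p. indicator S (fst p) * \<kappa> (fst p - snd p) \<partial>lborel) + (\<integral>\<^sup>+p. indicator S (snd p) * \<kappa> (fst p - snd p) \<partial>lborel)"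
    unfolding lborel_prod[symmetric] by (rule nn_integral_add) measurable
  also have "\<dots> = 2 * (emeasure lborel S * (\<integral>\<^sup>+z. \<kappa> z \<partial>lborel))"
    by (simp add: nn_integral_pair_fst_kernel mult_2)
  also have "(\<integral>\<^sup>+z. \<kappa> z \<partial>lborel) = ennreal m * (\<integral>\<^sup>+z. ennreal (norm z / norm z ^ DIM('a)) * indicator (ball 0 D) z \<partial>(lborel :: 'a measure))"
    unfolding \<kappa>_def by (rule nn_integral_cmult) measurable
  finally show ?thesis by (simp add: mult_ac)
qed

lemma lipschitz_domain_cutoffs:
  fixes \<Omega> :: "'a::euclidean_space set"
  assumes \<Omega>: "bounded_lipschitz_domain \<Omega>"
  obtains \<eta> :: "nat \<Rightarrow> 'a \<Rightarrow> real" and K C where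
    "\<And>n. \<eta> n \<in> borel_measurable borel" "\<And>n x. 0 \<le> \<eta> n x" "\<And>n x. \<eta> n x \<le> 1"
    "\<And>n. compact (K n)" "\<And>n. K n \<subseteq> \<Omega>" "\<And>n x. x \<notin> K n \<Longrightarrow> \<eta> n x = 0"
    "\<And>x. x \<in> \<Omega> \<Longrightarrow> (\<lambda>n. \<eta> n x) \<longlonglongrightarrow> 1"
    "\<And>n. energy \<Omega> (\<eta> n) \<le> ennreal C"
proof -
  have o: "open \<Omega>" and b: "bounded \<Omega>" using \<Omega> by (auto simp: bounded_lipschitz_domain_def)
  obtain C s0 where C: "C \<ge> 0" "s0 > 0"
    "\<And>s. 0 < s \<Longrightarrow> s < s0 \<Longrightarrow> measure lebesgue {x \<in> \<Omega>. \<exists>q. q \<notin> \<Omega> \<and> dist x q < s} \<le> C * s"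
    using lipschitz_domain_strip[OF \<Omega>] by blast
  \<comment> \<open>The index offset makes the strip width \<open>2 / m n\<close> admissible for
    every \<open>n\<close>, including 0.\<close>
  obtain n0 :: nat where n0: "real n0 > 2 / s0" using reals_Archimedean2 by blast
  define m where "m n = real (n + n0) + 1" for n
  have m: "m n > 0" "2 / m n < s0" for n
  proof -
    show "m n > 0" by (simp add: m_def add_nonneg_pos)
    have "m n > 2 / s0" using n0 by (simp add: m_def)
    with C(2) \<open>m n > 0\<close> show "2 / m n < s0" by (simp add: field_simps)
  qed
  \<comment> \<open>The distance to the empty set is 0 by convention, so a nonempty complement is
    required for \<open>infdist\<close> to detect interior points.\<close>
  have ne: "- \<Omega> \<noteq> {}" using b not_bounded_UNIV by (metis double_compl Compl_empty_eq)
  \<comment> \<open>Zero up to distance \<open>1 / m n\<close> from the complement, one from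
    distance \<open>2 / m n\<close> on, and linear in between; the inner margin is what gives
    compact support.\<close>
  define \<eta> where "\<eta> n x = max 0 (min 1 (m n * infdist x (- \<Omega>) - 1))" for n x
  define K where "K n = {x. 1 / m n \<le> infdist x (- \<Omega>)}" for n
  obtain R where R: "\<Omega> \<subseteq> ball 0 R" using bounded_subset_ballD[OF b, of 0] by blast
  let ?I = "\<integral>\<^sup>+z. ennreal (norm z / norm z ^ DIM('a)) * indicator (ball 0 (2 * R)) z \<partial>(lborel :: 'a measure)"
  have I: "?I < \<infinity>" by (rule nn_integral_radial_lipschitz_kernel)
  have cont: "continuous_on UNIV (\<lambda>x. infdist x (- \<Omega>))"
    by (intro continuous_intros)
  show ?thesis
  proof
    show meas: "\<eta> n \<in> borel_measurable borel" for n
      unfolding \<eta>_def by (intro borel_measurable_continuous_onI continuous_intros)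
    show r: "0 \<le> \<eta> n x" "\<eta> n x \<le> 1" for n x by (auto simp: \<eta>_def)
    show K\<Omega>: "K n \<subseteq> \<Omega>" for n
    proof
      fix x assume "x \<in> K n"
      moreover have "1 / m n > 0" using m(1)[of n] by simp
      ultimately have "infdist x (- \<Omega>) \<noteq> 0" unfolding K_def by auto
      then show "x \<in> \<Omega>" by (metis ComplI infdist_zero)
    qed
    have "closed (K n)" for n
      unfolding K_def by (intro closed_Collect_le continuous_intros)
    then show "compact (K n)" for n
      using K\<Omega>[of n] b bounded_subset by (auto simp: compact_eq_bounded_closed)
    show "\<eta> n x = 0" if "x \<notin> K n" for n x
      using that m(1)[of n] by (auto simp: \<eta>_def K_def not_le field_simps)
    show "(\<lambda>n. \<eta> n x) \<longlonglongrightarrow> 1" if x: "x \<in> \<Omega>" for x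
    proof -
      have pos: "infdist x (- \<Omega>) > 0"
        using x o ne in_closed_iff_infdist_zero[of "- \<Omega>" x] infdist_nonneg[of x "- \<Omega>"] by (auto simp: less_le)
      obtain k :: nat where k: "real k > 2 / infdist x (- \<Omega>)" using reals_Archimedean2 by blast
      have "\<eta> n x = 1" if "n \<ge> k" for n
      proof -
        have "2 / infdist x (- \<Omega>) < m n" using k that by (simp add: m_def)
        then have "2 < m n * infdist x (- \<Omega>)" using pos by (simp add: field_simps)
        then show ?thesis by (simp add: \<eta>_def)
      qed
      then show ?thesis by (intro tendsto_eventually) (auto simp: eventually_sequentially)
    qed
    \<comment> \<open>The factor \<open>2 * m n\<close> of the cutoff estimate meets the strip
      volume \<open>2 * C / m n\<close>, so the dependence on \<open>n\<close> cancels.\<close>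
    show "energy \<Omega> (\<eta> n) \<le> ennreal (4 * C * enn2real ?I)" for n
    proof -
      define S where "S = {x \<in> \<Omega>. \<exists>q. q \<notin> \<Omega> \<and> dist x q < 2 / m n}"
      have "S = \<Omega> \<inter> {x. \<exists>q. q \<notin> \<Omega> \<and> dist x q < 2 / m n}" by (auto simp: S_def)
      then have oS: "open S" using o open_near_complement[of \<Omega> "2 / m n"] by (simp only: open_Int)
      have bS: "bounded S" using b by (rule bounded_subset) (auto simp: S_def)
      have "measure lebesgue S \<le> C * (2 / m n)" unfolding S_def by (rule C(3)) (use m in auto)
      moreover have "measure lebesgue S = measure lborel S" using oS by (intro measure_completion) auto
      ultimately have S: "emeasure lborel S \<le> ennreal (2 * C / m n)"
        using emeasure_bounded_finite[OF bS] by (subst emeasure_eq_ennreal_measure) (auto intro!: ennreal_leI simp: mult.commute)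
      have "energy \<Omega> (\<eta> n) \<le> 2 * ennreal (m n) * emeasure lborel S * ?I"
      proof (rule energy_lipschitz_cutoff)
        show "\<bar>\<eta> n x - \<eta> n y\<bar> \<le> m n * norm (x - y)" for x y
        proof -
          have "\<bar>\<eta> n x - \<eta> n y\<bar> \<le> \<bar>m n * infdist x (- \<Omega>) - m n * infdist y (- \<Omega>)\<bar>"
            by (auto simp: \<eta>_def max_def min_def)
          also have "\<dots> = m n * \<bar>infdist x (- \<Omega>) - infdist y (- \<Omega>)\<bar>"
            using m(1)[of n] by (simp add: abs_mult right_diff_distrib[symmetric])
          also have "\<bar>infdist x (- \<Omega>) - infdist y (- \<Omega>)\<bar> \<le> norm (x - y)"
            using infdist_triangle[of x "- \<Omega>" y] infdist_triangle[of y "- \<Omega>" x] by (simp add: dist_norm norm_minus_commute abs_le_iff)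
          finally show ?thesis using m(1)[of n] by simp
        qed
        show "\<eta> n x = 1" if "x \<in> \<Omega>" "x \<notin> S" for x
        proof -
          have "2 / m n \<le> infdist x (- \<Omega>)"
            unfolding infdist_notempty[OF ne] using that by (intro cINF_greatest[OF ne]) (auto simp: S_def not_less)
          then show ?thesis using m(1)[of n] by (simp add: \<eta>_def field_simps)
        qed
        show "norm (x - y) < 2 * R" if "x \<in> \<Omega>" "y \<in> \<Omega>" for x y
          using norm_triangle_ineq4[of x y] subsetD[OF R that(1)] subsetD[OF R that(2)] by simp
      qed (use o oS m(1)[of n] meas r in \<open>auto intro: less_imp_le\<close>)
      also have "\<dots> \<le> 2 * ennreal (m n) * ennreal (2 * C / m n) * ?I"
        by (intro mult_right_mono mult_left_mono S) auto
      also have "\<dots> = ennreal (4 * C) * ?I"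
        using m(1)[of n] C(1) by (simp add: ennreal_mult[symmetric] flip: ennreal_numeral)
      also have "?I = ennreal (enn2real ?I)" using I by simp
      finally show ?thesis using C(1) by (simp add: ennreal_mult)
    qed
  qed
qed

section \<open>Comparison of the form with the energy on the domain\<close>

lemma integrable_pair_mult:
  fixes f g :: "'a::euclidean_space \<Rightarrow> real"
  assumes f: "integrable lborel f" and g: "integrable lborel g"
  shows "integrable lborel (\<lambda>p. f (fst p) * g (snd p))"
proof -
  have [measurable]: "f \<in> borel_measurable lborel" "g \<in> borel_measurable lborel" using f g by auto
  have m: "(\<lambda>p. ennreal (norm (f (fst p) * g (snd p)))) \<in> borel_measurable (lborel \<Otimes>\<^sub>M lborel)"
    by measurable
  have "(\<integral>\<^sup>+p. ennreal (norm (f (fst p) * g (snd p))) \<partial>(lborel \<Otimes>\<^sub>M lborel))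
     = (\<integral>\<^sup>+x. (\<integral>\<^sup>+y. ennreal \<bar>f x\<bar> * ennreal \<bar>g y\<bar> \<partial>lborel) \<partial>lborel)"
    unfolding lborel.nn_integral_fst[OF m, symmetric] by (simp add: abs_mult ennreal_mult)
  also have "\<dots> = (\<integral>\<^sup>+x. ennreal \<bar>f x\<bar> \<partial>lborel) * (\<integral>\<^sup>+y. ennreal \<bar>g y\<bar> \<partial>lborel)"
    by (simp add: nn_integral_cmult nn_integral_multc)
  also have "\<dots> < \<infinity>"
    using f g by (simp add: ennreal_mult_less_top integrable_iff_bounded)
  finally have "integrable (lborel \<Otimes>\<^sub>M lborel) (\<lambda>p. f (fst p) * g (snd p))"
    by (intro integrableI_bounded) measurable
  then show ?thesis by (simp add: lborel_prod)
qed

text \<open>With r = 1 this reconciles the conventions: both double integrals of \<open>E_L\<close>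
  include the pairs at distance 1, while h is defined with open balls. Spheres are null
  sets.\<close>

lemma AE_pair_norm_diff_neq:
  "AE p in (lborel :: ('a::euclidean_space \<times> 'a) measure). norm (fst p - snd p) \<noteq> r"
proof -
  have "AE p in (lborel \<Otimes>\<^sub>M lborel :: ('a \<times> 'a) measure). norm (fst p - snd p) \<noteq> r"
  proof (rule lborel_pair.AE_pair_measure)
    show "{p \<in> space (lborel \<Otimes>\<^sub>M lborel). norm (fst p - snd p) \<noteq> r} \<in> sets (lborel \<Otimes>\<^sub>M lborel :: ('a \<times> 'a) measure)"
      by (rule borel_measurable_neq) measurable
    have "AE y in lborel. norm (x - y) \<noteq> r" for x :: 'a
    proof -
      have "sphere x r \<in> null_sets lebesgue"
        using negligible_sphere[of x r] by (simp add: negligible_iff_null_sets)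
      then have "AE y in lebesgue. y \<notin> sphere x r" by (rule AE_not_in)
      then show ?thesis by (simp add: AE_completion_iff dist_norm)
    qed
    then show "AE x in lborel. AE y in lborel. norm (fst (x, y) - snd (x :: 'a, y)) \<noteq> r" by simp
  qed
  then show ?thesis unfolding lborel_prod .
qed

lemma integral_pair_swap:
  fixes f :: "'a::euclidean_space \<times> 'a \<Rightarrow> real"
  assumes "f \<in> borel_measurable borel"
  shows "(LBINT p. f (snd p, fst p)) = (LBINT p. f p)"
  using lborel_pair.integral_product_swap[of f] assms
  by (simp add: lborel_prod case_prod_beta')

lemma integrable_pair_swap:
  fixes f :: "'a::euclidean_space \<times> 'a \<Rightarrow> real"
  assumes "integrable lborel f"
  shows "integrable lborel (\<lambda>p. f (snd p, fst p))"
  using lborel_pair.integrable_product_swap[of f] assms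
  by (simp add: lborel_prod case_prod_beta')

text \<open>Measurability of \<open>f\<close> is not assumed but follows from completeness of the
  measure. This is the passage from the completed integrals of the definitions to Borel
  representatives, where product measures and Fubini are available.\<close>

lemma lebesgue_AE_eq_borel:
  fixes f g :: "'a::euclidean_space \<Rightarrow> real"
  assumes g: "g \<in> borel_measurable borel" and ae: "AE x in lborel. f x = g x"
  shows "integral\<^sup>L lebesgue f = integral\<^sup>L lborel g" "integrable lebesgue f \<longleftrightarrow> integrable lborel g"
proof -
  have gl: "g \<in> borel_measurable lebesgue" using g by (intro measurable_completion) simp
  have ae': "AE x in lebesgue. g x = f x" using ae by (simp add: AE_completion_iff eq_commute)
  have fl: "f \<in> borel_measurable lebesgue" by (rule borel_measurable_AE[OF gl ae'])
  have "integral\<^sup>L lebesgue g = integral\<^sup>L lebesgue f" by (rule integral_cong_AE[OF gl fl ae'])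
  then show "integral\<^sup>L lebesgue f = integral\<^sup>L lborel g" using g by (simp add: integral_completion)
  have "integrable lebesgue g \<longleftrightarrow> integrable lebesgue f" by (rule integrable_cong_AE[OF gl fl ae'])
  then show "integrable lebesgue f \<longleftrightarrow> integrable lborel g" using g by (simp add: integrable_completion)
qed

text \<open>Changing \<open>u\<close> on a null set changes the double integrands only at pairs with
  a coordinate in that set, and these form a null set of the product.\<close>

lemma E_L_lborel:
  fixes u v w :: "'a::euclidean_space \<Rightarrow> real"
  assumes [measurable]: "v \<in> borel_measurable borel" "w \<in> borel_measurable borel"
    and ae: "AE x in lborel. u x = v x"
  shows "E_L u w =
    c_const DIM('a) / 2 * (LBINT p. (if norm (fst p - snd p) \<le> 1 then
        (v (fst p) - v (snd p)) * (w (fst p) - w (snd p)) / norm (fst p - snd p) ^ DIM('a) else 0))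
    - c_const DIM('a) * (LBINT p. (if 1 \<le> norm (fst p - snd p) then
        v (fst p) * w (snd p) / norm (fst p - snd p) ^ DIM('a) else 0))
    + rho_const DIM('a) * (LBINT x. v x * w x)"
proof -
  have p: "AE p in (lborel :: ('a \<times> 'a) measure). u (fst p) = v (fst p) \<and> u (snd p) = v (snd p)"
    by (rule AE_fst_snd_lborel[OF ae])
  show ?thesis
    unfolding E_L_def set_lebesgue_integral_def
    apply (intro arg_cong2[where f="(+)"] arg_cong2[where f="(-)"] arg_cong2[where f="(*)"] refl lebesgue_AE_eq_borel(1))
         apply (rule borel_measurable_pairI, measurable)
        using p apply eventually_elim apply (auto simp: indicator_def)[1]
       apply (rule borel_measurable_pairI, measurable)
      using p apply eventually_elim apply (auto simp: indicator_def)[1]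
     apply measurable
    using ae apply eventually_elim apply simp
    done
qed

lemma E_L_cong_AE:
  fixes u v w :: "'a::euclidean_space \<Rightarrow> real"
  assumes "v \<in> borel_measurable borel" "w \<in> borel_measurable borel" "AE x in lborel. u x = v x"
  shows "E_L u w = E_L v w"
  by (simp only: E_L_lborel[OF assms] E_L_lborel[OF assms(1,2) AE_I2[OF refl]])

text \<open>The signed kernel (1_{|x-y|<1} - 1_\<Omega>(y)) |x-y|^(-N), whose integral in y is h(x)
  / c_N for x in \<Omega>.\<close>

definition h_kernel :: "'a::euclidean_space set \<Rightarrow> 'a \<times> 'a \<Rightarrow> real" where
  "h_kernel \<Omega> p = (if norm (fst p - snd p) < 1 then (if snd p \<in> \<Omega> then 0 else 1)
     else (if snd p \<in> \<Omega> then -1 else 0)) / norm (fst p - snd p) ^ DIM('a)"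

lemma borel_measurable_h_kernel:
  assumes [measurable]: "\<Omega> \<in> sets borel"
  shows "h_kernel \<Omega> \<in> borel_measurable (borel \<Otimes>\<^sub>M borel)"
  unfolding h_kernel_def[abs_def] by measurable

lemma h_fun_kernel:
  fixes \<Omega> :: "'a::euclidean_space set"
  assumes \<Omega>: "open \<Omega>" "bounded \<Omega>" and x: "x \<in> \<Omega>"
  shows "integrable lborel (\<lambda>y. h_kernel \<Omega> (x, y))" (is ?int)
    "h_fun \<Omega> x = c_const DIM('a) * (LBINT y. h_kernel \<Omega> (x, y))" (is ?h)
proof -
  have eq: "h_kernel \<Omega> (x, y) = indicator (ball x 1 - \<Omega>) y * (1 / norm (x - y) ^ DIM('a)) -
      indicator (\<Omega> - ball x 1) y * (1 / norm (x - y) ^ DIM('a))" for y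
    by (auto simp: h_kernel_def indicator_def dist_norm)
  show ?int
    unfolding eq by (intro Bochner_Integration.integrable_diff h_fun_lborel[OF \<Omega> x])
  show ?h
    unfolding eq h_fun_lborel(3)[OF \<Omega> x]
    by (simp only: Bochner_Integration.integral_diff[OF h_fun_lborel(1,2)[OF \<Omega> x]])
qed

text \<open>Capping the distance at 1 makes the same \<open>d\<close> a lower bound on both parts of
  the support of \<open>h_kernel\<close>: points outside \<Omega>, and points at distance at least
  1.\<close>

lemma compact_distance_complement:
  fixes \<Omega> :: "'a::euclidean_space set"
  assumes "open \<Omega>" "compact K" "K \<subseteq> \<Omega>"
  obtains d where "0 < d" "d \<le> 1" "\<And>x y. x \<in> K \<Longrightarrow> y \<notin> \<Omega> \<Longrightarrow> d \<le> norm (x - y)"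
proof -
  obtain d where "0 < d" "\<forall>x\<in>K. \<forall>y\<in>-\<Omega>. d \<le> dist x y"
    using separate_compact_closed[of K "- \<Omega>"] assms by auto
  then show ?thesis using that[of "min d 1"] by (auto simp: dist_norm min_le_iff_disj)
qed

lemma h_fun_bounded_on_compact:
  fixes \<Omega> :: "'a::euclidean_space set"
  assumes \<Omega>: "open \<Omega>" "bounded \<Omega>" and K: "compact K" "K \<subseteq> \<Omega>"
  obtains M where "M \<ge> 0" "\<And>x. x \<in> K \<Longrightarrow> \<bar>h_fun \<Omega> x\<bar> \<le> M"
proof -
  have [measurable]: "\<Omega> \<in> sets borel" using \<Omega> by simp
  obtain d where d: "0 < d" "d \<le> 1" "\<And>x y. x \<in> K \<Longrightarrow> y \<notin> \<Omega> \<Longrightarrow> d \<le> norm (x - y)"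
    using compact_distance_complement[OF \<Omega>(1) K] by blast
  obtain R where R: "\<Omega> \<subseteq> ball 0 R" using bounded_subset_ballD[OF \<Omega>(2), of 0] by blast
  \<comment> \<open>Enlarged by 1, the ball contains the unit ball around each point of \<Omega> as
    well as \<Omega> itself.\<close>
  let ?B = "ball (0::'a) (R + 1)"
  have iB: "integrable lborel (\<lambda>y. indicator ?B y * (1 / d ^ DIM('a)))"
    by (intro integrable_mult_left integrable_indicator_bounded) auto
  have "\<bar>h_fun \<Omega> x\<bar> \<le> c_const DIM('a) * (LBINT y. indicator ?B y * (1 / d ^ DIM('a)))" if x: "x \<in> K" for x
  proof -
    have x\<Omega>: "x \<in> \<Omega>" using x K by auto
    have le: "\<bar>h_kernel \<Omega> (x, y)\<bar> \<le> indicator ?B y * (1 / d ^ DIM('a))" for y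
    proof (cases "h_kernel \<Omega> (x, y) = 0")
      case False
      then have *: "norm (x - y) < 1 \<and> y \<notin> \<Omega> \<or> norm (x - y) \<ge> 1 \<and> y \<in> \<Omega>"
        by (auto simp: h_kernel_def split: if_splits)
      then have dn: "d \<le> norm (x - y)" using d x by auto
      have "norm y \<le> norm x + norm (x - y)" using norm_triangle_ineq4[of x "x - y"] by simp
      then have "y \<in> ?B" using * subsetD[OF R, of x] subsetD[OF R, of y] x\<Omega> by auto
      moreover have "\<bar>h_kernel \<Omega> (x, y)\<bar> = 1 / norm (x - y) ^ DIM('a)"
        using * by (auto simp: h_kernel_def)
      moreover have "1 / norm (x - y) ^ DIM('a) \<le> 1 / d ^ DIM('a)"
        using d(1) dn by (intro divide_left_mono power_mono mult_pos_pos zero_less_power) auto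
      ultimately show ?thesis by simp
    qed (use d(1) in simp)
    have "\<bar>\<integral>y. h_kernel \<Omega> (x, y) \<partial>lborel\<bar> \<le> (LBINT y. indicator ?B y * (1 / d ^ DIM('a)))"
      by (rule integral_abs_bound_integral[OF h_fun_kernel(1)[OF \<Omega> x\<Omega>] iB le])
    then show ?thesis
      unfolding h_fun_kernel(2)[OF \<Omega> x\<Omega>] abs_mult abs_of_pos[OF c_const_pos[OF DIM_positive]]
      by (rule mult_left_mono) (simp add: c_const_pos less_imp_le)
  qed
  moreover have "0 \<le> c_const DIM('a) * (LBINT y. indicator ?B y * (1 / d ^ DIM('a)))"
    using d(1) by (intro mult_nonneg_nonneg Bochner_Integration.integral_nonneg) (auto simp: c_const_pos less_imp_le)
  ultimately show ?thesis using that by blast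
qed

text \<open>The pointwise inequality behind \<open>E_L_le_energy\<close>. Its left-hand side is the symmetrised integrand
  of \<open>E_L u \<phi>\<close>; the terms dropped on the right are the products of \<open>\<phi>\<close> with \<open>u \<ge> 0\<close> outside \<open>\<Omega>\<close>.\<close>

lemma E_L_integrand_le:
  fixes ux uy \<phi>x \<phi>y k n :: real
  assumes "k \<ge> 0" "\<phi>x \<ge> 0" "\<phi>y \<ge> 0" "n \<noteq> 1"
    "\<not> X \<Longrightarrow> \<phi>x = 0 \<and> ux \<ge> 0" "\<not> Y \<Longrightarrow> \<phi>y = 0 \<and> uy \<ge> 0"
  shows "(if n \<le> 1 then (ux - uy) * (\<phi>x - \<phi>y) * k else 0) - (if 1 \<le> n then ux * \<phi>y * k else 0)
      - (if 1 \<le> n then uy * \<phi>x * k else 0)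
    \<le> (if X \<and> Y then (ux - uy) * (\<phi>x - \<phi>y) * k else 0)
      + ux * \<phi>x * ((if n < 1 then (if Y then 0 else 1) else (if Y then -1 else 0)) * k)
      + uy * \<phi>y * ((if n < 1 then (if X then 0 else 1) else (if X then -1 else 0)) * k)"
proof (cases "X \<and> Y")
  case True
  then show ?thesis using assms(4) by (auto simp: algebra_simps)
next
  case False
  have "ux * \<phi>y * k \<ge> 0" if "\<not> X" using that assms by simp
  moreover have "uy * \<phi>x * k \<ge> 0" if "\<not> Y" using that assms by simp
  ultimately show ?thesis using False assms(4-6) by (auto simp: algebra_simps)
qed

context
  fixes \<Omega> K :: "'a::euclidean_space set" and u \<phi> :: "'a \<Rightarrow> real"
  assumes \<Omega>: "open \<Omega>" "bounded \<Omega>"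
    and u [measurable]: "u \<in> borel_measurable borel"
    and u1: "integrable lborel (\<lambda>x. \<bar>u x\<bar> / (1 + norm x) ^ DIM('a))"
    and u_nonneg: "\<And>x. x \<notin> \<Omega> \<Longrightarrow> u x \<ge> 0"
    and u_energy: "integrable (energy_measure \<Omega>) (\<lambda>p. (u (fst p) - u (snd p))\<^sup>2)"
    and \<phi> [measurable]: "\<phi> \<in> borel_measurable borel"
    and \<phi>01: "\<And>x. 0 \<le> \<phi> x" "\<And>x. \<phi> x \<le> 1"
    and K: "compact K" "K \<subseteq> \<Omega>" "\<And>x. x \<notin> K \<Longrightarrow> \<phi> x = 0"
    and \<phi>_energy: "integrable (energy_measure \<Omega>) (\<lambda>p. (\<phi> (fst p) - \<phi> (snd p))\<^sup>2)"
begin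

lemma integrable_u_ball: "integrable lborel (\<lambda>x. indicator (ball 0 R) x * \<bar>u x\<bar>)"
proof (rule integrable_abs_le[OF integrable_mult_left[OF u1, of "\<bar>1 + R\<bar> ^ DIM('a)"]])
  fix x :: 'a
  show "\<bar>indicator (ball 0 R) x * \<bar>u x\<bar>\<bar> \<le> \<bar>u x\<bar> / (1 + norm x) ^ DIM('a) * \<bar>1 + R\<bar> ^ DIM('a)"
  proof (cases "norm x < R")
    case True
    then have "(1 + norm x) ^ DIM('a) \<le> \<bar>1 + R\<bar> ^ DIM('a)" by (intro power_mono) auto
    moreover have "(1 + norm x) ^ DIM('a) > 0" by (intro zero_less_power add_pos_nonneg) auto
    ultimately have "1 \<le> \<bar>1 + R\<bar> ^ DIM('a) / (1 + norm x) ^ DIM('a)" by simp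
    from mult_left_mono[OF this, of "\<bar>u x\<bar>"] show ?thesis using True by simp
  qed auto
qed auto

text \<open>For two points of \<Omega> at distance above 1, -u(x)\<phi>(y) - u(y)\<phi>(x) equals
  (u(x)-u(y))(\<phi>(x)-\<phi>(y)) - u(x)\<phi>(x) - u(y)\<phi>(y): the far interaction completes
  the energy and leaves the negative part of h. For x in \<Omega>, y outside and distance below 1,
  (u(x)-u(y))\<phi>(x) leaves the positive part of h after -u(y)\<phi>(x) \<le> 0 has been dropped.
  Splitting the integrals requires every piece to converge absolutely, which takes up most of the
  proof.\<close>

lemma E_L_le_energy:
  "integrable lborel (\<lambda>x. (h_fun \<Omega> x + rho_const DIM('a)) * (u x * \<phi> x))" (is ?int)
  "E_L u \<phi> \<le> c_const DIM('a) / 2 * (\<integral>p. (u (fst p) - u (snd p)) * (\<phi> (fst p) - \<phi> (snd p)) \<partial>energy_measure \<Omega>)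
     + (LBINT x. (h_fun \<Omega> x + rho_const DIM('a)) * (u x * \<phi> x))" (is ?le)
proof -
  let ?N = "DIM('a)"
  have [measurable]: "\<Omega> \<in> sets borel" "K \<in> sets borel" using \<Omega> K by (auto simp: borel_compact)
  obtain d where d: "0 < d" "d \<le> 1" "\<And>x y. x \<in> K \<Longrightarrow> y \<notin> \<Omega> \<Longrightarrow> d \<le> norm (x - y)"
    using compact_distance_complement[OF \<Omega>(1) K(1,2)] by blast
  obtain R where R: "\<Omega> \<subseteq> ball 0 R" using bounded_subset_ballD[OF \<Omega>(2), of 0] by blast
  let ?B = "ball (0::'a) (R + 1)"
  let ?n = "\<lambda>p. norm (fst p - snd p :: 'a)"
  let ?k = "\<lambda>p. 1 / ?n p ^ ?N"
  have kd: "\<bar>?k p\<bar> \<le> 1 / d ^ ?N" if "d \<le> ?n p" for p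
    using that d(1) by (auto intro!: divide_left_mono power_mono mult_pos_pos zero_less_power)
  have \<phi>\<Omega>: "\<phi> x = 0" if "x \<notin> \<Omega>" for x using that K by auto
  \<comment> \<open>\<open>a\<close> and \<open>b\<close> are the near and far integrands of the
    form, \<open>q\<close> is the energy integrand on \<Omega> x \<Omega>, and \<open>s\<close>
    integrates in its second variable to u \<phi> h / c_N.\<close>
  define a where "a p = (if ?n p \<le> 1 then (u (fst p) - u (snd p)) * (\<phi> (fst p) - \<phi> (snd p)) / ?n p ^ ?N else 0)" for p
  define b where "b p = (if 1 \<le> ?n p then u (fst p) * \<phi> (snd p) / ?n p ^ ?N else 0)" for p
  define q where "q p = indicator (\<Omega> \<times> \<Omega>) p / ?n p ^ ?N * ((u (fst p) - u (snd p)) * (\<phi> (fst p) - \<phi> (snd p)))" for p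
  define s where "s p = u (fst p) * \<phi> (fst p) * h_kernel \<Omega> p" for p
  have hk [measurable]: "h_kernel \<Omega> \<in> borel_measurable (borel \<Otimes>\<^sub>M borel)"
    by (rule borel_measurable_h_kernel) measurable
  have ma: "a \<in> borel_measurable borel" unfolding a_def[abs_def] by (rule borel_measurable_pairI) measurable
  have mb: "b \<in> borel_measurable borel" unfolding b_def[abs_def] by (rule borel_measurable_pairI) measurable
  have ms: "s \<in> borel_measurable borel" unfolding s_def[abs_def] by (rule borel_measurable_pairI) measurable
  have mq: "(\<lambda>p. (u (fst p) - u (snd p)) * (\<phi> (fst p) - \<phi> (snd p))) \<in> borel_measurable borel"
    by (rule borel_measurable_pairI) measurable
  have "integrable (energy_measure \<Omega>) (\<lambda>p. (u (fst p) - u (snd p)) * (\<phi> (fst p) - \<phi> (snd p)))"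
    by (rule integrable_mult_L2[OF _ _ u_energy \<phi>_energy]) (simp_all add: borel_measurable_diff_pair)
  then have iq: "integrable lborel q"
    unfolding q_def using integral_energy_measure(1)[OF _ mq, of \<Omega>] by simp
  have Iq: "(LBINT p. q p) = (\<integral>p. (u (fst p) - u (snd p)) * (\<phi> (fst p) - \<phi> (snd p)) \<partial>energy_measure \<Omega>)"
    unfolding q_def using integral_energy_measure(2)[OF _ mq, of \<Omega>] by simp
  have iB: "integrable lborel (indicator ?B :: 'a \<Rightarrow> real)"
    by (intro integrable_indicator_bounded) auto
  have iK: "integrable lborel (indicator K :: 'a \<Rightarrow> real)"
    using compact_imp_bounded[OF K(1)] by (intro integrable_indicator_bounded) auto
  let ?w = "\<lambda>p. (indicator ?B (fst p) * \<bar>u (fst p)\<bar>) * indicator ?B (snd p) :: real"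
  have iw: "integrable lborel ?w" by (rule integrable_pair_mult[OF integrable_u_ball iB])
  have iw': "integrable lborel (\<lambda>p. ?w (snd p, fst p))" by (rule integrable_pair_swap[OF iw])
  have near: "y \<in> ?B" if "x \<in> \<Omega>" "norm (x - y) \<le> 1 \<or> y \<in> \<Omega>" for x y
  proof -
    have "norm y \<le> norm x + norm (x - y)" using norm_triangle_ineq4[of x "x - y"] by simp
    then show ?thesis using that subsetD[OF R, of x] subsetD[OF R, of y] by auto
  qed
  have \<Omega>B: "y \<in> ?B" if "y \<in> \<Omega>" for y using near[OF that] that by blast
  \<comment> \<open>On the support of \<open>s\<close> the first point lies in \<open>K\<close> and
    the two points are at distance at least \<open>d\<close>, so the kernel is bounded and both
    points stay in \<open>?B\<close>.\<close>
  have ints: "integrable lborel s"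
  proof (rule integrable_abs_le[OF integrable_mult_right[OF iw, of "1 / d ^ ?N"]])
    show "\<bar>s p\<bar> \<le> 1 / d ^ ?N * ?w p" for p
    proof (cases "s p = 0")
      case False
      obtain x y where p: "p = (x, y)" by (cases p)
      from False have nz: "\<phi> x \<noteq> 0" "h_kernel \<Omega> p \<noteq> 0" by (auto simp: s_def p)
      then have xK: "x \<in> K" and *: "norm (x - y) < 1 \<and> y \<notin> \<Omega> \<or> norm (x - y) \<ge> 1 \<and> y \<in> \<Omega>"
        using K(3) by (auto simp: h_kernel_def p split: if_splits)
      have dn: "d \<le> norm (x - y)" using * d xK by auto
      have x\<Omega>: "x \<in> \<Omega>" using xK K by auto
      have B: "x \<in> ?B" "y \<in> ?B" using \<Omega>B[OF x\<Omega>] near[OF x\<Omega>, of y] * by auto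
      have "\<bar>h_kernel \<Omega> p\<bar> = ?k p" using * by (auto simp: h_kernel_def p)
      then have "\<bar>h_kernel \<Omega> p\<bar> \<le> 1 / d ^ ?N" using kd[of p] dn by (simp add: p)
      then have "\<bar>u x\<bar> * \<phi> x * \<bar>h_kernel \<Omega> p\<bar> \<le> \<bar>u x\<bar> * 1 * (1 / d ^ ?N)"
        using \<phi>01 by (intro mult_mono) auto
      then show ?thesis using B \<phi>01 by (simp add: s_def p abs_mult mult_ac)
    qed (use d(1) in simp)
  qed (use ms in simp)
  have ia: "integrable lborel a"
  proof (rule integrable_abs_le[OF Bochner_Integration.integrable_add[OF integrable_abs[OF iq]
        integrable_mult_right[OF Bochner_Integration.integrable_add[OF iw iw'], of "1 / d ^ ?N"]]])
    show "\<bar>a p\<bar> \<le> \<bar>q p\<bar> + 1 / d ^ ?N * (?w p + ?w (snd p, fst p))" for p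
    proof -
      obtain x y where p: "p = (x, y)" by (cases p)
      have w0: "1 / d ^ ?N * (?w p + ?w (snd p, fst p)) \<ge> 0" using d(1) by simp
      \<comment> \<open>If \<open>a p\<close> is nonzero, one point lies in \<open>K\<close>. Either
        the other one lies in \<Omega> and \<open>q\<close> takes over, or it lies outside and the
        distance is at least \<open>d\<close>.\<close>
      consider "a p = 0" | "x \<in> \<Omega>" "y \<in> \<Omega>" | "a p \<noteq> 0" "x \<in> K" "y \<notin> \<Omega>" | "a p \<noteq> 0" "x \<notin> \<Omega>" "y \<in> K"
      proof -
        have "a p = 0" if "x \<notin> K" "y \<notin> K" using that K(3) by (simp add: a_def p)
        then show ?thesis using K(2) that by blast
      qed
      then show ?thesis
      proof cases
        case 1
        then show ?thesis using w0 by simp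
      next
        case 2
        then have "\<bar>a p\<bar> \<le> \<bar>q p\<bar>" by (auto simp: a_def q_def p)
        then show ?thesis using w0 by linarith
      next
        case 3
        then have n1: "norm (x - y) \<le> 1" by (auto simp: a_def p split: if_splits)
        have x\<Omega>: "x \<in> \<Omega>" using 3 K by auto
        have B: "x \<in> ?B" "y \<in> ?B" using \<Omega>B[OF x\<Omega>] near[OF x\<Omega>, of y] n1 by auto
        have "\<bar>a p\<bar> = \<bar>u x - u y\<bar> * \<phi> x * \<bar>?k p\<bar>"
          using n1 \<phi>\<Omega>[OF 3(3)] \<phi>01 by (simp add: a_def p abs_mult)
        also have "\<dots> \<le> (\<bar>u x\<bar> + \<bar>u y\<bar>) * 1 * (1 / d ^ ?N)"
          using kd[of p] d(3)[OF 3(2,3)] \<phi>01 by (intro mult_mono) (auto simp: p)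
        finally have "\<bar>a p\<bar> \<le> (\<bar>u x\<bar> + \<bar>u y\<bar>) * 1 * (1 / d ^ ?N)" .
        then show ?thesis using B by (simp add: p mult_ac)
      next
        case 4
        then have n1: "norm (y - x) \<le> 1" by (auto simp: a_def p norm_minus_commute split: if_splits)
        have y\<Omega>: "y \<in> \<Omega>" using 4 K by auto
        have B: "x \<in> ?B" "y \<in> ?B" using \<Omega>B[OF y\<Omega>] near[OF y\<Omega>, of x] n1 by auto
        have "\<bar>a p\<bar> = \<bar>u x - u y\<bar> * \<phi> y * \<bar>?k p\<bar>"
          using n1 \<phi>\<Omega>[OF 4(2)] \<phi>01 by (simp add: a_def p abs_mult norm_minus_commute)
        also have "\<dots> \<le> (\<bar>u x\<bar> + \<bar>u y\<bar>) * 1 * (1 / d ^ ?N)"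
          using kd[of p] d(3)[OF 4(3,2)] \<phi>01 by (intro mult_mono) (auto simp: p norm_minus_commute)
        finally have "\<bar>a p\<bar> \<le> (\<bar>u x\<bar> + \<bar>u y\<bar>) * 1 * (1 / d ^ ?N)" .
        then show ?thesis using B by (simp add: p mult_ac)
      qed
    qed
  qed (use ma in simp)
  \<comment> \<open>This is where the weight of \<open>L1_0\<close> enters. For |y| < R and |x-y|
    \<ge> 1 one has 1 + |x| \<le> 1 + R + |x-y| \<le> (2+R) |x-y|, so the kernel is at most (2+R)^N
    (1+|x|)^(-N).\<close>
  have ib: "integrable lborel b"
  proof (rule integrable_abs_le[OF integrable_mult_right[OF integrable_pair_mult[OF u1 iK], of "(2 + R) ^ ?N"]])
    show "\<bar>b p\<bar> \<le> (2 + R) ^ ?N * (\<bar>u (fst p)\<bar> / (1 + norm (fst p)) ^ ?N * indicator K (snd p))" for p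
    proof (cases "b p = 0")
      case False
      obtain x y where p: "p = (x, y)" by (cases p)
      have yK: "y \<in> K" and n1: "1 \<le> norm (x - y)" using False K(3) by (auto simp: b_def p split: if_splits)
      have yR: "norm y < R" using yK K(2) R by auto
      then have R0: "R > 0" using norm_ge_zero[of y] by linarith
      have "norm x \<le> norm y + norm (x - y)" using norm_triangle_ineq[of y "x - y"] by simp
      moreover have "(1 + R) * 1 \<le> (1 + R) * norm (x - y)" using n1 R0 by (intro mult_left_mono) auto
      ultimately have le: "1 + norm x \<le> (2 + R) * norm (x - y)" using yR by (simp add: algebra_simps)
      have p0: "(1 + norm x) ^ ?N > 0" by (intro zero_less_power add_pos_nonneg) auto
      have "(1 + norm x) ^ ?N \<le> ((2 + R) * norm (x - y)) ^ ?N" by (intro power_mono le) auto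
      also have "\<dots> = (2 + R) ^ ?N * norm (x - y) ^ ?N" by (rule power_mult_distrib)
      finally have "1 \<le> (2 + R) ^ ?N * norm (x - y) ^ ?N / (1 + norm x) ^ ?N"
        using p0 by simp
      moreover have pn: "norm (x - y) ^ ?N > 0" using n1 by (intro zero_less_power) linarith
      ultimately have "1 / norm (x - y) ^ ?N \<le> (2 + R) ^ ?N / (1 + norm x) ^ ?N"
        unfolding pos_divide_le_eq[OF pn] by simp
      then have "\<bar>u x\<bar> * \<phi> y * (1 / norm (x - y) ^ ?N) \<le> \<bar>u x\<bar> * 1 * ((2 + R) ^ ?N / (1 + norm x) ^ ?N)"
        using \<phi>01 by (intro mult_mono) auto
      then show ?thesis using yK n1 \<phi>01 by (simp add: b_def p abs_mult mult_ac)
    next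
      case True
      have "R \<ge> 0" if "snd p \<in> K"
      proof -
        have "norm (snd p) < R" using subsetD[OF R, of "snd p"] K(2) that by auto
        then show ?thesis using norm_ge_zero[of "snd p"] by linarith
      qed
      then show ?thesis using True by (auto simp: indicator_def)
    qed
  qed (use mb in simp)
  note ints' = integrable_pair_swap[OF ints] and ib' = integrable_pair_swap[OF ib]
  \<comment> \<open>The pointwise comparison holds only after symmetrising \<open>b\<close> and
    \<open>s\<close>. Exchanging the variables preserves integrals, so each swapped copy doubles its
    term in \<open>main\<close>.\<close>
  have "(LBINT p. a p - b p - b (snd p, fst p)) \<le> (LBINT p. q p + s p + s (snd p, fst p))"
  proof (rule integral_mono_AE)
    show "AE p in lborel. a p - b p - b (snd p, fst p) \<le> q p + s p + s (snd p, fst p)"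
      using AE_pair_norm_diff_neq[of 1]
    proof eventually_elim
      case (elim p)
      have "?k p \<ge> 0" by simp
      from E_L_integrand_le[OF this \<phi>01(1)[of "fst p"] \<phi>01(1)[of "snd p"] elim, of "fst p \<in> \<Omega>" "u (fst p)" "snd p \<in> \<Omega>" "u (snd p)"]
        \<phi>\<Omega> u_nonneg
      show ?case
        by (simp add: a_def b_def q_def s_def h_kernel_def indicator_times norm_minus_commute[of "snd p" "fst p"]
            split: if_split_asm)
    qed
  qed (use ia ib ib' iq ints ints' in auto)
  then have main: "(LBINT p. a p) - 2 * (LBINT p. b p) \<le> (LBINT p. q p) + 2 * (LBINT p. s p)"
    using ia ib ib' iq ints ints' by (simp add: integral_pair_swap[OF mb] integral_pair_swap[OF ms])
  have ints2: "integrable (lborel \<Otimes>\<^sub>M lborel) s" using ints by (simp add: lborel_prod)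
  let ?H = "\<lambda>x. \<integral>y. h_kernel \<Omega> (x, y) \<partial>lborel"
  have sx: "(LBINT y. s (x, y)) = u x * \<phi> x * ?H x" for x by (simp add: s_def)
  have hH: "h_fun \<Omega> x * (u x * \<phi> x) = c_const ?N * (u x * \<phi> x * ?H x)" for x
    using h_fun_kernel(2)[OF \<Omega>, of x] \<phi>\<Omega>[of x] by (cases "x \<in> \<Omega>") auto
  have ih: "integrable lborel (\<lambda>x. h_fun \<Omega> x * (u x * \<phi> x))"
    unfolding hH using lborel_pair.integrable_fst'[OF ints2] unfolding sx by (rule integrable_mult_right)
  have Ih: "(LBINT x. h_fun \<Omega> x * (u x * \<phi> x)) = c_const ?N * (LBINT p. s p)"
    unfolding hH using lborel_pair.integral_fst'[OF ints2] unfolding sx by (simp add: lborel_prod)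
  have iu: "integrable lborel (\<lambda>x. u x * \<phi> x)"
  proof (rule integrable_abs_le[OF integrable_u_ball[of R]])
    show "\<bar>u x * \<phi> x\<bar> \<le> indicator (ball 0 R) x * \<bar>u x\<bar>" for x
      using \<phi>01[of x] \<phi>\<Omega>[of x] subsetD[OF R, of x] by (cases "x \<in> \<Omega>") (auto simp: mult_left_le abs_mult)
  qed auto
  have eq: "(\<lambda>x. (h_fun \<Omega> x + rho_const ?N) * (u x * \<phi> x)) = (\<lambda>x. h_fun \<Omega> x * (u x * \<phi> x) + rho_const ?N * (u x * \<phi> x))"
    by (auto simp: algebra_simps)
  show ?int
    unfolding eq using ih iu by auto
  have "E_L u \<phi> = c_const ?N / 2 * ((LBINT p. a p) - 2 * (LBINT p. b p)) + rho_const ?N * (LBINT x. u x * \<phi> x)"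
    unfolding E_L_lborel[OF u \<phi> AE_I2[OF refl]] a_def b_def by (simp add: right_diff_distrib)
  also have "\<dots> \<le> c_const ?N / 2 * ((LBINT p. q p) + 2 * (LBINT p. s p)) + rho_const ?N * (LBINT x. u x * \<phi> x)"
    using main c_const_pos[of ?N] by (intro add_right_mono mult_left_mono) auto
  also have "\<dots> = c_const ?N / 2 * (LBINT p. q p) + (LBINT x. h_fun \<Omega> x * (u x * \<phi> x) + rho_const ?N * (u x * \<phi> x))"
    using ih iu Ih by (simp add: distrib_left)
  finally show ?le
    unfolding eq Iq .
qed

end

section \<open>The maximum principle\<close>

text \<open>Local integrability gives measurability only after cutting \<open>u\<close> to compact
  sets; \<open>u\<close> is the pointwise limit of its restrictions to growing balls.\<close>

lemma L1_0_imp_measurable: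
  assumes "u \<in> L1_0"
  shows "u \<in> borel_measurable lebesgue"
proof (rule borel_measurable_LIMSEQ_metric)
  fix n :: nat
  have "set_integrable lebesgue (cball 0 (real n)) u"
    using assms by (auto simp: L1_0_def locally_integrable_def)
  then show "(\<lambda>x. indicator (cball 0 (real n)) x *\<^sub>R u x) \<in> borel_measurable lebesgue"
    by (auto simp: set_integrable_def)
next
  fix x :: 'a
  obtain k :: nat where k: "norm x \<le> real k" using real_arch_simple by blast
  have "indicator (cball 0 (real n)) x *\<^sub>R u x = u x" if "n \<ge> k" for n
    using k that by (auto simp: indicator_def)
  then show "(\<lambda>n. indicator (cball 0 (real n)) x *\<^sub>R u x) \<longlonglongrightarrow> u x"
    by (intro tendsto_eventually) (auto simp: eventually_sequentially)
qed

text \<open>The space controls only pairs at distance at most 1. For the others the kernel is at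
  most 1 and (v(x)-v(y))^2 \<le> 2 v(x)^2 + 2 v(y)^2, which is integrable over the bounded set
  \<Omega> x \<Omega>.\<close>

lemma V_space_energy:
  fixes \<Omega> :: "'a::euclidean_space set" and v :: "'a \<Rightarrow> real"
  assumes \<Omega>: "open \<Omega>" "bounded \<Omega>" and u: "u \<in> V_space \<Omega>"
    and v [measurable]: "v \<in> borel_measurable borel" and ae: "AE x in lborel. u x = v x"
  shows "integrable lborel (\<lambda>x. \<bar>v x\<bar> / (1 + norm x) ^ DIM('a))" (is ?L1)
    "integrable (energy_measure \<Omega>) (\<lambda>p. (v (fst p) - v (snd p))\<^sup>2)" (is ?E)
proof -
  have \<Omega>m [measurable]: "\<Omega> \<in> sets borel" using \<Omega> by simp
  have m: "(\<lambda>x. \<bar>v x\<bar> / (1 + norm x) ^ DIM('a)) \<in> borel_measurable borel" by measurable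
  have "AE x in lborel. \<bar>u x\<bar> / (1 + norm x) ^ DIM('a) = \<bar>v x\<bar> / (1 + norm x) ^ DIM('a)"
    using ae by eventually_elim simp
  then show ?L1
    using lebesgue_AE_eq_borel(2)[OF m] u by (simp add: V_space_def L1_0_def)
  have p: "AE p in (lborel :: ('a \<times> 'a) measure). u (fst p) = v (fst p) \<and> u (snd p) = v (snd p)"
    by (rule AE_fst_snd_lborel[OF ae])
  let ?near = "\<lambda>v p. indicator {(x, y). x \<in> \<Omega> \<and> y \<in> \<Omega> \<and> norm (x - y) \<le> 1} p * ((v (fst p) - v (snd p))\<^sup>2 / norm (fst p - snd p) ^ DIM('a)) :: real"
  have m1: "?near v \<in> borel_measurable borel"
    unfolding case_prod_beta' by (rule borel_measurable_pairI) measurable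
  have a1: "AE p in lborel. ?near u p = ?near v p"
    using p by eventually_elim simp
  have "integrable lebesgue (?near u)"
    using u by (simp add: V_space_def set_integrable_def case_prod_beta')
  then have near: "integrable lborel (?near v)"
    by (simp only: lebesgue_AE_eq_borel(2)[OF m1 a1])
  have i\<Omega>: "integrable lborel (indicator \<Omega> :: 'a \<Rightarrow> real)"
    using \<Omega> by (intro integrable_indicator_bounded) auto
  have m2: "(\<lambda>x. indicator \<Omega> x * (v x)\<^sup>2) \<in> borel_measurable borel" by measurable
  have a2: "AE x in lborel. indicator \<Omega> x * (u x)\<^sup>2 = (indicator \<Omega> x * (v x)\<^sup>2 :: real)"
    using ae by eventually_elim simp
  have "integrable lebesgue (\<lambda>x. indicator \<Omega> x * (u x)\<^sup>2)"
    using u by (simp add: V_space_def set_integrable_def)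
  then have "integrable lborel (\<lambda>x. indicator \<Omega> x * (v x)\<^sup>2)"
    by (simp only: lebesgue_AE_eq_borel(2)[OF m2 a2])
  from integrable_pair_mult[OF this i\<Omega>]
  have v2: "integrable lborel (\<lambda>p. indicator \<Omega> (fst p) * (v (fst p))\<^sup>2 * indicator \<Omega> (snd p))" .
  note v2' = integrable_pair_swap[OF v2]
  let ?far = "\<lambda>p. 2 * (indicator \<Omega> (fst p) * (v (fst p))\<^sup>2 * indicator \<Omega> (snd p)) +
      2 * (indicator \<Omega> (snd p) * (v (snd p))\<^sup>2 * indicator \<Omega> (fst p)) :: real"
  let ?q = "\<lambda>p. indicator (\<Omega> \<times> \<Omega>) p / norm (fst p - snd p) ^ DIM('a) * (v (fst p) - v (snd p))\<^sup>2"
  have mq: "(\<lambda>p. (v (fst p) - v (snd p))\<^sup>2) \<in> borel_measurable borel"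
    by (rule borel_measurable_pairI) measurable
  have "integrable lborel ?q"
  proof (rule integrable_abs_le[OF Bochner_Integration.integrable_add[OF near]])
    show "integrable lborel ?far" using v2 v2' by simp
    show "?q \<in> borel_measurable lborel"
      using borel_measurable_times[OF borel_measurable_kernel_density[OF \<Omega>m] mq] by simp
    show "\<bar>?q p\<bar> \<le> ?near v p + ?far p" for p
    proof (cases "p \<in> \<Omega> \<times> \<Omega>")
      case True
      then obtain x y where p: "p = (x, y)" "x \<in> \<Omega>" "y \<in> \<Omega>" by auto
      show ?thesis
      proof (cases "norm (x - y) \<le> 1")
        case True
        then show ?thesis using p by simp
      next
        case False
        then have n1: "1 \<le> norm (x - y)" by simp
        have "1 \<le> norm (x - y) ^ DIM('a)" by (rule one_le_power[OF n1])
        then have "(v x - v y)\<^sup>2 / norm (x - y) ^ DIM('a) \<le> (v x - v y)\<^sup>2 / 1"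
          by (intro divide_left_mono) auto
        moreover have "(v x - v y)\<^sup>2 \<le> 2 * (v x)\<^sup>2 + 2 * (v y)\<^sup>2"
          using sum_squares_bound[of "v x" "- v y"] by (simp add: power2_diff)
        ultimately show ?thesis using p False by simp
      qed
    next
      case False
      then show ?thesis by (auto simp: indicator_def)
    qed
  qed
  then show ?E
    using integral_energy_measure(1)[OF _ mq, of \<Omega>] by simp
qed

text \<open>The bound passes through the translation-invariant energy \<open>?F\<close>, for which
  \<open>mollify_energy\<close> holds. \<open>far\<close> replaces the energy on \<Omega> by
  \<open>?F\<close> at the cost of pairs at distance at least 1; \<open>near\<close> returns to
  \<Omega> for \<open>f\<close> itself, where a pair with one point outside has its other point in
  \<open>K\<close>, hence at distance at least \<open>d\<close>. Both costs are independent of the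
  radius.\<close>

lemma mollify_energy_bound:
  fixes \<Omega> K :: "'a::euclidean_space set" and f :: "'a \<Rightarrow> real"
  assumes \<Omega>: "open \<Omega>" "bounded \<Omega>" and f [measurable]: "f \<in> borel_measurable borel"
    and f01: "\<And>x. 0 \<le> f x" "\<And>x. f x \<le> 1"
    and K: "compact K" "K \<subseteq> \<Omega>" "\<And>x. x \<notin> K \<Longrightarrow> f x = 0"
    and energy: "energy \<Omega> f < \<infinity>"
  obtains C where "\<And>e. e > 0 \<Longrightarrow>
    energy \<Omega> (mollify e f) \<le> ennreal C"
proof -
  let ?N = "DIM('a)"
  have [measurable]: "\<Omega> \<in> sets borel" using \<Omega> by auto
  obtain d where d: "0 < d" "d \<le> 1" "\<And>x y. x \<in> K \<Longrightarrow> y \<notin> \<Omega> \<Longrightarrow> d \<le> norm (x - y)"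
    using compact_distance_complement[OF \<Omega>(1) K(1,2)] by blast
  obtain R where R: "\<Omega> \<subseteq> ball 0 R" using bounded_subset_ballD[OF \<Omega>(2), of 0] by blast
  let ?B = "ball (0::'a) (R + 1)"
  \<comment> \<open>Without the cut at 1 the whole-space energy of a compactly supported function
    diverges logarithmically at infinity in general.\<close>
  define W where "W z = (if norm z < 1 then 1 / norm z ^ ?N else 0)" for z :: 'a
  have [measurable]: "W \<in> borel_measurable borel" unfolding W_def[abs_def] by measurable
  have W0: "W z \<ge> 0" for z by (simp add: W_def)
  let ?F = "\<lambda>f. \<integral>\<^sup>+p. ennreal ((f (fst p) - f (snd p))\<^sup>2 * W (fst p - snd p)) \<partial>(lborel :: ('a \<times> 'a) measure)"
  let ?J = "\<lambda>c A. \<integral>\<^sup>+p. ennreal (c * (indicator A (fst p) * indicator A (snd p))) \<partial>(lborel :: ('a \<times> 'a) measure)"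
  have E_eq: "energy \<Omega> g = (\<integral>\<^sup>+p. ennreal (indicator (\<Omega> \<times> \<Omega>) p / norm (fst p - snd p) ^ ?N) * ennreal ((g (fst p) - g (snd p))\<^sup>2) \<partial>lborel)"
    if [measurable]: "g \<in> borel_measurable borel" for g :: "'a \<Rightarrow> real"
    by (intro nn_integral_energy_measure borel_measurable_pairI) measurable
  have finite_pair: "?J c A < \<infinity>"
    if "bounded A" "A \<in> sets borel" "c \<ge> 0" for A :: "'a set" and c :: real
  proof -
    have "integrable lborel (indicator A :: 'a \<Rightarrow> real)"
      using that by (intro integrable_indicator_bounded) auto
    then have "integrable lborel (\<lambda>p::'a \<times> 'a. c * (indicator A (fst p) * indicator A (snd p)))"
      using integrable_pair_mult[of "indicator A" "indicator A"] by (intro integrable_mult_right) auto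
    then show ?thesis using that(3) by (subst nn_integral_eq_integral) auto
  qed
  have far: "energy \<Omega> g \<le> ?F g + ?J 1 \<Omega>"
    if [measurable]: "g \<in> borel_measurable borel" and g01: "\<And>x. 0 \<le> g x" "\<And>x. g x \<le> 1" for g :: "'a \<Rightarrow> real"
  proof -
    have "energy \<Omega> g \<le> (\<integral>\<^sup>+p. ennreal ((g (fst p) - g (snd p))\<^sup>2 * W (fst p - snd p)) + ennreal (1 * (indicator \<Omega> (fst p) * indicator \<Omega> (snd p))) \<partial>lborel)"
      unfolding E_eq[OF that(1)]
    proof (rule nn_integral_mono)
      fix p :: "'a \<times> 'a"
      obtain x y where p: "p = (x, y)" by (cases p)
      have g1: "(g x - g y)\<^sup>2 \<le> 1" using g01[of x] g01[of y] by (simp add: abs_square_le_1 abs_le_iff)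
      show "ennreal (indicator (\<Omega> \<times> \<Omega>) p / norm (fst p - snd p) ^ ?N) * ennreal ((g (fst p) - g (snd p))\<^sup>2)
        \<le> ennreal ((g (fst p) - g (snd p))\<^sup>2 * W (fst p - snd p)) + ennreal (1 * (indicator \<Omega> (fst p) * indicator \<Omega> (snd p)))"
      proof (cases "x \<in> \<Omega> \<and> y \<in> \<Omega>")
        case True
        have "1 / norm (x - y) ^ ?N * (g x - g y)\<^sup>2 \<le> (g x - g y)\<^sup>2 * W (x - y) + 1"
        proof (cases "norm (x - y) < 1")
          case False
          then have "1 \<le> norm (x - y) ^ ?N" by (intro one_le_power) simp
          then have "(g x - g y)\<^sup>2 / norm (x - y) ^ ?N \<le> 1 / 1"
            using g1 by (intro frac_le) auto
          then show ?thesis using False by (simp add: W_def)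
        qed (simp add: W_def)
        then have "ennreal (1 / norm (x - y) ^ ?N * (g x - g y)\<^sup>2) \<le> ennreal ((g x - g y)\<^sup>2 * W (x - y) + 1)"
          by (rule ennreal_leI)
        also have "\<dots> = ennreal ((g x - g y)\<^sup>2 * W (x - y)) + ennreal 1"
          by (rule ennreal_plus) (simp_all add: W0)
        finally show ?thesis using True by (simp add: p ennreal_mult'[symmetric])
      next
        case False
        then have "indicator (\<Omega> \<times> \<Omega>) p = (0 :: real)" by (auto simp: p indicator_def)
        then show ?thesis by simp
      qed
    qed
    also have "\<dots> = ?F g + ?J 1 \<Omega>"
      unfolding lborel_prod[symmetric] by (rule nn_integral_add) measurable
    finally show ?thesis .
  qed
  have near: "?F f \<le> energy \<Omega> f + ?J (1 / d ^ ?N) ?B"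
  proof -
    have "?F f \<le> (\<integral>\<^sup>+p. ennreal (indicator (\<Omega> \<times> \<Omega>) p / norm (fst p - snd p) ^ ?N) * ennreal ((f (fst p) - f (snd p))\<^sup>2)
        + ennreal (1 / d ^ ?N * (indicator ?B (fst p) * indicator ?B (snd p))) \<partial>lborel)"
    proof (rule nn_integral_mono)
      fix p :: "'a \<times> 'a"
      obtain x y where p: "p = (x, y)" by (cases p)
      show "ennreal ((f (fst p) - f (snd p))\<^sup>2 * W (fst p - snd p)) \<le>
        ennreal (indicator (\<Omega> \<times> \<Omega>) p / norm (fst p - snd p) ^ ?N) * ennreal ((f (fst p) - f (snd p))\<^sup>2)
        + ennreal (1 / d ^ ?N * (indicator ?B (fst p) * indicator ?B (snd p)))"
      proof (cases "(f x - f y)\<^sup>2 * W (x - y) = 0")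
        case False
        then have n1: "norm (x - y) < 1" and ne: "f x \<noteq> f y" by (auto simp: W_def split: if_splits)
        show ?thesis
        proof (cases "x \<in> \<Omega> \<and> y \<in> \<Omega>")
          case True
          then show ?thesis using n1 by (auto simp: p W_def ennreal_mult'[symmetric] mult.commute intro: add_increasing2)
        next
          case out: False
          have "x \<in> K \<and> y \<notin> \<Omega> \<or> y \<in> K \<and> x \<notin> \<Omega>"
            using out ne K(3)[of x] K(3)[of y] subsetD[OF K(2), of x] subsetD[OF K(2), of y] by metis
          then have "d \<le> norm (x - y)"
            using d(3)[of x y] d(3)[of y x] by (auto simp: norm_minus_commute)
          then have k: "1 / norm (x - y) ^ ?N \<le> 1 / d ^ ?N"
            using d(1) by (intro divide_left_mono power_mono mult_pos_pos zero_less_power) auto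
          have "x \<in> \<Omega> \<or> y \<in> \<Omega>"
            using ne K(3)[of x] K(3)[of y] subsetD[OF K(2), of x] subsetD[OF K(2), of y] by metis
          then have "norm x < R \<or> norm y < R" using subsetD[OF R, of x] subsetD[OF R, of y] by auto
          moreover have "norm y \<le> norm x + norm (x - y)" "norm x \<le> norm y + norm (x - y)"
            using norm_triangle_ineq4[of x "x - y"] norm_triangle_ineq[of y "x - y"] by auto
          ultimately have B: "x \<in> ?B" "y \<in> ?B" using n1 by auto
          have "(f x - f y)\<^sup>2 \<le> 1" using f01[of x] f01[of y] by (simp add: abs_square_le_1 abs_le_iff)
          then have "(f x - f y)\<^sup>2 * W (x - y) \<le> 1 * (1 / d ^ ?N)"
            using k n1 W0 by (intro mult_mono) (auto simp: W_def)
          then have "ennreal ((f x - f y)\<^sup>2 * W (x - y)) \<le> ennreal (1 / d ^ ?N * (indicator ?B x * indicator ?B y))"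
            using B by (intro ennreal_leI) simp
          then show ?thesis unfolding p fst_conv snd_conv by (rule add_increasing[OF zero_le])
        qed
      next
        case True
        then show ?thesis by (simp only: p fst_conv snd_conv ennreal_0 zero_le)
      qed
    qed
    also have "\<dots> = energy \<Omega> f + ?J (1 / d ^ ?N) ?B"
      unfolding E_eq[OF f] indicator_times lborel_prod[symmetric] by (rule nn_integral_add) measurable
    finally show ?thesis .
  qed
  define C where "C = energy \<Omega> f + ?J (1 / d ^ ?N) ?B
      + ?J 1 \<Omega>"
  have "C < \<infinity>"
    unfolding C_def using energy finite_pair[of ?B "1 / d ^ ?N"] finite_pair[of \<Omega> 1] \<Omega>(2) d(1) by (simp add: ennreal_add_eq_top less_top)
  then have C: "C = ennreal (enn2real C)" by simp
  have "energy \<Omega> (mollify e f) \<le> ennreal (enn2real C)" if e: "e > 0" for e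
  proof -
    have "energy \<Omega> (mollify e f) \<le> ?F (mollify e f) + ?J 1 \<Omega>"
      by (intro far borel_measurable_mollify[OF e f f01 K(1,3)] mollify_nonneg[OF e f f01 K(1,3)] mollify_le_1[OF e f f01 K(1,3)])
    also have "\<dots> \<le> C"
      unfolding C_def
      by (intro add_right_mono order_trans[OF _ near] mollify_energy[OF e f f01 K(1,3)] W0) measurable
    finally show ?thesis using C by simp
  qed
  then show ?thesis using that by blast
qed

context
  fixes \<Omega> :: "'a::euclidean_space set" and u :: "'a \<Rightarrow> real"
  assumes \<Omega>: "bounded_lipschitz_domain \<Omega>"
    and u [measurable]: "u \<in> borel_measurable borel"
    and u1: "integrable lborel (\<lambda>x. \<bar>u x\<bar> / (1 + norm x) ^ DIM('a))"
    and u_nonneg: "\<And>x. x \<notin> \<Omega> \<Longrightarrow> u x \<ge> 0"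
    and u_energy: "integrable (energy_measure \<Omega>) (\<lambda>p. (u (fst p) - u (snd p))\<^sup>2)"
    and super: "L_Delta_nonneg \<Omega> u"
begin

abbreviation (input) "E_form g \<equiv> (\<integral>p. (u (fst p) - u (snd p)) * (g (fst p) - g (snd p)) \<partial>energy_measure \<Omega>)"

text \<open>The form with \<open>u\<close> fixed is a bounded linear functional of the differences
  in L2 of \<open>energy_measure\<close>, so bounded energies and convergence almost everywhere are
  enough to pass to the limit. In the zero-order term all mollified functions live in one compact
  subset of \<Omega>, where h is bounded.\<close>

lemma supersolution_extended:
  assumes f [measurable]: "f \<in> borel_measurable borel"
    and f01: "\<And>x. 0 \<le> f x" "\<And>x. f x \<le> 1"
    and K: "compact K" "K \<subseteq> \<Omega>" "\<And>x. x \<notin> K \<Longrightarrow> f x = 0"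
    and energy: "energy \<Omega> f < \<infinity>"
  shows "integrable lborel (\<lambda>x. (h_fun \<Omega> x + rho_const DIM('a)) * (u x * f x))" (is ?int)
    "0 \<le> c_const DIM('a) / 2 * E_form f + (LBINT x. (h_fun \<Omega> x + rho_const DIM('a)) * (u x * f x))" (is ?le)
proof -
  have o: "open \<Omega>" and b: "bounded \<Omega>" using \<Omega> by (auto simp: bounded_lipschitz_domain_def)
  let ?c = "c_const DIM('a) / 2"
  let ?h = "\<lambda>x. h_fun \<Omega> x + rho_const DIM('a)"
  have [measurable]: "\<Omega> \<in> sets borel" using o by simp
  have sq: "integrable (energy_measure \<Omega>) (\<lambda>p. (g (fst p) - g (snd p))\<^sup>2)"
    if "g \<in> borel_measurable borel" "energy \<Omega> g < \<infinity>" for g :: "'a \<Rightarrow> real"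
    using that(2) borel_measurable_diff_pair[OF that(1)] by (intro integrableI_bounded) auto
  show i: "integrable lborel (\<lambda>x. ?h x * (u x * f x))"
    by (rule E_L_le_energy(1)[OF o b u u1 u_nonneg u_energy f f01 K sq[OF f energy]])
  obtain C where C: "\<And>e. e > 0 \<Longrightarrow> energy \<Omega> (mollify e f) \<le> ennreal C"
    using mollify_energy_bound[OF o b f f01 K energy] by blast
  obtain d where d: "0 < d" "d \<le> 1" "\<And>x y. x \<in> K \<Longrightarrow> y \<notin> \<Omega> \<Longrightarrow> d \<le> norm (x - y)"
    using compact_distance_complement[OF o K(1,2)] by blast
  \<comment> \<open>Points outside \<Omega> are at distance at least \<open>d\<close> from
    \<open>K\<close>, so radii up to \<open>d / 2\<close> keep all supports in the compact
    neighbourhood \<open>K'\<close> inside \<Omega>.\<close>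
  obtain e where e: "\<And>n. 0 < e n" "\<And>n::nat. e n \<le> d / 2" "AE x in lborel. (\<lambda>n. mollify (e n) f x) \<longlonglongrightarrow> f x"
    using mollify_AE_converges[OF f f01 K(1,3), of "d / 2"] d(1) by auto
  define \<phi> where "\<phi> n = mollify (e n) f" for n
  have \<phi> [measurable]: "\<phi> n \<in> borel_measurable borel" for n
    unfolding \<phi>_def by (rule borel_measurable_mollify[OF e(1) f f01 K(1,3)])
  have \<phi>01: "0 \<le> \<phi> n x" "\<phi> n x \<le> 1" for n x
    unfolding \<phi>_def
    by (auto intro: mollify_nonneg[OF e(1) f f01 K(1,3)] mollify_le_1[OF e(1) f f01 K(1,3)])
  define K' where "K' = {x. \<exists>y\<in>K. dist x y \<le> d / 2}"
  have K'\<Omega>: "K' \<subseteq> \<Omega>"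
    using d(1,3) by (force simp: K'_def dist_norm norm_minus_commute)
  have cK': "compact K'"
    unfolding K'_def by (rule compact_closed_neighbourhood[OF K(1)])
  have \<phi>K': "\<phi> n x = 0" if "x \<notin> K'" for n x
    unfolding \<phi>_def
  proof (rule mollify_eq_0[OF e(1) f f01 K(1,3)])
    fix y assume "y \<in> K"
    then show "e n \<le> dist x y" using that e(2)[of n] by (force simp: K'_def)
  qed
  have test: "\<phi> n \<in> test_functions \<Omega>" for n
    unfolding \<phi>_def
  proof (rule mollify_test_function[OF e(1) f f01 K(1,3)])
    show "{x. \<exists>y\<in>K. dist x y \<le> e n} \<subseteq> \<Omega>"
      using K'\<Omega> e(2)[of n] by (force simp: K'_def)
  qed
  have E\<phi>: "energy \<Omega> (\<phi> n) \<le> ennreal C" for n unfolding \<phi>_def by (rule C[OF e(1)])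
  then have E\<phi>': "energy \<Omega> (\<phi> n) < \<infinity>" for n using le_less_trans[OF E\<phi>[of n] ennreal_less_top] by simp
  have form\<phi>: "integrable lborel (\<lambda>x. ?h x * (u x * \<phi> n x))"
    "E_L u (\<phi> n) \<le> ?c * E_form (\<phi> n) + (LBINT x. ?h x * (u x * \<phi> n x))" for n
    by (rule E_L_le_energy[OF o b u u1 u_nonneg u_energy \<phi> \<phi>01 cK' K'\<Omega> \<phi>K' sq[OF \<phi> E\<phi>']]; assumption)+
  have lim: "AE x in lborel. (\<lambda>n. \<phi> n x) \<longlonglongrightarrow> f x" using e(3) by (simp add: \<phi>_def)
  have A: "(\<lambda>n. E_form (\<phi> n)) \<longlonglongrightarrow> E_form f"
  proof (rule weak_L2_convergence(2)[OF _ _ _ u_energy E\<phi>])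
    show "AE p in energy_measure \<Omega>. (\<lambda>n. \<phi> n (fst p) - \<phi> n (snd p)) \<longlonglongrightarrow> f (fst p) - f (snd p)"
      by (intro AE_energy_measure, simp, use AE_fst_snd_lborel[OF lim] in eventually_elim) (auto intro: tendsto_diff)
  qed (simp_all add: borel_measurable_diff_pair)
  obtain M where M0: "M \<ge> 0" and M: "\<And>x. x \<in> K' \<Longrightarrow> \<bar>h_fun \<Omega> x\<bar> \<le> M"
    using h_fun_bounded_on_compact[OF o b cK' K'\<Omega>] by blast
  obtain R where R: "\<Omega> \<subseteq> ball 0 R" using bounded_subset_ballD[OF b, of 0] by blast
  let ?w = "\<lambda>x. (M + \<bar>rho_const DIM('a)\<bar>) * (indicator (ball 0 R) x * \<bar>u x\<bar>)"
  have B: "(\<lambda>n. \<integral>x. ?h x * (u x * \<phi> n x) \<partial>lborel) \<longlonglongrightarrow> (LBINT x. ?h x * (u x * f x))"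
  proof (rule integral_dominated_convergence[where w="?w"])
    show "integrable lborel ?w"
      by (intro integrable_mult_right integrable_u_ball[OF o b u u1 u_nonneg u_energy f f01 K sq[OF f energy]])
    show "AE x in lborel. (\<lambda>n. ?h x * (u x * \<phi> n x)) \<longlonglongrightarrow> ?h x * (u x * f x)"
      using lim by eventually_elim (intro tendsto_intros)
    show "AE x in lborel. norm (?h x * (u x * \<phi> n x)) \<le> ?w x" for n
    proof (rule AE_I2)
      fix x
      show "norm (?h x * (u x * \<phi> n x)) \<le> ?w x"
      proof (cases "x \<in> K'")
        case True
        then have xR: "x \<in> ball 0 R" using K'\<Omega> R by auto
        have "\<bar>?h x\<bar> * (\<bar>u x\<bar> * \<phi> n x) \<le> (M + \<bar>rho_const DIM('a)\<bar>) * (\<bar>u x\<bar> * 1)"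
          using M[OF True] \<phi>01 by (intro mult_mono) auto
        then show ?thesis using xR \<phi>01 by (simp add: abs_mult)
      next
        case False
        then show ?thesis using \<phi>K'[OF False] M0 by simp
      qed
    qed
  qed (use i form\<phi>(1) in auto)
  have "0 \<le> ?c * E_form (\<phi> n) + (LBINT x. ?h x * (u x * \<phi> n x))" for n
  proof -
    have "0 \<le> E_L u (\<phi> n)" using super test \<phi>01 by (auto simp: L_Delta_nonneg_def)
    also note form\<phi>(2)[of n]
    finally show ?thesis .
  qed
  then show "0 \<le> ?c * E_form f + (LBINT x. ?h x * (u x * f x))"
    by (intro LIMSEQ_le_const[OF tendsto_add[OF tendsto_mult_left[OF A] B]]) auto
qed

lemma supersolution_nonneg:
  assumes hpos: "\<And>x. x \<in> \<Omega> \<Longrightarrow> 0 \<le> h_fun \<Omega> x + rho_const DIM('a)"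
  shows "AE x in lborel. 0 \<le> u x"
proof -
  have o: "open \<Omega>" and b: "bounded \<Omega>" using \<Omega> by (auto simp: bounded_lipschitz_domain_def)
  let ?h = "\<lambda>x. h_fun \<Omega> x + rho_const DIM('a)"
  let ?c = "c_const DIM('a) / 2"
  have \<Omega>m [measurable]: "\<Omega> \<in> sets borel" using o by simp
  have c: "?c > 0" by (simp add: c_const_pos)
  define w where "w x = (if x \<in> \<Omega> then min 1 (max 0 (- u x)) else 0)" for x
  have w [measurable]: "w \<in> borel_measurable borel" unfolding w_def[abs_def] by measurable
  have w01: "0 \<le> w x" "w x \<le> 1" for x by (auto simp: w_def)
  have uw: "u x * w x \<le> 0" if "x \<in> \<Omega>" for x
    using that by (cases "u x \<ge> 0") (auto simp: w_def mult_le_0_iff)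
  obtain \<eta> :: "nat \<Rightarrow> 'a \<Rightarrow> real" and K C where
    \<eta> [measurable]: "\<And>n. \<eta> n \<in> borel_measurable borel" and \<eta>01: "\<And>n x. 0 \<le> \<eta> n x" "\<And>n x. \<eta> n x \<le> 1"
    and K: "\<And>n. compact (K n)" "\<And>n. K n \<subseteq> \<Omega>" "\<And>n x. x \<notin> K n \<Longrightarrow> \<eta> n x = 0"
    and \<eta>1: "\<And>x. x \<in> \<Omega> \<Longrightarrow> (\<lambda>n. \<eta> n x) \<longlonglongrightarrow> 1"
    and \<eta>E: "\<And>n. energy \<Omega> (\<eta> n) \<le> ennreal C"
    using lipschitz_domain_cutoffs[OF \<Omega>] by blast
  have sq: "(\<lambda>p. ennreal ((g (fst p) - g (snd p))\<^sup>2)) \<in> borel_measurable (energy_measure \<Omega>)"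
    if "g \<in> borel_measurable borel" for g :: "'a \<Rightarrow> real"
    using borel_measurable_diff_pair[OF that] by simp
  have inside: "AE p in energy_measure \<Omega>. p \<in> \<Omega> \<times> \<Omega>"
    by (rule AE_energy_measure) auto
  \<comment> \<open>On \<Omega>, \<open>w\<close> is a nonincreasing function of \<open>u\<close>
    with Lipschitz constant 1. Monotonicity fixes the sign of the product, and the Lipschitz bound
    allows one increment of \<open>u\<close> to be replaced by that of \<open>w\<close>.\<close>
  have wu: "\<bar>w x - w y\<bar> \<le> \<bar>u x - u y\<bar>" "(u x - u y) * (w x - w y) \<le> - (w x - w y)\<^sup>2"
    if "x \<in> \<Omega>" "y \<in> \<Omega>" for x y
  proof -
    show "\<bar>w x - w y\<bar> \<le> \<bar>u x - u y\<bar>" using that by (auto simp: w_def min_def max_def)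
    show "(u x - u y) * (w x - w y) \<le> - (w x - w y)\<^sup>2"
    proof (cases "w x" "w y" rule: linorder_cases)
      case less
      then have "w y - w x \<le> u x - u y" using that by (auto simp: w_def min_def max_def split: if_splits)
      from mult_right_mono[OF this, of "w y - w x"] less show ?thesis
        by (simp add: power2_eq_square algebra_simps)
    next
      case greater
      then have "w x - w y \<le> u y - u x" using that by (auto simp: w_def min_def max_def split: if_splits)
      from mult_right_mono[OF this, of "w x - w y"] greater show ?thesis
        by (simp add: power2_eq_square algebra_simps)
    qed simp
  qed
  define U where "U = (\<integral>p. (u (fst p) - u (snd p))\<^sup>2 \<partial>energy_measure \<Omega>)"
  have Ew: "energy \<Omega> w \<le> ennreal U"
  proof -
    have "energy \<Omega> w \<le> energy \<Omega> u"
      using inside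
      by (intro nn_integral_mono_AE, eventually_elim) (auto intro!: ennreal_leI simp: abs_le_square_iff[symmetric] wu(1))
    then show ?thesis unfolding U_def by (simp add: nn_integral_eq_integral[OF u_energy])
  qed
  have iw: "integrable (energy_measure \<Omega>) (\<lambda>p. (w (fst p) - w (snd p))\<^sup>2)"
    using le_less_trans[OF Ew ennreal_less_top] borel_measurable_diff_pair[OF w] by (intro integrableI_bounded) auto
  define f where "f n x = \<eta> n x * w x" for n x
  have f [measurable]: "f n \<in> borel_measurable borel" for n unfolding f_def[abs_def] by measurable
  have f01: "0 \<le> f n x" "f n x \<le> 1" for n x
    using \<eta>01[of n x] w01[of x] by (auto simp: f_def intro: mult_le_one)
  have fK: "f n x = 0" if "x \<notin> K n" for n x using K(3)[OF that] by (simp add: f_def)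
  \<comment> \<open>A discrete Leibniz rule: the increment of \<open>f n\<close> is
    \<open>\<eta> n\<close> times that of \<open>w\<close> plus \<open>w\<close> times that of
    \<open>\<eta> n\<close>, and both \<open>\<eta> n\<close> and \<open>w\<close> are at most
    1.\<close>
  have Ef: "energy \<Omega> (f n) \<le> ennreal (2 * U + 2 * max C 0)" for n
  proof -
    have "energy \<Omega> (f n) \<le> (\<integral>\<^sup>+p. 2 * ennreal ((w (fst p) - w (snd p))\<^sup>2) + 2 * ennreal ((\<eta> n (fst p) - \<eta> n (snd p))\<^sup>2) \<partial>energy_measure \<Omega>)"
    proof (rule nn_integral_mono)
      fix p :: "'a \<times> 'a"
      let ?x = "fst p" and ?y = "snd p"
      have "\<bar>\<eta> n ?x * (w ?x - w ?y)\<bar> \<le> \<bar>w ?x - w ?y\<bar>"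
        using \<eta>01[of n ?x] by (simp add: abs_mult mult_left_le_one_le)
      moreover have "\<bar>w ?y * (\<eta> n ?x - \<eta> n ?y)\<bar> \<le> \<bar>\<eta> n ?x - \<eta> n ?y\<bar>"
        using w01[of ?y] by (simp add: abs_mult mult_left_le_one_le)
      moreover have "f n ?x - f n ?y = \<eta> n ?x * (w ?x - w ?y) + w ?y * (\<eta> n ?x - \<eta> n ?y)"
        by (simp add: f_def algebra_simps)
      ultimately have "\<bar>f n ?x - f n ?y\<bar> \<le> \<bar>w ?x - w ?y\<bar> + \<bar>\<eta> n ?x - \<eta> n ?y\<bar>" by linarith
      then have "(f n ?x - f n ?y)\<^sup>2 \<le> (\<bar>w ?x - w ?y\<bar> + \<bar>\<eta> n ?x - \<eta> n ?y\<bar>)\<^sup>2"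
        by (simp add: abs_le_square_iff[symmetric])
      also have "\<dots> \<le> 2 * (w ?x - w ?y)\<^sup>2 + 2 * (\<eta> n ?x - \<eta> n ?y)\<^sup>2"
        using sum_squares_bound[of "\<bar>w ?x - w ?y\<bar>" "\<bar>\<eta> n ?x - \<eta> n ?y\<bar>"] by (simp add: power2_sum)
      finally have "ennreal ((f n ?x - f n ?y)\<^sup>2) \<le> ennreal (2 * (w ?x - w ?y)\<^sup>2 + 2 * (\<eta> n ?x - \<eta> n ?y)\<^sup>2)"
        by (rule ennreal_leI)
      then show "ennreal ((f n ?x - f n ?y)\<^sup>2) \<le> 2 * ennreal ((w ?x - w ?y)\<^sup>2) + 2 * ennreal ((\<eta> n ?x - \<eta> n ?y)\<^sup>2)"
        by (simp add: ennreal_mult)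
    qed
    also have "\<dots> = 2 * energy \<Omega> w + 2 * energy \<Omega> (\<eta> n)"
    proof -
      have "(\<lambda>p. 2 * ennreal ((g (fst p) - g (snd p))\<^sup>2)) \<in> borel_measurable (energy_measure \<Omega>)"
        if "g \<in> borel_measurable borel" for g :: "'a \<Rightarrow> real"
        using sq[OF that] by measurable
      from nn_integral_add[OF this[OF w] this[OF \<eta>]] show ?thesis
        by (simp only: nn_integral_cmult[OF sq[OF w]] nn_integral_cmult[OF sq[OF \<eta>]])
    qed
    also have "\<dots> \<le> 2 * ennreal U + 2 * ennreal (max C 0)"
      by (intro add_mono mult_left_mono Ew order_trans[OF \<eta>E] ennreal_leI) auto
    also have "\<dots> = ennreal (2 * U + 2 * max C 0)"
      by (simp add: ennreal_mult U_def)
    finally show ?thesis .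
  qed
  have Ef': "energy \<Omega> (f n) < \<infinity>" for n using le_less_trans[OF Ef[of n] ennreal_less_top] by simp
  have ext: "integrable lborel (\<lambda>x. ?h x * (u x * f n x))"
    "0 \<le> ?c * E_form (f n) + (LBINT x. ?h x * (u x * f n x))" for n
    by (rule supersolution_extended[OF f f01 K(1,2) fK Ef']; assumption)+
  have A: "(\<lambda>n. E_form (f n)) \<longlonglongrightarrow> E_form w"
  proof (rule weak_L2_convergence(2)[OF _ _ _ u_energy Ef])
    show "AE p in energy_measure \<Omega>. (\<lambda>n. f n (fst p) - f n (snd p)) \<longlonglongrightarrow> w (fst p) - w (snd p)"
      using inside
    proof eventually_elim
      case (elim p)
      then have "(\<lambda>n. \<eta> n (fst p) * w (fst p) - \<eta> n (snd p) * w (snd p)) \<longlonglongrightarrow> 1 * w (fst p) - 1 * w (snd p)"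
        by (intro tendsto_intros \<eta>1) auto
      then show ?case by (simp add: f_def)
    qed
  qed (simp_all add: borel_measurable_diff_pair)
  \<comment> \<open>Since the integrand is nonpositive, the supersolution inequality forces
    \<open>E_form (f n)\<close> to be nonnegative for each \<open>n\<close>, and only this sign is
    carried to the limit.\<close>
  have neg: "?h x * (u x * f n x) \<le> 0" for n x
  proof (cases "x \<in> \<Omega>")
    case True
    have "?h x * \<eta> n x * (u x * w x) \<le> 0"
      by (rule mult_nonneg_nonpos[OF mult_nonneg_nonneg[OF hpos[OF True] \<eta>01(1)] uw[OF True]])
    then show ?thesis by (simp add: f_def mult_ac)
  next
    case False
    then have "f n x = 0" by (simp add: f_def w_def)
    then show ?thesis by simp
  qed
  have I0: "(LBINT x. ?h x * (u x * f n x)) \<le> 0" for n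
    using Bochner_Integration.integral_nonneg[of lborel "\<lambda>x. - (?h x * (u x * f n x))"] neg by simp
  have "E_form (f n) \<ge> 0" for n
  proof -
    have "0 \<le> ?c * E_form (f n)" using ext(2)[of n] I0[of n] by linarith
    then show ?thesis using c by (simp add: zero_le_mult_iff)
  qed
  then have E0: "E_form w \<ge> 0" by (intro LIMSEQ_le_const[OF A]) auto
  have mono: "E_form w \<le> (\<integral>p. - (w (fst p) - w (snd p))\<^sup>2 \<partial>energy_measure \<Omega>)"
  proof (rule integral_mono_AE)
    show "integrable (energy_measure \<Omega>) (\<lambda>p. (u (fst p) - u (snd p)) * (w (fst p) - w (snd p)))"
      by (rule integrable_mult_L2[OF _ _ u_energy iw]) (simp_all add: borel_measurable_diff_pair)
    show "AE p in energy_measure \<Omega>. (u (fst p) - u (snd p)) * (w (fst p) - w (snd p)) \<le> - (w (fst p) - w (snd p))\<^sup>2"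
      using inside by eventually_elim (auto intro: wu(2))
  qed (use iw in simp)
  have w2: "(\<integral>p. (w (fst p) - w (snd p))\<^sup>2 \<partial>energy_measure \<Omega>) \<ge> 0" by simp
  have Ew0: "E_form w = 0" and w20: "(\<integral>p. (w (fst p) - w (snd p))\<^sup>2 \<partial>energy_measure \<Omega>) = 0"
    using mono[unfolded Bochner_Integration.integral_minus] E0 w2 by linarith+
  have "AE p in energy_measure \<Omega>. (w (fst p) - w (snd p))\<^sup>2 = 0"
    using integral_nonneg_eq_0_iff_AE[OF iw] w20 by simp
  then have "AE p in lborel. 0 < ennreal (indicator (\<Omega> \<times> \<Omega>) p / norm (fst p - snd p) ^ DIM('a)) \<longrightarrow> (w (fst p) - w (snd p))\<^sup>2 = 0"
    unfolding energy_measure_def using borel_measurable_kernel_density[OF \<Omega>m] by (subst (asm) AE_density) auto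
  \<comment> \<open>The density is positive off the diagonal; on it, where the density is 0, the
    claim is trivial.\<close>
  then have "AE p in lborel. p \<in> \<Omega> \<times> \<Omega> \<longrightarrow> w (fst p) = w (snd p)"
  proof eventually_elim
    case (elim p)
    then show ?case by (cases "fst p = snd p") (auto simp: indicator_def zero_less_power)
  qed
  then have "AE p in lborel \<Otimes>\<^sub>M lborel. p \<in> \<Omega> \<times> \<Omega> \<longrightarrow> w (fst p) = w (snd p)"
    unfolding lborel_prod .
  from lborel_pair.AE_pair[OF this]
  have const: "AE x in lborel. AE y in lborel. x \<in> \<Omega> \<and> y \<in> \<Omega> \<longrightarrow> w x = w y" by simp
  \<comment> \<open>For a nonpositive integrand the L1 norm is minus the integral, which the
    supersolution inequality bounds by \<open>?c * E_form (f n)\<close>, and this tends to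
    \<open>?c * E_form w = 0\<close>. Along a subsequence the integrand thus tends to 0 almost
    everywhere, which yields (h + rho) u w = 0.\<close>
  have "(\<lambda>n. \<integral>x. norm (?h x * (u x * f n x)) \<partial>lborel) \<longlonglongrightarrow> 0"
  proof (rule tendsto_sandwich[OF _ _ tendsto_const])
    show "(\<lambda>n. ?c * E_form (f n)) \<longlonglongrightarrow> 0"
      using tendsto_mult_left[OF A, of ?c] Ew0 by simp
    have "(LBINT x. norm (?h x * (u x * f n x))) = - (LBINT x. ?h x * (u x * f n x))" for n
    proof -
      have "(\<lambda>x. norm (?h x * (u x * f n x))) = (\<lambda>x. - (?h x * (u x * f n x)))"
        unfolding real_norm_def abs_of_nonpos[OF neg] ..
      then show ?thesis by simp
    qed
    then show "\<forall>\<^sub>F n in sequentially. (LBINT x. norm (?h x * (u x * f n x))) \<le> ?c * E_form (f n)"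
      using ext(2) by (intro always_eventually allI) (smt (verit))
  qed (auto intro!: always_eventually)
  from tendsto_L1_AE_subseq[OF ext(1) this] obtain r :: "nat \<Rightarrow> nat" where
    r: "strict_mono r" "AE x in lborel. (\<lambda>n. ?h x * (u x * f (r n) x)) \<longlonglongrightarrow> 0" by blast
  obtain G where G: "open G" "G \<noteq> {}" "G \<subseteq> \<Omega>" "\<And>x. x \<in> G \<Longrightarrow> h_fun \<Omega> x > - rho_const DIM('a)"
    using h_fun_large[OF o b, of "- rho_const DIM('a)"] \<Omega> by (auto simp: bounded_lipschitz_domain_def)
  have wG: "AE x in lborel. x \<in> G \<longrightarrow> w x = 0"
    using r(2)
  proof eventually_elim
    case (elim x)
    show ?case
    proof
      assume x: "x \<in> G"
      then have x\<Omega>: "x \<in> \<Omega>" using G by auto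
      have "(\<lambda>n. \<eta> (r n) x) \<longlonglongrightarrow> 1"
        using LIMSEQ_subseq_LIMSEQ[OF \<eta>1[OF x\<Omega>] r(1)] by (simp add: comp_def)
      then have "(\<lambda>n. ?h x * (u x * (\<eta> (r n) x * w x))) \<longlonglongrightarrow> ?h x * (u x * (1 * w x))"
        by (intro tendsto_intros)
      then have "?h x * (u x * (1 * w x)) = 0"
        using elim LIMSEQ_unique unfolding f_def by blast
      then have "u x = 0 \<or> w x = 0" using G(4)[OF x] by simp
      then show "w x = 0" using x\<Omega> by (auto simp: w_def)
    qed
  qed
  \<comment> \<open>A typical \<open>x\<close> with \<open>w x\<close> nonzero would share this
    value with almost every point of \<open>G\<close>, where \<open>w\<close> vanishes almost
    everywhere; the nonempty open set \<open>G\<close> would then be null.\<close>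
  have "AE x in lborel. x \<in> \<Omega> \<longrightarrow> w x = 0"
    using const
  proof eventually_elim
    case (elim x)
    show ?case
    proof (intro impI, rule ccontr)
      assume x: "x \<in> \<Omega>" "w x \<noteq> 0"
      have "AE y in lborel. y \<notin> G"
        using elim wG by eventually_elim (use x G(3) in auto)
      then have "emeasure lborel G = 0"
        using G(1) by (subst (asm) AE_iff_measurable[of G]) auto
      moreover obtain z e where "e > 0" "ball z e \<subseteq> G" using G(1,2) openE by blast
      moreover have "emeasure lborel (ball z e) > 0"
        using \<open>e > 0\<close> unit_ball_vol_pos[of "real DIM('a)"] by (simp add: emeasure_ball less_le)
      ultimately show False
        using emeasure_mono[of "ball z e" G lborel] G(1) by simp
    qed
  qed
  then show ?thesis
  proof eventually_elim
    case (elim x)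
    then show ?case
      using u_nonneg[of x] by (cases "x \<in> \<Omega>") (auto simp: w_def min_def max_def split: if_splits)
  qed
qed

end

text \<open>What is left is to replace a class modulo null sets by a suitable representative:
  hypotheses and conclusion are all insensitive to null sets, whereas
  \<open>supersolution_nonneg\<close> asks for a Borel function that is nonnegative at every point
  outside \<Omega>.\<close>

lemma maximum_principle_if_h_nonneg:
  fixes \<Omega> :: "'a::euclidean_space set"
  assumes \<Omega>: "bounded_lipschitz_domain \<Omega>"
    and hpos: "\<And>x. x \<in> \<Omega> \<Longrightarrow> 0 \<le> h_fun \<Omega> x + rho_const DIM('a)"
  shows "maximum_principle \<Omega>"
  unfolding maximum_principle_def
proof (intro ballI impI, elim conjE)
  fix u assume u: "u \<in> V_space \<Omega>" and super: "L_Delta_nonneg \<Omega> u"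
    and outside: "AE x in lebesgue. x \<notin> \<Omega> \<longrightarrow> 0 \<le> u x"
  have o: "open \<Omega>" and b: "bounded \<Omega>" using \<Omega> by (auto simp: bounded_lipschitz_domain_def)
  have [measurable]: "\<Omega> \<in> sets borel" using o by simp
  have "u \<in> borel_measurable lebesgue" using u by (intro L1_0_imp_measurable) (auto simp: V_space_def)
  then obtain g where g: "g \<in> borel_measurable borel" "AE x in lborel. u x = g x"
    using completion_ex_borel_measurable_real[of u lborel] by auto
  note [measurable] = g(1)
  \<comment> \<open>Cutting off negative values outside \<Omega> alters the Borel version only on a
    null set, by the sign condition there.\<close>
  define v where "v x = (if x \<in> \<Omega> then g x else max 0 (g x))" for x
  have v: "v \<in> borel_measurable borel" unfolding v_def[abs_def] by measurable
  have "AE x in lborel. x \<notin> \<Omega> \<longrightarrow> 0 \<le> u x" using outside by (simp add: AE_completion_iff)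
  with g(2) have ae: "AE x in lborel. u x = v x" by eventually_elim (auto simp: v_def)
  note energy = V_space_energy[OF o b u v ae]
  have "L_Delta_nonneg \<Omega> v"
    unfolding L_Delta_nonneg_def
  proof (intro ballI impI)
    fix \<phi> assume \<phi>: "\<phi> \<in> test_functions \<Omega>" "\<forall>x. 0 \<le> \<phi> x"
    then have "\<phi> \<in> borel_measurable borel"
      using C_k_imp_continuous[of 0 \<phi>] by (auto simp: test_functions_def)
    then have "E_L u \<phi> = E_L v \<phi>" using v ae by (intro E_L_cong_AE)
    then show "0 \<le> E_L v \<phi>" using super \<phi> by (auto simp: L_Delta_nonneg_def)
  qed
  moreover have "0 \<le> v x" if "x \<notin> \<Omega>" for x using that by (simp add: v_def)
  ultimately have "AE x in lborel. 0 \<le> v x"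
    using supersolution_nonneg[OF \<Omega> v energy(1) _ energy(2) _ hpos] by blast
  with ae have "AE x in lborel. 0 \<le> u x" by eventually_elim simp
  then show "AE x in lebesgue. 0 \<le> u x" by (simp add: AE_completion_iff)
qed

text \<open>With \<open>r\<close> the radius of a ball of the same volume as \<Omega>, the factor
  \<open>unit_ball_vol\<close> cancels from the hypothesis; taking logarithms and multiplying by 2/N
  turns it into 2 ln r \<le> rho_N. The constant in the volume bound is thus the one at which the
  lower bound -2 ln r for h equals -rho_N.\<close>

lemma h_nonneg_if_volume_small:
  fixes \<Omega> :: "'a::euclidean_space set"
  assumes \<Omega>: "open \<Omega>" "bounded \<Omega>" and x: "x \<in> \<Omega>"
    and vol: "measure lborel \<Omega> \<le> 2 ^ DIM('a) *
      exp (real DIM('a) / 2 * (Digamma (real DIM('a) / 2) - euler_mascheroni)) * unit_ball_vol (real DIM('a))"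
  shows "0 \<le> h_fun \<Omega> x + rho_const DIM('a)"
proof -
  let ?N = "DIM('a)" and ?v = "unit_ball_vol (real DIM('a))"
  have v: "?v > 0" by simp
  have v0: "?v \<noteq> 0" using v by (metis less_irrefl)
  \<comment> \<open>A ball inside \<Omega> makes the volume positive, so that \<open>r > 0\<close>
    and its logarithm can be used.\<close>
  obtain e where "e > 0" "ball x e \<subseteq> \<Omega>" using \<Omega>(1) x openE by blast
  then have "emeasure lborel (ball x e) \<le> emeasure lborel \<Omega>" using \<Omega>(1) by (intro emeasure_mono) auto
  moreover have "emeasure lborel (ball x e) > 0"
    using \<open>e > 0\<close> v0 by (simp add: emeasure_ball less_le)
  ultimately have pos: "measure lborel \<Omega> > 0"
    using emeasure_bounded_finite[OF \<Omega>(2)] by (simp add: measure_def enn2real_positive_iff)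
  define r where "r = root ?N (measure lborel \<Omega> / ?v)"
  have q: "measure lborel \<Omega> / ?v > 0" using pos v by (rule divide_pos_pos)
  have r: "r > 0" "r ^ ?N = measure lborel \<Omega> / ?v"
    using q by (simp_all add: r_def)
  have "r ^ ?N \<le> 2 ^ ?N * exp (real ?N / 2 * (Digamma (real ?N / 2) - euler_mascheroni))"
    unfolding r(2) using vol v by (simp add: pos_divide_le_eq)
  then have "ln (r ^ ?N) \<le> ln (2 ^ ?N * exp (real ?N / 2 * (Digamma (real ?N / 2) - euler_mascheroni)))"
    using r(1) by simp
  then have "real ?N * ln r \<le> real ?N * (ln 2 + (Digamma (real ?N / 2) - euler_mascheroni) / 2)"
    using r(1) by (simp add: ln_mult ln_realpow distrib_left)
  then have "ln r \<le> ln 2 + (Digamma (real ?N / 2) - euler_mascheroni) / 2" by simp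
  moreover have "2 * l \<le> 2 * a + D - g" if "l \<le> a + (D - g) / 2" for l a D g :: real
    using that[unfolded diff_divide_distrib] by linarith
  ultimately have "2 * ln r \<le> rho_const ?N" unfolding rho_const_def by blast
  moreover have "h_fun \<Omega> x \<ge> - 2 * ln r"
    by (rule h_fun_ge_ball[OF \<Omega> x r(1)]) (use r(2) v0 in simp)
  ultimately show ?thesis by linarith
qed

theorem corollary1p9:
  fixes \<Omega> :: "(real ^ 'n) set"
  assumes "bounded_lipschitz_domain \<Omega>"
    and "(\<forall>x\<in>\<Omega>. h_fun \<Omega> x + rho_const CARD('n) \<ge> 0) \<or>
         measure lebesgue \<Omega> \<le>
           2 ^ CARD('n) * exp (real CARD('n) / 2 * (Digamma (real CARD('n) / 2) - euler_mascheroni))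
             * measure lebesgue (ball (0 :: real ^ 'n) 1)"
  shows "maximum_principle \<Omega>"
proof (rule maximum_principle_if_h_nonneg[OF assms(1)])
  fix x assume x: "x \<in> \<Omega>"
  have o: "open \<Omega>" and b: "bounded \<Omega>" using assms(1) by (auto simp: bounded_lipschitz_domain_def)
  have N: "DIM(real ^ 'n) = CARD('n)" by simp
  have "measure lebesgue \<Omega> = measure lborel \<Omega>" using o by (intro measure_completion) auto
  moreover have "measure lebesgue (ball (0 :: real ^ 'n) 1) = unit_ball_vol (real CARD('n))"
    using content_ball[of 1 "0 :: real ^ 'n"] by (simp add: measure_completion)
  ultimately show "0 \<le> h_fun \<Omega> x + rho_const DIM(real ^ 'n)"
    using assms(2) x h_nonneg_if_volume_small[OF o b x] unfolding N by auto
qed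

end
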